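(* Let $T$ be a complete first-order $\mathcal{L}$-theory with monster model $\mathbb{U}$, and suppose $T$ has NIP. Let $\pi(x)$ be a partial type and let $0<n<\omega$. The following are equivalent: (1) $\mathrm{opD}(\pi)<n$ (that is, it is not the case that $\mathrm{opD}(\pi)\ge n$). (2) For every model $\mathcal{A}\models T_{n\text{-mlo}}^*$ and every indiscernible picture $I:\mathcal{A}\to\pi(\mathbb{U})$, there exists $j<n$ such that $I$ is an indiscernible picture with respect to $\{<_i : i<n,\ i\neq j\}$.
   Context: Op-dimension: a partial type $\pi(x)$ has op-dimension $\ge n$, written $\mathrm{opD}(\pi)\ge n$, if there exist formulas $\psi_i(x;y_i)$ and sequences $\langle b_{i,j}: j<\omega\rangle$ in $\mathbb{U}$, for $i<n$, such that for every function $f:n\to\omega$ the partial type $$\pi(x)\cup\{\psi_i(x;b_{i,j}) : j<f(i),\ i<n\}\cup\{\neg\psi_i(x;b_{i,j}) : j\ge f(i),\ i<n\}$$ is consistent. Multi-orders: $\mathcal{L}_{n\text{-mlo}}=\{<_0,\dots,<_{n-1}\}$ is the one-sorted language with $n$ binary relation symbols, and $T_{n\text{-mlo}}$ is the theory asserting that each $<_i$ is a linear order. $T_{n\text{-mlo}}^*$ is its model completion, i.e. the theory of the Fraïssé limit of the class of finite models of $T_{n\text{-mlo}}$ ($n$ independent dense linear orders); it has quantifier elimination. Indiscernible pictures: $\pi(\mathbb{U})$ is the set of realizations of $\pi$ in $\mathbb{U}$. For $\mathcal{A}\models T_{n\text{-mlo}}^*$ (possibly uncountable) with universe $A$, an indiscernible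 picture $I:\mathcal{A}\to\pi(\mathbb{U})$ is an injection $I:A\to\pi(\mathbb{U})$ such that for all $0<k<\omega$ and all $\bar a,\bar b\in A^k$, if $\bar a$ and $\bar b$ have the same quantifier-free $\mathcal{L}_{n\text{-mlo}}$-type in $\mathcal{A}$, then $I\bar a$ and $I\bar b$ (coordinatewise images) have the same complete $\mathcal{L}$-type over $\emptyset$ in $\mathbb{U}$. $I$ is an indiscernible picture with respect to $\{<_i: i<n,\ i\ne j\}$ if the same holds whenever $\bar a$ and $\bar b$ merely have the same quantifier-free type in the language (with equality) $\{<_i: i<n,\ i\neq j\}$. *)

theory Defs
  imports Main
begin

unbundle cardinal_syntax

section \<open>First-order logic\<close>

text \<open>A language is a set of function symbols and a set of relation symbols, each paired with its
  arity; constants are function symbols of arity 0.\<close>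

record ('f, 'r) lang =
  funs :: "('f \<times> nat) set"
  rels :: "('r \<times> nat) set"

datatype 'f tm = Var nat | App 'f "'f tm list"

datatype ('f, 'r) fm =
    Eq "'f tm" "'f tm"
  | Rel 'r "'f tm list"
  | Neg "('f, 'r) fm"
  | Imp "('f, 'r) fm" "('f, 'r) fm"
  | All nat "('f, 'r) fm"

fun wf_tm :: "('f, 'r) lang \<Rightarrow> 'f tm \<Rightarrow> bool" where
  "wf_tm L (Var i) = True"
| "wf_tm L (App f ts) = ((f, length ts) \<in> funs L \<and> (\<forall>t\<in>set ts. wf_tm L t))"

fun wf_fm :: "('f, 'r) lang \<Rightarrow> ('f, 'r) fm \<Rightarrow> bool" where
  "wf_fm L (Eq s t) = (wf_tm L s \<and> wf_tm L t)"
| "wf_fm L (Rel r ts) = ((r, length ts) \<in> rels L \<and> (\<forall>t\<in>set ts. wf_tm L t))"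
| "wf_fm L (Neg \<phi>) = wf_fm L \<phi>"
| "wf_fm L (Imp \<phi> \<psi>) = (wf_fm L \<phi> \<and> wf_fm L \<psi>)"
| "wf_fm L (All x \<phi>) = wf_fm L \<phi>"

fun fv_tm :: "'f tm \<Rightarrow> nat set" where
  "fv_tm (Var i) = {i}"
| "fv_tm (App f ts) = (\<Union>t\<in>set ts. fv_tm t)"

fun fv :: "('f, 'r) fm \<Rightarrow> nat set" where
  "fv (Eq s t) = fv_tm s \<union> fv_tm t"
| "fv (Rel r ts) = (\<Union>t\<in>set ts. fv_tm t)"
| "fv (Neg \<phi>) = fv \<phi>"
| "fv (Imp \<phi> \<psi>) = fv \<phi> \<union> fv \<psi>"
| "fv (All x \<phi>) = fv \<phi> - {x}"

fun qfree :: "('f, 'r) fm \<Rightarrow> bool" where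
  "qfree (Eq s t) = True"
| "qfree (Rel r ts) = True"
| "qfree (Neg \<phi>) = qfree \<phi>"
| "qfree (Imp \<phi> \<psi>) = (qfree \<phi> \<and> qfree \<psi>)"
| "qfree (All x \<phi>) = False"

text \<open>A formula in the tuple of variables \<open>(v\<^sub>0, \<dots>, v\<^sub>k\<^sub>-\<^sub>1)\<close>.  A partitioned formula
  \<open>\<phi>(x;y)\<close> with \<open>|x| = k\<close> and \<open>|y| = m\<close> is a formula in \<open>k + m\<close> variables,
  the first \<open>k\<close> of which form \<open>x\<close>.\<close>

definition formula :: "('f, 'r) lang \<Rightarrow> nat \<Rightarrow> ('f, 'r) fm \<Rightarrow> bool" where
  "formula L k \<phi> \<longleftrightarrow> wf_fm L \<phi> \<and> fv \<phi> \<subseteq> {..<k}"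

abbreviation sentence :: "('f, 'r) lang \<Rightarrow> ('f, 'r) fm \<Rightarrow> bool" where
  "sentence L \<equiv> formula L 0"

record ('f, 'r, 'm) struct =
  univ :: "'m set"
  fun_int :: "'f \<Rightarrow> 'm list \<Rightarrow> 'm"
  rel_int :: "'r \<Rightarrow> 'm list \<Rightarrow> bool"

definition tuples :: "('f, 'r, 'm) struct \<Rightarrow> nat \<Rightarrow> 'm list set" where
  "tuples M k = {a. length a = k \<and> set a \<subseteq> univ M}"

definition is_struct :: "('f, 'r) lang \<Rightarrow> ('f, 'r, 'm) struct \<Rightarrow> bool" where
  "is_struct L M \<longleftrightarrow>
     univ M \<noteq> {} \<and> (\<forall>(f, k)\<in>funs L. \<forall>a\<in>tuples M k. fun_int M f a \<in> univ M)"

fun eval :: "('f, 'r, 'm) struct \<Rightarrow> (nat \<Rightarrow> 'm) \<Rightarrow> 'f tm \<Rightarrow> 'm" where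
  "eval M v (Var i) = v i"
| "eval M v (App f ts) = fun_int M f (map (eval M v) ts)"

fun sat :: "('f, 'r, 'm) struct \<Rightarrow> (nat \<Rightarrow> 'm) \<Rightarrow> ('f, 'r) fm \<Rightarrow> bool" where
  "sat M v (Eq s t) = (eval M v s = eval M v t)"
| "sat M v (Rel r ts) = rel_int M r (map (eval M v) ts)"
| "sat M v (Neg \<phi>) = (\<not> sat M v \<phi>)"
| "sat M v (Imp \<phi> \<psi>) = (sat M v \<phi> \<longrightarrow> sat M v \<psi>)"
| "sat M v (All x \<phi>) = (\<forall>d\<in>univ M. sat M (v(x := d)) \<phi>)"

text \<open>Satisfaction of a formula in \<open>k\<close> variables by a \<open>k\<close>-tuple; the value of \<open>nth a\<close>
  beyond the length of \<open>a\<close> is irrelevant because of the bound on the free variables.\<close>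

abbreviation holds :: "('f, 'r, 'm) struct \<Rightarrow> ('f, 'r) fm \<Rightarrow> 'm list \<Rightarrow> bool" where
  "holds M \<phi> a \<equiv> sat M (nth a) \<phi>"

definition models :: "('f, 'r) lang \<Rightarrow> ('f, 'r, 'm) struct \<Rightarrow> ('f, 'r) fm set \<Rightarrow> bool" where
  "models L M T \<longleftrightarrow> is_struct L M \<and> (\<forall>\<sigma>\<in>T. holds M \<sigma> [])"

text \<open>Models with universe contained in the type of formulas suffice for entailment:
  that type has cardinality at least \<open>|L| + \<aleph>\<^sub>0\<close>, so by the downward
  Loewenheim-Skolem theorem a satisfiable set of sentences has a model there.\<close>

definition entails :: "('f, 'r) lang \<Rightarrow> ('f, 'r) fm set \<Rightarrow> ('f, 'r) fm \<Rightarrow> bool" where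
  "entails L T \<sigma> \<longleftrightarrow>
     (\<forall>M :: ('f, 'r, ('f, 'r) fm) struct. models L M T \<longrightarrow> holds M \<sigma> [])"

definition complete_theory :: "('f, 'r) lang \<Rightarrow> ('f, 'r) fm set \<Rightarrow> bool" where
  "complete_theory L T \<longleftrightarrow>
     (\<forall>\<sigma>\<in>T. sentence L \<sigma>) \<and>
     (\<exists>M :: ('f, 'r, ('f, 'r) fm) struct. models L M T) \<and>
     (\<forall>\<sigma>. sentence L \<sigma> \<longrightarrow> entails L T \<sigma> \<or> entails L T (Neg \<sigma>))"

definition same_tp ::
  "('f, 'r) lang \<Rightarrow> ('f, 'r, 'm) struct \<Rightarrow> 'm list \<Rightarrow> 'm list \<Rightarrow> bool" where
  "same_tp L M a b \<longleftrightarrow> length a = length b \<and>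
     (\<forall>\<phi>. formula L (length a) \<phi> \<longrightarrow> (holds M \<phi> a \<longleftrightarrow> holds M \<phi> b))"

definition same_qftp ::
  "('f, 'r) lang \<Rightarrow> ('f, 'r, 'm) struct \<Rightarrow> 'm list \<Rightarrow> 'm list \<Rightarrow> bool" where
  "same_qftp L M a b \<longleftrightarrow> length a = length b \<and>
     (\<forall>\<phi>. formula L (length a) \<phi> \<and> qfree \<phi> \<longrightarrow> (holds M \<phi> a \<longleftrightarrow> holds M \<phi> b))"

definition embedding ::
  "('f, 'r) lang \<Rightarrow> ('f, 'r, 'm) struct \<Rightarrow> ('f, 'r, 'n) struct \<Rightarrow> ('m \<Rightarrow> 'n) \<Rightarrow> bool" where
  "embedding L M N h \<longleftrightarrow> h ` univ M \<subseteq> univ N \<and> inj_on h (univ M) \<and>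
     (\<forall>(f, k)\<in>funs L. \<forall>a\<in>tuples M k. h (fun_int M f a) = fun_int N f (map h a)) \<and>
     (\<forall>(r, k)\<in>rels L. \<forall>a\<in>tuples M k. rel_int M r a \<longleftrightarrow> rel_int N r (map h a))"

definition automorphism ::
  "('f, 'r) lang \<Rightarrow> ('f, 'r, 'm) struct \<Rightarrow> ('m \<Rightarrow> 'm) \<Rightarrow> bool" where
  "automorphism L M h \<longleftrightarrow> embedding L M M h \<and> h ` univ M = univ M"


section \<open>Partial types and monster models\<close>

text \<open>A pair \<open>(\<phi>, c)\<close> stands for the formula \<open>\<phi>(x; c)\<close> with parameters \<open>c\<close>,
  where \<open>x\<close> is a \<open>k\<close>-tuple of variables.\<close>

type_synonym ('f, 'r, 'm) ptype = "(('f, 'r) fm \<times> 'm list) set"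

definition type_over ::
  "('f, 'r) lang \<Rightarrow> nat \<Rightarrow> 'm set \<Rightarrow> ('f, 'r, 'm) ptype \<Rightarrow> bool" where
  "type_over L k B \<pi> \<longleftrightarrow> (\<forall>(\<phi>, c)\<in>\<pi>. formula L (k + length c) \<phi> \<and> set c \<subseteq> B)"

definition realizations ::
  "('f, 'r, 'm) struct \<Rightarrow> nat \<Rightarrow> ('f, 'r, 'm) ptype \<Rightarrow> 'm list set" where
  "realizations M k \<pi> = {a \<in> tuples M k. \<forall>(\<phi>, c)\<in>\<pi>. holds M \<phi> (a @ c)}"

text \<open>Consistency with the elementary diagram of \<open>M\<close>, i.e. finite satisfiability in
  \<open>M\<close>.  Being realized in \<open>M\<close> is not required.\<close>

definition consistent ::
  "('f, 'r, 'm) struct \<Rightarrow> nat \<Rightarrow> ('f, 'r, 'm) ptype \<Rightarrow> bool" where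
  "consistent M k \<pi> \<longleftrightarrow> (\<forall>\<pi>\<^sub>0. \<pi>\<^sub>0 \<subseteq> \<pi> \<and> finite \<pi>\<^sub>0 \<longrightarrow> realizations M k \<pi>\<^sub>0 \<noteq> {})"

text \<open>A cardinal is represented by a relation \<open>\<kappa>\<close> with \<open>Card_order \<kappa>\<close>.\<close>

definition saturated :: "('f, 'r) lang \<Rightarrow> 'k rel \<Rightarrow> ('f, 'r, 'm) struct \<Rightarrow> bool" where
  "saturated L \<kappa> M \<longleftrightarrow>
     (\<forall>B k \<pi>. B \<subseteq> univ M \<and> |B| <o \<kappa> \<and> type_over L k B \<pi> \<and> consistent M k \<pi> \<longrightarrow>
        realizations M k \<pi> \<noteq> {})"

definition strongly_homogeneous ::
  "('f, 'r) lang \<Rightarrow> 'k rel \<Rightarrow> ('f, 'r, 'm) struct \<Rightarrow> bool" where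
  "strongly_homogeneous L \<kappa> M \<longleftrightarrow>
     (\<forall>B g. B \<subseteq> univ M \<and> |B| <o \<kappa> \<and> g ` B \<subseteq> univ M \<and>
        (\<forall>a. set a \<subseteq> B \<longrightarrow> same_tp L M a (map g a)) \<longrightarrow>
        (\<exists>h. automorphism L M h \<and> (\<forall>x\<in>B. h x = g x)))"

text \<open>The set of all \<open>L\<close>-formulas has cardinality \<open>|L| + \<aleph>\<^sub>0\<close>.  "Small" means
  of cardinality less than \<open>\<kappa>\<close>.\<close>

definition monster ::
  "('f, 'r) lang \<Rightarrow> ('f, 'r) fm set \<Rightarrow> 'k rel \<Rightarrow> ('f, 'r, 'm) struct \<Rightarrow> bool" where
  "monster L T \<kappa> M \<longleftrightarrow> models L M T \<and> Card_order \<kappa> \<and> |{\<phi>. wf_fm L \<phi>}| <o \<kappa> \<and>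
     saturated L \<kappa> M \<and> strongly_homogeneous L \<kappa> M"

definition partial_type ::
  "('f, 'r) lang \<Rightarrow> 'k rel \<Rightarrow> ('f, 'r, 'm) struct \<Rightarrow> nat \<Rightarrow> ('f, 'r, 'm) ptype \<Rightarrow> bool" where
  "partial_type L \<kappa> M k \<pi> \<longleftrightarrow>
     (\<exists>B. B \<subseteq> univ M \<and> |B| <o \<kappa> \<and> type_over L k B \<pi>)"

text \<open>The independence property and its negation, evaluated in the monster model \<open>M\<close> of a
  complete theory.\<close>

definition has_IP ::
  "('f, 'r, 'm) struct \<Rightarrow> nat \<Rightarrow> nat \<Rightarrow> ('f, 'r) fm \<Rightarrow> bool" where
  "has_IP M p q \<phi> \<longleftrightarrow>
     (\<exists>(a :: nat \<Rightarrow> 'm list) (b :: nat set \<Rightarrow> 'm list).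
        (\<forall>i. a i \<in> tuples M p) \<and> (\<forall>S. b S \<in> tuples M q) \<and>
        (\<forall>i S. holds M \<phi> (a i @ b S) \<longleftrightarrow> i \<in> S))"

definition NIP :: "('f, 'r) lang \<Rightarrow> ('f, 'r, 'm) struct \<Rightarrow> bool" where
  "NIP L M \<longleftrightarrow> (\<forall>p q \<phi>. formula L (p + q) \<phi> \<longrightarrow> \<not> has_IP M p q \<phi>)"

definition opD_ge ::
  "('f, 'r) lang \<Rightarrow> ('f, 'r, 'm) struct \<Rightarrow> nat \<Rightarrow> ('f, 'r, 'm) ptype \<Rightarrow> nat \<Rightarrow> bool" where
  "opD_ge L M k \<pi> n \<longleftrightarrow>
     (\<exists>(m :: nat \<Rightarrow> nat) (\<psi> :: nat \<Rightarrow> ('f, 'r) fm) (b :: nat \<Rightarrow> nat \<Rightarrow> 'm list).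
        (\<forall>i<n. formula L (k + m i) (\<psi> i) \<and> (\<forall>j. b i j \<in> tuples M (m i))) \<and>
        (\<forall>f :: nat \<Rightarrow> nat. consistent M k
           (\<pi> \<union> {(\<psi> i, b i j) | i j. i < n \<and> j < f i}
              \<union> {(Neg (\<psi> i), b i j) | i j. i < n \<and> j \<ge> f i})))"


section \<open>Multi-orders and indiscernible pictures\<close>

text \<open>The relational language \<open>{<\<^sub>i : i \<in> J}\<close>; the type of function symbols is a dummy.\<close>

definition mlo_lang :: "nat set \<Rightarrow> (unit, nat) lang" where
  "mlo_lang J = \<lparr>funs = {}, rels = {(i, 2) | i. i \<in> J}\<rparr>"

abbreviation Lt :: "nat \<Rightarrow> nat \<Rightarrow> nat \<Rightarrow> (unit, nat) fm" where
  "Lt i x y \<equiv> Rel i [Var x, Var y]"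

definition T_mlo :: "nat \<Rightarrow> (unit, nat) fm set" where
  "T_mlo n = (\<Union>i<n.
     {All 0 (Neg (Lt i 0 0)),
      All 0 (All 1 (All 2 (Imp (Lt i 0 1) (Imp (Lt i 1 2) (Lt i 0 2))))),
      All 0 (All 1 (Imp (Neg (Eq (Var 0) (Var 1))) (Imp (Neg (Lt i 0 1)) (Lt i 1 0))))})"

text \<open>The Fraisse limit of the class of finite models of \<open>T_mlo n\<close>: the countable
  (universe in \<open>nat\<close>) ultrahomogeneous structure whose age is that class.  The language is
  relational, so finitely generated substructures are finite subsets, and finite structures may be
  taken to have universe in \<open>nat\<close>.\<close>

definition mlo_fraisse_limit :: "nat \<Rightarrow> (unit, nat, nat) struct \<Rightarrow> bool" where
  "mlo_fraisse_limit n F \<longleftrightarrow> (let L = mlo_lang {..<n} in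
     is_struct L F \<and>
     (\<forall>B :: (unit, nat, nat) struct. is_struct L B \<and> finite (univ B) \<longrightarrow>
        (models L B (T_mlo n) \<longleftrightarrow> (\<exists>h. embedding L B F h))) \<and>
     (\<forall>S h. S \<subseteq> univ F \<and> finite S \<and> embedding L (F\<lparr>univ := S\<rparr>) F h \<longrightarrow>
        (\<exists>g. automorphism L F g \<and> (\<forall>x\<in>S. g x = h x))))"

text \<open>The complete theory of the Fraisse limit, which is unique up to isomorphism.\<close>

definition T_mlo_star :: "nat \<Rightarrow> (unit, nat) fm set" where
  "T_mlo_star n =
     {\<sigma>. sentence (mlo_lang {..<n}) \<sigma> \<and> (\<forall>F. mlo_fraisse_limit n F \<longrightarrow> holds F \<sigma> [])}"

text \<open>\<open>I : A \<rightarrow> \<pi>(M)\<close> is an indiscernible picture with respect to \<open>{<\<^sub>i : i \<in> J}\<close>.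
  The coordinatewise image of a tuple of elements of \<open>A\<close> is a tuple of \<open>k\<close>-tuples, which
  is flattened.\<close>

definition indisc_picture ::
  "('f, 'r) lang \<Rightarrow> ('f, 'r, 'm) struct \<Rightarrow> nat \<Rightarrow> ('f, 'r, 'm) ptype \<Rightarrow> nat set \<Rightarrow>
   (unit, nat, 'b) struct \<Rightarrow> ('b \<Rightarrow> 'm list) \<Rightarrow> bool" where
  "indisc_picture L M k \<pi> J A I \<longleftrightarrow>
     inj_on I (univ A) \<and> I ` univ A \<subseteq> realizations M k \<pi> \<and>
     (\<forall>l>0. \<forall>a\<in>tuples A l. \<forall>b\<in>tuples A l.
        same_qftp (mlo_lang J) A a b \<longrightarrow>
        same_tp L M (concat (map I a)) (concat (map I b)))"

end

(* If opD(pi) >= n, the realizations a_f are indexed by functions f, so placing the i-th coordinates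
   of the points of a multi-order in the i-th of n consecutive blocks of omega assigns realizations
   of pi to the points of any finite multi-order.  By Ramsey's theorem and compactness this becomes
   an indiscernible picture of a countable model in which psi_i separates every <_i-initial segment
   of a finite set from its complement.  If the picture did not depend on <_j, all subsets of an
   infinite set would be separated by psi_j in this way, contradicting NIP.

   Conversely, if a picture depends on every <_j, then for each j moving some single element of a
   tuple past its <_j-successor y changes the type of its image.  In a box given by an open interval
   in each order, such moves for all j < n can be set up independently, with a <_j-increasing
   sequence of copies of y crossing the box only in the order <_j.  The points of the box then
   realize an n-dimensional pattern. *)

theory Submission
  imports Defs "HOL-Library.Ramsey" "HOL-Library.Countable_Set" "HOL.Rat"
begin

section \<open>Renaming of variables\<close>

text \<open>Models of \<open>T_mlo_star n\<close> are handled only through \<open>rich\<close>: one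
  point can be found simultaneously in n given cuts, each with finitely many bounds. Being a scheme
  of sentences, this passes from the Fraisse limit to models of every cardinality, and it supplies
  all points that boxes and moves require. Conversely, back and forth makes every rich structure a
  model, so one construction by rational coordinates both shows that a limit exists and yields the
  domain of the picture. The formal obstacle is compactness. \<open>saturated\<close> realizes types
  in finitely many variables, whereas a picture consists of infinitely many tuples; it has to be
  found as one valuation of countably many variables, chosen value by value. Two tuples that agree
  in all orders but \<open>j\<close> may differ arbitrarily in the order \<open>j\<close>. Sorting
  one into the other by adjacent moves isolates a single moved element, and a difference of this
  kind is what one free point of a box can reproduce.\<close>

lemma finite_fv_tm [simp]: "finite (fv_tm t)"
  by (induction t) auto

lemma finite_fv [simp]: "finite (fv \<phi>)"
  by (induction \<phi>) auto

lemma eval_cong: "(\<And>i. i \<in> fv_tm t \<Longrightarrow> v i = w i) \<Longrightarrow> eval M v t = eval M w t"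
proof (induction t)
  case (App f ts)
  then have "map (eval M v) ts = map (eval M w) ts"
    by (intro map_cong) auto
  then show ?case by (metis eval.simps(2))
qed simp

lemma sat_cong: "(\<And>i. i \<in> fv \<phi> \<Longrightarrow> v i = w i) \<Longrightarrow> sat M v \<phi> = sat M w \<phi>"
proof (induction \<phi> arbitrary: v w)
  case (Eq s t)
  then have "eval M v s = eval M w s" "eval M v t = eval M w t"
    by (auto intro: eval_cong)
  then show ?case by simp
next
  case (Rel r ts)
  then have "map (eval M v) ts = map (eval M w) ts"
    by (intro map_cong) (auto intro: eval_cong)
  then show ?case by (metis sat.simps(2))
next
  case (Neg \<phi>)
  have "sat M v \<phi> = sat M w \<phi>" using Neg.prems by (intro Neg.IH) auto
  then show ?case by simp
next
  case (Imp \<phi> \<psi>)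
  have "sat M v \<phi> = sat M w \<phi>" using Imp.prems by (intro Imp.IH(1)) auto
  moreover have "sat M v \<psi> = sat M w \<psi>" using Imp.prems by (intro Imp.IH(2)) auto
  ultimately show ?case by simp
next
  case (All x \<phi>)
  have "sat M (v(x := d)) \<phi> = sat M (w(x := d)) \<phi>" for d
    using All.prems by (intro All.IH) auto
  then show ?case by simp
qed

fun ren_tm :: "(nat \<Rightarrow> nat) \<Rightarrow> 'f tm \<Rightarrow> 'f tm" where
  "ren_tm g (Var i) = Var (g i)"
| "ren_tm g (App f ts) = App f (map (ren_tm g) ts)"

lemma eval_ren_tm: "eval M v (ren_tm g t) = eval M (v \<circ> g) t"
proof (induction t)
  case (App f ts)
  then have "map (eval M v \<circ> ren_tm g) ts = map (eval M (v \<circ> g)) ts"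
    by (intro map_cong) (auto simp: comp_def)
  then show ?case by (metis eval.simps(2) list.map_comp ren_tm.simps(2))
qed simp

lemma wf_ren_tm: "wf_tm L t \<Longrightarrow> wf_tm L (ren_tm g t)"
  by (induction t) auto

lemma fv_ren_tm: "fv_tm (ren_tm g t) = g ` fv_tm t"
  by (induction t) auto

text \<open>Asserting mere existence avoids a definition of capture-avoiding substitution. The map
  \<open>g\<close> may identify variables, and several later uses rely on that.\<close>

lemma ex_rename:
  fixes M :: "('f, 'r, 'm) struct"
  assumes "wf_fm L \<phi>"
  shows "\<exists>\<phi>'. wf_fm L \<phi>' \<and> fv \<phi>' \<subseteq> g ` fv \<phi> \<and> (\<forall>v. sat M v \<phi>' = sat M (v \<circ> g) \<phi>)"
  using assms
proof (induction \<phi> arbitrary: g)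
  case (Eq s t)
  then show ?case
    by (intro exI[of _ "Eq (ren_tm g s) (ren_tm g t)"])
      (auto simp: eval_ren_tm fv_ren_tm wf_ren_tm comp_def)
next
  case (Rel r ts)
  have "map (eval M v \<circ> ren_tm g) ts = map (eval M (v \<circ> g)) ts" for v
    by (intro map_cong) (auto simp: eval_ren_tm)
  then have "\<forall>v. sat M v (Rel r (map (ren_tm g) ts)) = sat M (v \<circ> g) (Rel r ts)"
    by (metis list.map_comp sat.simps(2))
  with Rel show ?case
    by (intro exI[of _ "Rel r (map (ren_tm g) ts)"]) (auto simp: fv_ren_tm wf_ren_tm comp_def)
next
  case (Neg \<phi>)
  then obtain \<phi>' where "wf_fm L \<phi>'" "fv \<phi>' \<subseteq> g ` fv \<phi>" "\<forall>v. sat M v \<phi>' = sat M (v \<circ> g) \<phi>"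
    by (metis wf_fm.simps(3))
  then show ?case by (intro exI[of _ "Neg \<phi>'"]) (auto simp: comp_def)
next
  case (Imp \<phi> \<psi>)
  then obtain \<phi>' \<psi>' where "wf_fm L \<phi>'" "fv \<phi>' \<subseteq> g ` fv \<phi>" "\<forall>v. sat M v \<phi>' = sat M (v \<circ> g) \<phi>"
    "wf_fm L \<psi>'" "fv \<psi>' \<subseteq> g ` fv \<psi>" "\<forall>v. sat M v \<psi>' = sat M (v \<circ> g) \<psi>"
    by (metis wf_fm.simps(4))
  then show ?case by (intro exI[of _ "Imp \<phi>' \<psi>'"]) (auto simp: comp_def)
next
  case (All x \<phi>)
  \<comment> \<open>\<open>y\<close> avoids the images of all free variables of the body, so the new
    quantifier captures none of them.\<close>
  obtain y where y: "y \<notin> g ` fv \<phi>"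
    using ex_new_if_finite[of "g ` fv \<phi>"] by auto
  obtain \<phi>' where \<phi>': "wf_fm L \<phi>'" "fv \<phi>' \<subseteq> (g(x := y)) ` fv \<phi>"
      "\<forall>v. sat M v \<phi>' = sat M (v \<circ> (g(x := y))) \<phi>"
    using All by (metis wf_fm.simps(5))
  have "sat M (v(y := d) \<circ> g(x := y)) \<phi> = sat M ((v \<circ> g)(x := d)) \<phi>" for v d
    using y by (intro sat_cong) auto
  moreover have "fv (All y \<phi>') \<subseteq> g ` fv (All x \<phi>)"
    using \<phi>'(2) by (auto split: if_splits)
  moreover have "sat M v (All y \<phi>') = sat M (v \<circ> g) (All x \<phi>)" for v
    using \<phi>'(3) calculation(1) by (simp del: comp_apply)
  ultimately show ?case using \<phi>'(1) by (intro exI[of _ "All y \<phi>'"]) (simp only: wf_fm.simps, blast)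
qed


section \<open>Definable conditions on valuations\<close>

text \<open>Parameters come first and the variables are shifted behind them, because the parameter
  tuple is finite and the valuation is not.\<close>

definition prefix_val :: "'m list \<Rightarrow> (nat \<Rightarrow> 'm) \<Rightarrow> nat \<Rightarrow> 'm" where
  "prefix_val c v i = (if i < length c then c ! i else v (i - length c))"

text \<open>Conditions on an assignment of all variables, so that quantifying and renaming variables needs
  no bookkeeping of tuple lengths; only finitely many variables matter.\<close>

definition vdef ::
  "('f, 'r) lang \<Rightarrow> ('f, 'r, 'm) struct \<Rightarrow> 'm set \<Rightarrow> ((nat \<Rightarrow> 'm) \<Rightarrow> bool) \<Rightarrow> bool" where
  "vdef L M B G \<longleftrightarrow>
     (\<exists>\<phi> c. wf_fm L \<phi> \<and> set c \<subseteq> B \<and> (\<forall>v. G v = sat M (prefix_val c v) \<phi>))"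

lemma vdef_mono: "vdef L M B G \<Longrightarrow> B \<subseteq> B' \<Longrightarrow> vdef L M B' G"
  unfolding vdef_def by blast

lemma vdef_neg: "vdef L M B G \<Longrightarrow> vdef L M B (\<lambda>v. \<not> G v)"
  unfolding vdef_def by (metis wf_fm.simps(3) sat.simps(3))

lemma vdef_ex: 
  assumes "vdef L M B G"
  shows "vdef L M B (\<lambda>v. \<exists>d\<in>univ M. G (v(x := d)))"
proof -
  obtain \<phi> c where \<phi>: "wf_fm L \<phi>" "set c \<subseteq> B" "\<And>v. G v = sat M (prefix_val c v) \<phi>"
    using assms unfolding vdef_def by auto
  have "prefix_val c (v(x := d)) = (prefix_val c v)(length c + x := d)" for v d
    by (rule ext) (auto simp: prefix_val_def)
  then show ?thesis unfolding vdef_def using \<phi>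
    by (intro exI[of _ "Neg (All (length c + x) (Neg \<phi>))"] exI[of _ c]) auto
qed

text \<open>Values fixed earlier become parameters here, and \<open>g\<close> renames or identifies
  the variables that follow them.\<close>

lemma vdef_subst:
  assumes "vdef L M B G" "set a \<subseteq> B"
  shows "vdef L M B (\<lambda>v. G (prefix_val a (v \<circ> g)))"
proof -
  obtain \<phi> c where \<phi>: "wf_fm L \<phi>" "set c \<subseteq> B" "\<And>v. G v = sat M (prefix_val c v) \<phi>"
    using assms unfolding vdef_def by auto
  define h where "h i = (if i < length (c @ a) then i else length (c @ a) + g (i - length (c @ a)))" for i
  obtain \<phi>' where \<phi>': "wf_fm L \<phi>'" "\<forall>v. sat M v \<phi>' = sat M (v \<circ> h) \<phi>"
    using ex_rename[OF \<phi>(1)] by metis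
  have "prefix_val c (prefix_val a (v \<circ> g)) = prefix_val (c @ a) v \<circ> h" for v
    by (rule ext) (auto simp: prefix_val_def h_def nth_append)
  then show ?thesis unfolding vdef_def using \<phi> \<phi>' assms(2)
    by (intro exI[of _ \<phi>'] exI[of _ "c @ a"]) auto
qed

lemma vdef_imp:
  assumes "vdef L M B G" "vdef L M B H"
  shows "vdef L M B (\<lambda>v. G v \<longrightarrow> H v)"
proof -
  obtain \<phi> c where \<phi>: "wf_fm L \<phi>" "set c \<subseteq> B" "\<And>v. G v = sat M (prefix_val c v) \<phi>"
    using assms unfolding vdef_def by auto
  obtain \<psi> d where \<psi>: "wf_fm L \<psi>" "set d \<subseteq> B" "\<And>v. H v = sat M (prefix_val d v) \<psi>"
    using assms unfolding vdef_def by auto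
  define h1 where "h1 i = (if i < length c then i else length d + i)" for i
  define h2 where "h2 i = length c + i" for i
  obtain \<phi>' where \<phi>': "wf_fm L \<phi>'" "\<forall>v. sat M v \<phi>' = sat M (v \<circ> h1) \<phi>"
    using ex_rename[OF \<phi>(1)] by metis
  obtain \<psi>' where \<psi>': "wf_fm L \<psi>'" "\<forall>v. sat M v \<psi>' = sat M (v \<circ> h2) \<psi>"
    using ex_rename[OF \<psi>(1)] by metis
  have "prefix_val c v = prefix_val (c @ d) v \<circ> h1"
      "prefix_val d v = prefix_val (c @ d) v \<circ> h2" for v
    by (rule ext, auto simp: prefix_val_def h1_def h2_def nth_append)+
  then show ?thesis unfolding vdef_def using \<phi> \<phi>' \<psi> \<psi>'
    by (intro exI[of _ "Imp \<phi>' \<psi>'"] exI[of _ "c @ d"]) auto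
qed

lemma vdef_True: "vdef L M B (\<lambda>v. True)"
  unfolding vdef_def by (intro exI[of _ "Eq (Var 0) (Var 0)"] exI[of _ "[]"]) auto

lemma vdef_conj: "vdef L M B G \<Longrightarrow> vdef L M B H \<Longrightarrow> vdef L M B (\<lambda>v. G v \<and> H v)"
  using vdef_neg[OF vdef_imp[OF _ vdef_neg, of L M B G H]] by simp

lemma vdef_iff: "vdef L M B G \<Longrightarrow> vdef L M B H \<Longrightarrow> vdef L M B (\<lambda>v. G v \<longleftrightarrow> H v)"
  using vdef_conj[OF vdef_imp vdef_imp, of L M B G H H G] by (auto simp: iff_conv_conj_imp)

lemma vdef_Ball:
  "finite S \<Longrightarrow> (\<And>s. s \<in> S \<Longrightarrow> vdef L M B (G s)) \<Longrightarrow> vdef L M B (\<lambda>v. \<forall>s\<in>S. G s v)"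
  by (induction S rule: finite_induct) (auto intro: vdef_True vdef_conj)

lemma vdef_ex_set:
  assumes "finite X" "vdef L M B G"
  shows "vdef L M B (\<lambda>v. \<exists>w. (\<forall>i. i \<notin> X \<longrightarrow> w i = v i) \<and> w ` X \<subseteq> univ M \<and> G w)"
  using assms(1)
proof (induction X rule: finite_induct)
  case empty
  have "(\<forall>i. w i = v i) \<longleftrightarrow> w = v" for w v :: "nat \<Rightarrow> 'c" by auto
  then show ?case using assms(2) by simp
next
  case (insert x X)
  let ?E = "\<lambda>X v. \<exists>w. (\<forall>i. i \<notin> X \<longrightarrow> w i = v i) \<and> w ` X \<subseteq> univ M \<and> G w"
  have "?E (insert x X) = (\<lambda>v. \<exists>d\<in>univ M. ?E X (v(x := d)))"
  proof (intro ext iffI)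
    fix v assume "?E (insert x X) v"
    then obtain w where "\<forall>i. i \<notin> insert x X \<longrightarrow> w i = v i" "w ` insert x X \<subseteq> univ M" "G w"
      by auto
    then show "\<exists>d\<in>univ M. ?E X (v(x := d))"
      by (intro bexI[of _ "w x"] exI[of _ w]) auto
  next
    fix v assume "\<exists>d\<in>univ M. ?E X (v(x := d))"
    then obtain d w where "d \<in> univ M" "\<forall>i. i \<notin> X \<longrightarrow> w i = (v(x := d)) i" "w ` X \<subseteq> univ M" "G w"
      by auto
    moreover from this insert.hyps have "w x = d" by simp
    ultimately show "?E (insert x X) v" by (intro exI[of _ w]) auto
  qed
  with vdef_ex[OF insert.IH] show ?case by simp
qed

text \<open>The tuple is stored in the variables from \<open>N\<close> on. Since \<open>G d\<close>
  reads only variables below \<open>N\<close>, overwriting these does not disturb the rest of the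
  condition.\<close>

lemma vdef_ex_tuples:
  assumes "vdef L M B (\<lambda>v. G (map v [N..<N + m]) v)"
    and "\<And>d v w. \<forall>i<N. v i = w i \<Longrightarrow> G d v = G d w"
  shows "vdef L M B (\<lambda>v. \<exists>d\<in>tuples M m. G d v)"
proof -
  have "(\<exists>d\<in>tuples M m. G d v) \<longleftrightarrow> (\<exists>w. (\<forall>i. i \<notin> {N..<N + m} \<longrightarrow> w i = v i) \<and>
      w ` {N..<N + m} \<subseteq> univ M \<and> G (map w [N..<N + m]) w)" for v
  proof safe
    fix d assume d: "d \<in> tuples M m" "G d v"
    define w where "w i = (if i \<in> {N..<N + m} then d ! (i - N) else v i)" for i
    have "map w [N..<N + m] = d"
      using d(1) by (intro nth_equalityI) (auto simp: w_def tuples_def)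
    moreover have "w ` {N..<N + m} \<subseteq> univ M"
      using d(1) nth_mem[of _ d] by (fastforce simp: w_def tuples_def)
    moreover have "G d w" using assms(2)[of w v d] d by (simp add: w_def)
    ultimately show "\<exists>w. (\<forall>i. i \<notin> {N..<N + m} \<longrightarrow> w i = v i) \<and>
        w ` {N..<N + m} \<subseteq> univ M \<and> G (map w [N..<N + m]) w"
      by (intro exI[of _ w]) (auto simp: w_def)
  next
    fix w assume w: "\<forall>i. i \<notin> {N..<N + m} \<longrightarrow> w i = v i"
        "w ` {N..<N + m} \<subseteq> univ M" "G (map w [N..<N + m]) w"
    then have "G (map w [N..<N + m]) v" using assms(2)[of w v] by simp
    with w(2) show "\<exists>d\<in>tuples M m. G d v"
      by (intro bexI[of _ "map w [N..<N + m]"]) (auto simp: tuples_def)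
  qed
  with vdef_ex_set[OF _ assms(1), of "{N..<N + m}"] show ?thesis by simp
qed

lemma vdef_holds:
  assumes "formula L (length idx + length c) \<phi>" "set c \<subseteq> B"
  shows "vdef L M B (\<lambda>v. holds M \<phi> (map v idx @ c))"
proof -
  define h where "h i = (if i < length idx then length c + idx ! i else i - length idx)" for i
  obtain \<phi>' where \<phi>': "wf_fm L \<phi>'" "\<forall>v. sat M v \<phi>' = sat M (v \<circ> h) \<phi>"
    using ex_rename[of L \<phi>] assms unfolding formula_def by metis
  have "sat M (nth (map v idx @ c)) \<phi> = sat M (prefix_val c v \<circ> h) \<phi>" for v
    using assms(1) unfolding formula_def
    by (intro sat_cong) (auto simp: prefix_val_def h_def nth_append)
  with \<phi>' assms(2) show ?thesis unfolding vdef_def by (intro exI[of _ \<phi>'] exI[of _ c]) auto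
qed

lemma vdef_finite_support:
  assumes "vdef L M B G"
  obtains N where "\<And>v w. \<forall>i<N. v i = w i \<Longrightarrow> G v = G w"
proof -
  obtain \<phi> c where \<phi>: "\<And>v. G v = sat M (prefix_val c v) \<phi>"
    using assms unfolding vdef_def by auto
  obtain N where N: "fv \<phi> \<subseteq> {..<N}" using finite_nat_bounded[OF finite_fv] by blast
  have "G v = G w" if "\<forall>i<N. v i = w i" for v w
    unfolding \<phi> using N that by (intro sat_cong) (force simp: prefix_val_def)
  then show ?thesis using that by blast
qed


section \<open>Saturation for countably many variables\<close>

text \<open>On constant valuations all variables coincide, so every condition becomes a formula in
  one variable and saturation for 1-types applies.\<close>

lemma saturated_vdef:
  assumes sat: "saturated L \<kappa> M" and B: "B \<subseteq> univ M" "|B| <o \<kappa>"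
    and def: "\<And>G. G \<in> \<Sigma> \<Longrightarrow> vdef L M B G"
    and fin: "\<And>\<Sigma>'. \<Sigma>' \<subseteq> \<Sigma> \<Longrightarrow> finite \<Sigma>' \<Longrightarrow> \<exists>x\<in>univ M. \<forall>G\<in>\<Sigma>'. G (\<lambda>_. x)"
  shows "\<exists>x\<in>univ M. \<forall>G\<in>\<Sigma>. G (\<lambda>_. x)"
proof -
  have "\<exists>p. formula L (1 + length (snd p)) (fst p) \<and> set (snd p) \<subseteq> B \<and>
      (\<forall>x. holds M (fst p) ([x] @ snd p) = G (\<lambda>_. x))" if G: "G \<in> \<Sigma>" for G
  proof -
    obtain \<phi> c where \<phi>: "wf_fm L \<phi>" "set c \<subseteq> B" "\<And>v. G v = sat M (prefix_val c v) \<phi>"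
      using def[OF G] unfolding vdef_def by auto
    \<comment> \<open>\<open>realizations\<close> puts the variable before the parameters: it
      becomes variable 0, and parameter \<open>i\<close> becomes variable
      \<open>Suc i\<close>.\<close>
    define h where "h i = (if i < length c then Suc i else 0)" for i
    obtain \<phi>' where \<phi>': "wf_fm L \<phi>'" "fv \<phi>' \<subseteq> h ` fv \<phi>" "\<forall>v. sat M v \<phi>' = sat M (v \<circ> h) \<phi>"
      using ex_rename[OF \<phi>(1)] by metis
    have "nth ([x] @ c) \<circ> h = prefix_val c (\<lambda>_. x)" for x
      by (auto simp: h_def prefix_val_def)
    moreover have "formula L (1 + length c) \<phi>'"
      using \<phi>' unfolding formula_def h_def by auto
    ultimately show ?thesis using \<phi> \<phi>' by (intro exI[of _ "(\<phi>', c)"]) (simp del: append_Cons)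
  qed
  then obtain p where p: "\<And>G. G \<in> \<Sigma> \<Longrightarrow> formula L (1 + length (snd (p G))) (fst (p G)) \<and>
      set (snd (p G)) \<subseteq> B \<and> (\<forall>x. holds M (fst (p G)) ([x] @ snd (p G)) = G (\<lambda>_. x))"
    by metis
  have real: "realizations M 1 (p ` S) = (\<lambda>x. [x]) ` {x \<in> univ M. \<forall>G\<in>S. G (\<lambda>_. x)}" if "S \<subseteq> \<Sigma>" for S
  proof -
    have "holds M (fst (p G)) ([x] @ snd (p G)) = G (\<lambda>_. x)" if "G \<in> S" for x G
      using that \<open>S \<subseteq> \<Sigma>\<close> p[of G] by (auto simp del: append_Cons)
    then have "(\<forall>q\<in>p ` S. holds M (fst q) ([x] @ snd q)) \<longleftrightarrow> (\<forall>G\<in>S. G (\<lambda>_. x))" for x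
      by (simp del: append_Cons)
    moreover have "tuples M 1 = (\<lambda>x. [x]) ` univ M"
      by (auto simp: tuples_def length_Suc_conv)
    ultimately show ?thesis
      unfolding realizations_def case_prod_unfold by (auto simp del: append_Cons)
  qed
  have "type_over L 1 B (p ` \<Sigma>)"
    using p unfolding type_over_def case_prod_unfold by blast
  moreover have "consistent M 1 (p ` \<Sigma>)"
    unfolding consistent_def
  proof safe
    fix \<pi>0 assume "\<pi>0 \<subseteq> p ` \<Sigma>" "finite \<pi>0" "realizations M 1 \<pi>0 = {}"
    then obtain S where S: "S \<subseteq> \<Sigma>" "finite S" "\<pi>0 = p ` S"
      by (meson finite_subset_image)
    show False using fin[OF S(1,2)] real[OF S(1)] S(3) \<open>realizations M 1 \<pi>0 = {}\<close> by auto
  qed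
  ultimately have "realizations M 1 (p ` \<Sigma>) \<noteq> {}"
    using sat B unfolding saturated_def by blast
  with real[of \<Sigma>] show ?thesis by auto
qed

lemma small_Un_countable:
  assumes "Card_order \<kappa>" "|UNIV :: nat set| <o \<kappa>" "|B| <o \<kappa>" "countable S"
  shows "|B \<union> S| <o \<kappa>"
proof -
  have "\<not> finite (Field \<kappa>)"
    using assms(1,2) by (meson Card_order_iff_ordIso_card_of card_of_ordLeq_infinite
        infinite_UNIV_nat ordIso_iff_ordLeq ordLeq_transitive ordLess_imp_ordLeq)
  moreover obtain f :: "'b \<Rightarrow> nat" where "inj_on f S"
    using assms(4) unfolding countable_def by blast
  then have "|S| \<le>o |UNIV :: nat set|"
    unfolding card_of_ordLeq[symmetric] by blast
  then have "|S| <o \<kappa>" using assms(2) by (rule ordLeq_ordLess_trans)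
  ultimately show ?thesis using assms card_of_Un_ordLess_infinite_Field by blast
qed

text \<open>The values of the variables are chosen one after the other, keeping the type of the remaining
  ones finitely satisfiable.\<close>

proposition omega_saturation:
  assumes sat: "saturated L \<kappa> M" and \<kappa>: "Card_order \<kappa>" "|UNIV :: nat set| <o \<kappa>"
    and B: "B \<subseteq> univ M" "|B| <o \<kappa>"
    and def: "\<And>G. G \<in> \<Gamma> \<Longrightarrow> vdef L M B G"
    and fin: "\<And>\<Gamma>'. \<Gamma>' \<subseteq> \<Gamma> \<Longrightarrow> finite \<Gamma>' \<Longrightarrow> \<exists>v. range v \<subseteq> univ M \<and> (\<forall>G\<in>\<Gamma>'. G v)"
  shows "\<exists>v. range v \<subseteq> univ M \<and> (\<forall>G\<in>\<Gamma>. G v)"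
proof -
  define P where "P a \<longleftrightarrow> set a \<subseteq> univ M \<and> (\<forall>\<Gamma>'. \<Gamma>' \<subseteq> \<Gamma> \<and> finite \<Gamma>' \<longrightarrow>
    (\<exists>v. range v \<subseteq> univ M \<and> (\<forall>i<length a. v i = a ! i) \<and> (\<forall>G\<in>\<Gamma>'. G v)))" for a
  have P_ex: "\<exists>v. range v \<subseteq> univ M \<and> (\<forall>i<length a. v i = a ! i) \<and> (\<forall>G\<in>\<Gamma>'. G v)"
    if "P a" "\<Gamma>' \<subseteq> \<Gamma>" "finite \<Gamma>'" for a \<Gamma>'
    using that unfolding P_def by simp
  have step: "\<exists>x. P (a @ [x])" if a: "P a" for a
  proof -
    define m where "m = length a"
    \<comment> \<open>\<open>H\<close> says that \<open>u 0\<close> can be the next value with the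
      finite set \<Gamma>' still satisfiable. It quantifies over whole valuations, so its
      definability has to be shown.\<close>
    define H where "H \<Gamma>' u \<longleftrightarrow> (\<exists>v. range v \<subseteq> univ M \<and> (\<forall>i<m. v i = a ! i) \<and> v m = u (0::nat) \<and>
      (\<forall>G\<in>\<Gamma>'. G v))" for \<Gamma>' u
    \<comment> \<open>The conditions in \<Gamma>' read only variables below \<open>N\<close>. Hence
      it suffices to quantify over the positions strictly between \<open>m\<close> and
      \<open>N\<close>; all other positions from \<open>m\<close> on repeat the value at
      \<open>m\<close>, which keeps them inside \<open>univ M\<close>.\<close>
    have H: "vdef L M (B \<union> set a) (H' :: (nat \<Rightarrow> _) \<Rightarrow> bool) \<and> (\<forall>x\<in>univ M. H' (\<lambda>_. x) = H \<Gamma>' (\<lambda>_. x))"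
      if \<Gamma>': "\<Gamma>' \<subseteq> \<Gamma>" "finite \<Gamma>'" and H': "H' = (\<lambda>u. \<exists>w. (\<forall>i. i \<notin> {Suc m..<N} \<longrightarrow> w i = prefix_val a (u \<circ> (\<lambda>_. 0)) i) \<and>
          w ` {Suc m..<N} \<subseteq> univ M \<and> (\<forall>G\<in>\<Gamma>'. G w))" and N: "\<And>v w. \<forall>i<N. v i = w i \<Longrightarrow> (\<forall>G\<in>\<Gamma>'. G v) = (\<forall>G\<in>\<Gamma>'. G w)" for \<Gamma>' N H'
    proof -
      have "vdef L M B (\<lambda>v. \<forall>G\<in>\<Gamma>'. G v)" using def \<Gamma>' by (intro vdef_Ball) auto
      then have "vdef L M (B \<union> set a) (\<lambda>v. \<exists>w. (\<forall>i. i \<notin> {Suc m..<N} \<longrightarrow> w i = v i) \<and>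
          w ` {Suc m..<N} \<subseteq> univ M \<and> (\<forall>G\<in>\<Gamma>'. G w))"
        by (intro vdef_ex_set) (auto intro: vdef_mono)
      then have d: "vdef L M (B \<union> set a) H'" unfolding H' by (rule vdef_subst) auto
      have "H' (\<lambda>_. x) = H \<Gamma>' (\<lambda>_. x)" if x: "x \<in> univ M" for x
      proof
        assume "H' (\<lambda>_. x)"
        then obtain w where w: "\<forall>i. i \<notin> {Suc m..<N} \<longrightarrow> w i = prefix_val a (\<lambda>_. x) i"
          "w ` {Suc m..<N} \<subseteq> univ M" "\<forall>G\<in>\<Gamma>'. G w" unfolding H' by (auto simp: comp_def)
        moreover have "w i \<in> univ M" for i
          using w(1,2) x a unfolding P_def prefix_val_def
          by (cases "i \<in> {Suc m..<N}") auto
        ultimately show "H \<Gamma>' (\<lambda>_. x)"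
          unfolding H_def by (intro exI[of _ w]) (auto simp: prefix_val_def m_def)
      next
        assume "H \<Gamma>' (\<lambda>_. x)"
        then obtain v where v: "range v \<subseteq> univ M" "\<forall>i<m. v i = a ! i" "v m = x" "\<forall>G\<in>\<Gamma>'. G v"
          unfolding H_def by auto
        define w where "w i = (if i \<in> {Suc m..<N} then v i else prefix_val a (\<lambda>_. x) i)" for i
        have "w i = v i" if "i < N" for i
          using v(2,3) that by (cases "i < m"; cases "i = m") (auto simp: w_def prefix_val_def m_def)
        then have "\<forall>G\<in>\<Gamma>'. G w" using N[of w v] v(4) by blast
        then show "H' (\<lambda>_. x)" unfolding H' using v(1)
          by (intro exI[of _ w]) (auto simp: w_def comp_def)
      qed
      with d show ?thesis by blast
    qed
    have "\<exists>H'. vdef L M (B \<union> set a) H' \<and> (\<forall>x\<in>univ M. H' (\<lambda>_. x) = H \<Gamma>' (\<lambda>_. x))"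
      if \<Gamma>': "\<Gamma>' \<subseteq> \<Gamma>" "finite \<Gamma>'" for \<Gamma>'
    proof -
      have "vdef L M B (\<lambda>v. \<forall>G\<in>\<Gamma>'. G v)" using def \<Gamma>' by (intro vdef_Ball) auto
      then obtain N where N: "\<And>v w. \<forall>i<N. v i = w i \<Longrightarrow> (\<forall>G\<in>\<Gamma>'. G v) = (\<forall>G\<in>\<Gamma>'. G w)"
        by (rule vdef_finite_support) blast
      show ?thesis by (rule exI, rule H[OF \<Gamma>' refl N])
    qed
    then have "\<forall>\<Gamma>'\<in>{\<Gamma>'. \<Gamma>' \<subseteq> \<Gamma> \<and> finite \<Gamma>'}. \<exists>H'. vdef L M (B \<union> set a) H' \<and>
        (\<forall>x\<in>univ M. H' (\<lambda>_. x) = H \<Gamma>' (\<lambda>_. x))"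
      by blast
    from bchoice[OF this] obtain H' where H': "\<And>\<Gamma>'. \<Gamma>' \<subseteq> \<Gamma> \<Longrightarrow> finite \<Gamma>' \<Longrightarrow>
        vdef L M (B \<union> set a) (H' \<Gamma>') \<and> (\<forall>x\<in>univ M. H' \<Gamma>' (\<lambda>_. x) = H \<Gamma>' (\<lambda>_. x))"
      by blast
    have "\<exists>x\<in>univ M. \<forall>G\<in>H' ` {\<Gamma>'. \<Gamma>' \<subseteq> \<Gamma> \<and> finite \<Gamma>'}. G (\<lambda>_. x)"
    proof (rule saturated_vdef[OF sat, of "B \<union> set a"])
      show "B \<union> set a \<subseteq> univ M" using B a unfolding P_def by auto
      show "|B \<union> set a| <o \<kappa>" by (rule small_Un_countable[OF \<kappa> B(2) countable_finite[OF finite_set]])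
      show "vdef L M (B \<union> set a) G" if "G \<in> H' ` {\<Gamma>'. \<Gamma>' \<subseteq> \<Gamma> \<and> finite \<Gamma>'}" for G
        using that H' by auto
      fix \<Sigma>' assume "\<Sigma>' \<subseteq> H' ` {\<Gamma>'. \<Gamma>' \<subseteq> \<Gamma> \<and> finite \<Gamma>'}" "finite \<Sigma>'"
      then obtain \<Delta> where \<Delta>: "\<Delta> \<subseteq> {\<Gamma>'. \<Gamma>' \<subseteq> \<Gamma> \<and> finite \<Gamma>'}" "finite \<Delta>" "\<Sigma>' = H' ` \<Delta>"
        by (meson finite_subset_image)
      \<comment> \<open>A single valuation for the union of these finite sets provides one value
        that serves each of them.\<close>
      then have "\<Union>\<Delta> \<subseteq> \<Gamma> \<and> finite (\<Union>\<Delta>)" by auto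
      with a have "\<exists>v. range v \<subseteq> univ M \<and> (\<forall>i<length a. v i = a ! i) \<and> (\<forall>G\<in>\<Union>\<Delta>. G v)"
        unfolding P_def by metis
      then obtain v where v: "range v \<subseteq> univ M" "\<forall>i<length a. v i = a ! i" "\<forall>G\<in>\<Union>\<Delta>. G v"
        by (elim exE conjE)
      have "H' \<Gamma>' (\<lambda>_. v m)" if "\<Gamma>' \<in> \<Delta>" for \<Gamma>'
      proof -
        have "H \<Gamma>' (\<lambda>_. v m)" using v that unfolding H_def m_def by (intro exI[of _ v]) auto
        moreover have "v m \<in> univ M" using v(1) by auto
        ultimately show ?thesis using H'[of \<Gamma>'] that \<Delta>(1) by auto
      qed
      then show "\<exists>x\<in>univ M. \<forall>G\<in>\<Sigma>'. G (\<lambda>_. x)"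
        using v(1) \<Delta>(3) by (intro bexI[of _ "v m"]) auto
    qed
    then obtain x where x: "x \<in> univ M" "\<And>\<Gamma>'. \<Gamma>' \<subseteq> \<Gamma> \<Longrightarrow> finite \<Gamma>' \<Longrightarrow> H' \<Gamma>' (\<lambda>_. x)" by auto
    have "P (a @ [x])" unfolding P_def
    proof (intro conjI allI impI)
      show "set (a @ [x]) \<subseteq> univ M" using a x unfolding P_def by auto
      fix \<Gamma>' assume "\<Gamma>' \<subseteq> \<Gamma> \<and> finite \<Gamma>'"
      then have "H \<Gamma>' (\<lambda>_. x)" using H'[of \<Gamma>'] x by auto
      then obtain v where "range v \<subseteq> univ M" "\<forall>i<m. v i = a ! i" "v m = x" "\<forall>G\<in>\<Gamma>'. G v"
        unfolding H_def by blast
      then show "\<exists>v. range v \<subseteq> univ M \<and> (\<forall>i<length (a @ [x]). v i = (a @ [x]) ! i) \<and> (\<forall>G\<in>\<Gamma>'. G v)"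
        by (intro exI[of _ v]) (auto simp: nth_append m_def less_Suc_eq)
    qed
    then show ?thesis ..
  qed
  have "P []" using fin unfolding P_def by auto
  then have "\<exists>f. \<forall>n. (P (f n) \<and> length (f n) = n) \<and> (\<exists>x. f (Suc n) = f n @ [x])"
  proof (intro dependent_nat_choice)
    fix a n assume "P a \<and> length a = n"
    then show "\<exists>y. (P y \<and> length y = Suc n) \<and> (\<exists>x. y = a @ [x])" using step[of a] by auto
  qed auto
  then obtain f where f: "\<And>n. P (f n)" "\<And>n. length (f n) = n" "\<And>n. \<exists>x. f (Suc n) = f n @ [x]" by blast
  define v where "v i = f (Suc i) ! i" for i
  have nth: "f n ! i = v i" if "i < n" for i n
    using that
  proof (induction n)
    case (Suc n)
    then show ?case using f(2)[of n] f(3)[of n]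
      by (cases "i = n") (auto simp: nth_append v_def less_Suc_eq)
  qed simp
  have "G v" if G: "G \<in> \<Gamma>" for G
  proof -
    \<comment> \<open>Each condition reads only an initial segment of the valuation, so its truth in
      the limit is already decided at stage \<open>N\<close>.\<close>
    obtain N where N: "\<And>v w. \<forall>i<N. v i = w i \<Longrightarrow> G v = G w"
      by (rule vdef_finite_support[OF def[OF G]]) blast
    obtain w where "\<forall>i<length (f N). w i = f N ! i" "G w"
      using P_ex[OF f(1)[of N], of "{G}"] G by auto
    then show ?thesis using N[of w v] nth f(2) by simp
  qed
  moreover have "v i \<in> univ M" for i
    using f(1)[of "Suc i"] f(2)[of "Suc i"] nth_mem[of i "f (Suc i)"] unfolding P_def v_def by auto
  ultimately show ?thesis by (intro exI[of _ v]) auto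
qed

section \<open>Independent dense linear orders\<close>

definition lt :: "(unit, nat, 'a) struct \<Rightarrow> nat \<Rightarrow> 'a \<Rightarrow> 'a \<Rightarrow> bool" where
  "lt A i x y \<longleftrightarrow> rel_int A i [x, y]"

definition multi_order :: "nat \<Rightarrow> (unit, nat, 'a) struct \<Rightarrow> bool" where
  "multi_order n A \<longleftrightarrow> (\<forall>i<n. (\<forall>x\<in>univ A. \<not> lt A i x x) \<and>
     (\<forall>x\<in>univ A. \<forall>y\<in>univ A. \<forall>z\<in>univ A. lt A i x y \<longrightarrow> lt A i y z \<longrightarrow> lt A i x z) \<and>
     (\<forall>x\<in>univ A. \<forall>y\<in>univ A. x \<noteq> y \<longrightarrow> lt A i x y \<or> lt A i y x))"

text \<open>This is the extension property of the Fraisse limit. One point meets n cuts at once,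
  which expresses density without endpoints of each order together with the independence of the
  orders. Empty bounds are allowed, so the universe is nonempty.\<close>

definition rich :: "nat \<Rightarrow> (unit, nat, 'a) struct \<Rightarrow> bool" where
  "rich n A \<longleftrightarrow> multi_order n A \<and> (\<forall>Lo Up.
     (\<forall>i<n. finite (Lo i) \<and> Lo i \<subseteq> univ A \<and> finite (Up i) \<and> Up i \<subseteq> univ A \<and>
        (\<forall>a\<in>Lo i. \<forall>b\<in>Up i. lt A i a b)) \<longrightarrow>
     (\<exists>x\<in>univ A. \<forall>i<n. (\<forall>a\<in>Lo i. lt A i a x) \<and> (\<forall>b\<in>Up i. lt A i x b)))"

text \<open>A partial isomorphism is indexed by a set with two valuations. The same notion thus
  covers variable assignments, maps on a subset (with \<open>id\<close> as first valuation) and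
  finite relations (with \<open>fst\<close> and \<open>snd\<close>).\<close>

definition partial_iso ::
  "nat \<Rightarrow> (unit, nat, 'a) struct \<Rightarrow> (unit, nat, 'b) struct \<Rightarrow> 'p set \<Rightarrow> ('p \<Rightarrow> 'a) \<Rightarrow> ('p \<Rightarrow> 'b) \<Rightarrow> bool"
  where
  "partial_iso n A B P v w \<longleftrightarrow> v ` P \<subseteq> univ A \<and> w ` P \<subseteq> univ B \<and>
     (\<forall>p\<in>P. \<forall>q\<in>P. \<forall>i<n. lt A i (v p) (v q) \<longleftrightarrow> lt B i (w p) (w q))"

lemma lt_irrefl: "multi_order n A \<Longrightarrow> i < n \<Longrightarrow> x \<in> univ A \<Longrightarrow> \<not> lt A i x x"
  unfolding multi_order_def by blast

lemma lt_trans: "multi_order n A \<Longrightarrow> i < n \<Longrightarrow> x \<in> univ A \<Longrightarrow> y \<in> univ A \<Longrightarrow> z \<in> univ A \<Longrightarrow>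
    lt A i x y \<Longrightarrow> lt A i y z \<Longrightarrow> lt A i x z"
  unfolding multi_order_def by blast

lemma lt_total: "multi_order n A \<Longrightarrow> i < n \<Longrightarrow> x \<in> univ A \<Longrightarrow> y \<in> univ A \<Longrightarrow>
    lt A i x y \<or> x = y \<or> lt A i y x"
  unfolding multi_order_def by blast

lemma lt_asym: "multi_order n A \<Longrightarrow> i < n \<Longrightarrow> x \<in> univ A \<Longrightarrow> y \<in> univ A \<Longrightarrow>
    lt A i x y \<Longrightarrow> \<not> lt A i y x"
  using lt_irrefl lt_trans by metis

lemma rich_multi_order: "rich n A \<Longrightarrow> multi_order n A"
  unfolding rich_def by blast

lemma rich_point:
  assumes "rich n A"
    "\<And>i. i < n \<Longrightarrow> finite (Lo i) \<and> Lo i \<subseteq> univ A" "\<And>i. i < n \<Longrightarrow> finite (Up i) \<and> Up i \<subseteq> univ A"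
    "\<And>i a b. i < n \<Longrightarrow> a \<in> Lo i \<Longrightarrow> b \<in> Up i \<Longrightarrow> lt A i a b"
  obtains x where "x \<in> univ A" "\<And>i a. i < n \<Longrightarrow> a \<in> Lo i \<Longrightarrow> lt A i a x"
    "\<And>i b. i < n \<Longrightarrow> b \<in> Up i \<Longrightarrow> lt A i x b"
proof -
  have "\<exists>x\<in>univ A. \<forall>i<n. (\<forall>a\<in>Lo i. lt A i a x) \<and> (\<forall>b\<in>Up i. lt A i x b)"
    using assms unfolding rich_def by simp
  with that show thesis by blast
qed

lemma partial_iso_sym: "partial_iso n A B P v w \<Longrightarrow> partial_iso n B A P w v"
  unfolding partial_iso_def by blast

text \<open>In a linear order two points are equal exactly when neither is below the other. With at
  least one order present, \<open>partial_iso\<close> therefore need not mention equality.\<close>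

lemma partial_iso_eq:
  assumes "multi_order n A" "multi_order n B" "0 < n" "partial_iso n A B P v w" "p \<in> P" "q \<in> P"
  shows "v p = v q \<longleftrightarrow> w p = w q"
proof -
  have "v p \<in> univ A" "v q \<in> univ A" "w p \<in> univ B" "w q \<in> univ B"
    using assms unfolding partial_iso_def by auto
  moreover have "lt A 0 (v p) (v q) \<longleftrightarrow> lt B 0 (w p) (w q)" "lt A 0 (v q) (v p) \<longleftrightarrow> lt B 0 (w q) (w p)"
    using assms unfolding partial_iso_def by auto
  ultimately show ?thesis
    using lt_total[OF assms(1,3)] lt_irrefl[OF assms(1,3)] lt_total[OF assms(2,3)] lt_irrefl[OF assms(2,3)]
    by metis
qed

lemma partial_iso_update:
  assumes A: "multi_order n A" and B: "multi_order n B" and iso: "partial_iso n A B (P - {x}) v w"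
    and d: "d \<in> univ A" and e: "e \<in> univ B"
    and 1: "\<And>p i. p \<in> P - {x} \<Longrightarrow> i < n \<Longrightarrow> lt A i d (v p) \<longleftrightarrow> lt B i e (w p)"
    and 2: "\<And>p i. p \<in> P - {x} \<Longrightarrow> i < n \<Longrightarrow> lt A i (v p) d \<longleftrightarrow> lt B i (w p) e"
  shows "partial_iso n A B P (v(x := d)) (w(x := e))"
  unfolding partial_iso_def
proof (intro conjI ballI allI impI)
  fix p q i assume "p \<in> P" "q \<in> P" "i < n"
  then show "lt A i ((v(x := d)) p) ((v(x := d)) q) \<longleftrightarrow> lt B i ((w(x := e)) p) ((w(x := e)) q)"
    using iso 1[of q i] 2[of p i] lt_irrefl[OF A _ d] lt_irrefl[OF B _ e]
    unfolding partial_iso_def by (cases "p = x"; cases "q = x") auto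
qed (use iso d e in \<open>auto simp: partial_iso_def\<close>)

lemma partial_iso_extend_point:
  assumes A: "multi_order n A" and B: "rich n B" and n: "0 < n" and P: "finite P"
    and iso: "partial_iso n A B P v w" and d: "d \<in> univ A"
  obtains e where "e \<in> univ B"
    "\<And>p i. p \<in> P \<Longrightarrow> i < n \<Longrightarrow> lt A i d (v p) \<longleftrightarrow> lt B i e (w p)"
    "\<And>p i. p \<in> P \<Longrightarrow> i < n \<Longrightarrow> lt A i (v p) d \<longleftrightarrow> lt B i (w p) e"
    "\<And>p. p \<in> P \<Longrightarrow> d = v p \<longleftrightarrow> e = w p"
proof (cases "d \<in> v ` P")
  case True
  then obtain q where "q \<in> P" "d = v q" by auto
  with that[of "w q"] show ?thesis
    using iso partial_iso_eq[OF A rich_multi_order[OF B] n iso] unfolding partial_iso_def by auto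
next
  case False
  note B' = rich_multi_order[OF B]
  have v: "v p \<in> univ A" if "p \<in> P" for p using iso that unfolding partial_iso_def by auto
  have w: "w p \<in> univ B" if "p \<in> P" for p using iso that unfolding partial_iso_def by auto
  define Lo where "Lo i = w ` {p \<in> P. lt A i (v p) d}" for i
  define Up where "Up i = w ` {p \<in> P. lt A i d (v p)}" for i
  obtain e where e: "e \<in> univ B" "\<And>i a. i < n \<Longrightarrow> a \<in> Lo i \<Longrightarrow> lt B i a e"
      "\<And>i a. i < n \<Longrightarrow> a \<in> Up i \<Longrightarrow> lt B i e a"
  proof (rule rich_point[OF B, of Lo Up])
    fix i a b assume *: "i < n" "a \<in> Lo i" "b \<in> Up i"
    then obtain p q where pq: "p \<in> P" "q \<in> P" "a = w p" "b = w q" "lt A i (v p) d" "lt A i d (v q)"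
      unfolding Lo_def Up_def by auto
    then have "lt A i (v p) (v q)" using lt_trans[OF A *(1) v d v] by blast
    then show "lt B i a b" using iso pq * unfolding partial_iso_def by auto
  qed (use P w in \<open>auto simp: Lo_def Up_def\<close>)
  have 1: "lt A i d (v p) \<longleftrightarrow> lt B i e (w p)" "lt A i (v p) d \<longleftrightarrow> lt B i (w p) e"
    if p: "p \<in> P" "i < n" for p i
  proof -
    consider "lt A i d (v p)" "\<not> lt A i (v p) d" | "lt A i (v p) d" "\<not> lt A i d (v p)"
      using lt_total[OF A p(2) d v[OF p(1)]] lt_asym[OF A p(2) d v[OF p(1)]] False p(1) by auto
    then have "lt A i d (v p) \<and> lt B i e (w p) \<and> \<not> lt A i (v p) d \<and> \<not> lt B i (w p) e \<or>
        \<not> lt A i d (v p) \<and> \<not> lt B i e (w p) \<and> lt A i (v p) d \<and> lt B i (w p) e"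
    proof cases
      case 1
      then have "w p \<in> Up i" using p unfolding Up_def by auto
      with 1 e(3)[of i] p lt_asym[OF B' p(2) e(1) w[OF p(1)]] show ?thesis by blast
    next
      case 2
      then have "w p \<in> Lo i" using p unfolding Lo_def by auto
      with 2 e(2)[of i] p lt_asym[OF B' p(2) w[OF p(1)] e(1)] show ?thesis by blast
    qed
    then show "lt A i d (v p) \<longleftrightarrow> lt B i e (w p)" "lt A i (v p) d \<longleftrightarrow> lt B i (w p) e" by auto
  qed
  moreover have "d = v p \<longleftrightarrow> e = w p" if "p \<in> P" for p
    using 1[OF that n] lt_total[OF A n d v[OF that]] lt_irrefl[OF B' n e(1)] False that by auto
  ultimately show ?thesis using that e(1) by blast
qed

text \<open>Only the target is rich. The lemma embeds finite multi-orders, and it places a copy of a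
  tuple around a box whose corners are prescribed by \<open>w\<close> on \<open>R\<close>.\<close>

lemma partial_iso_extend_set:
  assumes A: "multi_order n A" and B: "rich n B" and n: "0 < n"
    and S: "finite S" "S \<subseteq> univ A" and R: "R \<subseteq> S" "partial_iso n A B R id w"
  obtains w' where "partial_iso n A B S id w'" "\<And>x. x \<in> R \<Longrightarrow> w' x = w x"
proof -
  have "finite R" using R(1) S(1) by (rule finite_subset)
  have "\<exists>w'. partial_iso n A B (R \<union> Q) id w' \<and> (\<forall>x\<in>R. w' x = w x)" if "finite Q" "Q \<subseteq> S" for Q
    using that
  proof (induction Q rule: finite_induct)
    case empty
    show ?case using R(2) by (intro exI[of _ w]) (simp add: id_def)
  next
    case (insert d Q)
    then obtain w' where w': "partial_iso n A B (R \<union> Q) id w'" "\<forall>x\<in>R. w' x = w x" by blast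
    show ?case
    proof (cases "d \<in> R")
      case True
      then have "R \<union> insert d Q = R \<union> Q" by auto
      then show ?thesis using w' by (metis (no_types))
    next
      case False
      have dA: "d \<in> univ A" using insert S by auto
      obtain e where e: "e \<in> univ B"
        "\<And>p i. p \<in> R \<union> Q \<Longrightarrow> i < n \<Longrightarrow> lt A i d (id p) \<longleftrightarrow> lt B i e (w' p)"
        "\<And>p i. p \<in> R \<union> Q \<Longrightarrow> i < n \<Longrightarrow> lt A i (id p) d \<longleftrightarrow> lt B i (w' p) e"
        by (rule partial_iso_extend_point[OF A B n _ w'(1) dA]) (use \<open>finite R\<close> insert.hyps(1) in \<open>simp, blast\<close>)
      have "partial_iso n A B (insert d (R \<union> Q)) (id(d := d)) (w'(d := e))"
        using w'(1) e dA insert.hyps(2) False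
        by (intro partial_iso_update[OF A rich_multi_order[OF B]]) auto
      then have "partial_iso n A B (R \<union> insert d Q) id (w'(d := e))"
        using fun_upd_triv[of id d] by simp
      moreover have "\<forall>x\<in>R. (w'(d := e)) x = w x" using w'(2) False by auto
      ultimately show ?thesis by blast
    qed
  qed
  from this[OF S(1)] R(1) that show ?thesis by (auto simp: Un_absorb1)
qed


section \<open>The theory of the Fraisse limit\<close>

lemma is_struct_mlo: "is_struct (mlo_lang J) A \<longleftrightarrow> univ A \<noteq> {}"
  unfolding is_struct_def mlo_lang_def by simp

lemma models_T_mlo: "models (mlo_lang {..<n}) A (T_mlo n) \<longleftrightarrow> univ A \<noteq> {} \<and> multi_order n A"
proof -
  have "holds A (All 0 (Neg (Lt i 0 0))) [] \<longleftrightarrow> (\<forall>x\<in>univ A. \<not> lt A i x x)"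
    "holds A (All 0 (All 1 (All 2 (Imp (Lt i 0 1) (Imp (Lt i 1 2) (Lt i 0 2)))))) [] \<longleftrightarrow>
      (\<forall>x\<in>univ A. \<forall>y\<in>univ A. \<forall>z\<in>univ A. lt A i x y \<longrightarrow> lt A i y z \<longrightarrow> lt A i x z)"
    "holds A (All 0 (All 1 (Imp (Neg (Eq (Var 0) (Var 1))) (Imp (Neg (Lt i 0 1)) (Lt i 1 0))))) [] \<longleftrightarrow>
      (\<forall>x\<in>univ A. \<forall>y\<in>univ A. x \<noteq> y \<longrightarrow> lt A i x y \<or> lt A i y x)" for i
    unfolding lt_def by (simp_all, blast)
  note * = this
  show ?thesis
    unfolding models_def is_struct_mlo T_mlo_def multi_order_def Ball_def[of "\<Union>_"]
    by (simp only: * ball_UN Ball_def[symmetric] ball_simps lessThan_iff simp_thms) blast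
qed

lemma embedding_mlo: "embedding (mlo_lang {..<n}) A B h \<longleftrightarrow>
   inj_on h (univ A) \<and> h ` univ A \<subseteq> univ B \<and>
   (\<forall>x\<in>univ A. \<forall>y\<in>univ A. \<forall>i<n. lt A i x y \<longleftrightarrow> lt B i (h x) (h y))"
proof -
  have "tuples A 2 = {[x, y] | x y. x \<in> univ A \<and> y \<in> univ A}"
    by (auto simp: tuples_def length_Suc_conv numeral_2_eq_2)
  then show ?thesis unfolding embedding_def mlo_lang_def lt_def by auto
qed

lemma embedding_mlo_partial_iso:
  assumes "multi_order n A" "multi_order n B" "0 < n"
  shows "embedding (mlo_lang {..<n}) A B h \<longleftrightarrow> partial_iso n A B (univ A) id h"
proof -
  have "inj_on h (univ A)" if "partial_iso n A B (univ A) id h"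
    using partial_iso_eq[OF assms that] by (auto intro!: inj_onI)
  then show ?thesis unfolding embedding_mlo partial_iso_def by auto
qed

lemma wf_tm_mlo: "wf_tm (mlo_lang J) t \<Longrightarrow> \<exists>i. t = Var i"
  by (cases t) (auto simp: mlo_lang_def)

lemma wf_Rel_mlo:
  assumes "wf_fm (mlo_lang J) (Rel r ts)"
  obtains x y where "r \<in> J" "ts = [Var x, Var y]"
proof -
  have "r \<in> J" and "length ts = Suc (Suc 0)" and ts: "\<forall>t\<in>set ts. wf_tm (mlo_lang J) t"
    using assms by (auto simp: mlo_lang_def)
  then obtain s t where "ts = [s, t]" by (auto simp: length_Suc_conv)
  with ts wf_tm_mlo[of J s] wf_tm_mlo[of J t] \<open>r \<in> J\<close> that show thesis by auto
qed

text \<open>Back and forth along the formula: a quantifier drops its variable from the partial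
  isomorphism, and \<open>partial_iso_extend_point\<close> chooses the matching value on the other
  side. For a sentence the partial isomorphism is empty, so rich structures on different types have
  the same theory.\<close>

lemma rich_elementarily_equivalent:
  assumes n: "0 < n" and A: "rich n A" and B: "rich n B"
    and "wf_fm (mlo_lang {..<n}) \<phi>" "partial_iso n A B (fv \<phi>) v w"
  shows "sat A v \<phi> \<longleftrightarrow> sat B w \<phi>"
  using assms(4,5)
proof (induction \<phi> arbitrary: v w)
  case (Eq s t)
  then obtain x y where "s = Var x" "t = Var y" 
    using wf_tm_mlo[of "{..<n}" s] wf_tm_mlo[of "{..<n}" t] by auto
  then show ?case
    using partial_iso_eq[OF rich_multi_order[OF A] rich_multi_order[OF B] n Eq.prems(2), of x y] by auto
next
  case (Rel r ts)
  obtain x y where "r < n" "ts = [Var x, Var y]" using wf_Rel_mlo[OF Rel.prems(1)] by auto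
  with Rel.prems(2) show ?case by (auto simp: partial_iso_def lt_def)
next
  case (Neg \<phi>)
  then have "sat A v \<phi> \<longleftrightarrow> sat B w \<phi>" by (intro Neg.IH) auto
  then show ?case by simp
next
  case (Imp \<phi> \<psi>)
  have "sat A v \<phi> \<longleftrightarrow> sat B w \<phi>" using Imp.prems by (intro Imp.IH(1)) (auto simp: partial_iso_def)
  moreover have "sat A v \<psi> \<longleftrightarrow> sat B w \<psi>" using Imp.prems by (intro Imp.IH(2)) (auto simp: partial_iso_def)
  ultimately show ?case by simp
next
  case (All x \<phi>)
  have upd: "partial_iso n A B (fv \<phi>) (v(x := d)) (w(x := e))"
    if "d \<in> univ A" "e \<in> univ B"
      "\<And>p i. p \<in> fv \<phi> - {x} \<Longrightarrow> i < n \<Longrightarrow> lt A i d (v p) \<longleftrightarrow> lt B i e (w p)"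
      "\<And>p i. p \<in> fv \<phi> - {x} \<Longrightarrow> i < n \<Longrightarrow> lt A i (v p) d \<longleftrightarrow> lt B i (w p) e" for d e
    using that All.prems(2)
    by (intro partial_iso_update[OF rich_multi_order[OF A] rich_multi_order[OF B]]) auto
  have iso: "partial_iso n A B (fv \<phi> - {x}) v w" using All.prems(2) by simp
  show ?case
  proof
    assume *: "sat A v (All x \<phi>)"
    have "sat B (w(x := e)) \<phi>" if e: "e \<in> univ B" for e
    proof -
      obtain d where d: "d \<in> univ A"
        "\<And>p i. p \<in> fv \<phi> - {x} \<Longrightarrow> i < n \<Longrightarrow> lt B i e (w p) \<longleftrightarrow> lt A i d (v p)"
        "\<And>p i. p \<in> fv \<phi> - {x} \<Longrightarrow> i < n \<Longrightarrow> lt B i (w p) e \<longleftrightarrow> lt A i (v p) d"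
        by (rule partial_iso_extend_point[OF rich_multi_order[OF B] A n _ partial_iso_sym[OF iso] e])
          (simp, blast)
      then have "sat A (v(x := d)) \<phi> \<longleftrightarrow> sat B (w(x := e)) \<phi>"
        using All.prems(1) e by (intro All.IH upd) auto
      with * d(1) show ?thesis by simp
    qed
    then show "sat B w (All x \<phi>)" by simp
  next
    assume *: "sat B w (All x \<phi>)"
    have "sat A (v(x := d)) \<phi>" if d: "d \<in> univ A" for d
    proof -
      obtain e where e: "e \<in> univ B"
        "\<And>p i. p \<in> fv \<phi> - {x} \<Longrightarrow> i < n \<Longrightarrow> lt A i d (v p) \<longleftrightarrow> lt B i e (w p)"
        "\<And>p i. p \<in> fv \<phi> - {x} \<Longrightarrow> i < n \<Longrightarrow> lt A i (v p) d \<longleftrightarrow> lt B i (w p) e"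
        by (rule partial_iso_extend_point[OF rich_multi_order[OF A] B n _ iso d]) (simp, blast)
      then have "sat A (v(x := d)) \<phi> \<longleftrightarrow> sat B (w(x := e)) \<phi>"
        using All.prems(1) d by (intro All.IH upd) auto
      with * e(1) show ?thesis by simp
    qed
    then show "sat A v (All x \<phi>)" by simp
  qed
qed

text \<open>Atomic formulas determine the quantifier-free type. Equality is listed separately
  because \<open>J\<close> may be empty, namely when the only order is forgotten.\<close>

lemma same_qftp_mlo:
  assumes "set a \<subseteq> univ A" "set b \<subseteq> univ A"
  shows "same_qftp (mlo_lang J) A a b \<longleftrightarrow> length a = length b \<and>
    (\<forall>p<length a. \<forall>q<length a. (a ! p = a ! q \<longleftrightarrow> b ! p = b ! q) \<and>
      (\<forall>i\<in>J. lt A i (a ! p) (a ! q) \<longleftrightarrow> lt A i (b ! p) (b ! q)))"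
proof
  assume *: "same_qftp (mlo_lang J) A a b"
  have "a ! p = a ! q \<longleftrightarrow> b ! p = b ! q" if "p < length a" "q < length a" for p q
  proof -
    have "formula (mlo_lang J) (length a) (Eq (Var p) (Var q)) \<and> qfree (Eq (Var p) (Var q) :: (unit, nat) fm)"
      using that by (auto simp: formula_def)
    with * have "holds A (Eq (Var p) (Var q)) a \<longleftrightarrow> holds A (Eq (Var p) (Var q)) b"
      unfolding same_qftp_def by blast
    then show ?thesis by simp
  qed
  moreover have "lt A i (a ! p) (a ! q) \<longleftrightarrow> lt A i (b ! p) (b ! q)"
    if "p < length a" "q < length a" "i \<in> J" for p q i
  proof -
    have "formula (mlo_lang J) (length a) (Lt i p q) \<and> qfree (Lt i p q)"
      using that by (auto simp: formula_def mlo_lang_def)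
    with * have "holds A (Lt i p q) a \<longleftrightarrow> holds A (Lt i p q) b"
      unfolding same_qftp_def by blast
    then show ?thesis by (simp add: lt_def)
  qed
  ultimately show "length a = length b \<and>
    (\<forall>p<length a. \<forall>q<length a. (a ! p = a ! q \<longleftrightarrow> b ! p = b ! q) \<and>
      (\<forall>i\<in>J. lt A i (a ! p) (a ! q) \<longleftrightarrow> lt A i (b ! p) (b ! q)))"
    using * unfolding same_qftp_def by blast
next
  assume *: "length a = length b \<and>
    (\<forall>p<length a. \<forall>q<length a. (a ! p = a ! q \<longleftrightarrow> b ! p = b ! q) \<and>
      (\<forall>i\<in>J. lt A i (a ! p) (a ! q) \<longleftrightarrow> lt A i (b ! p) (b ! q)))"
  have "holds A \<phi> a \<longleftrightarrow> holds A \<phi> b"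
    if "wf_fm (mlo_lang J) \<phi>" "fv \<phi> \<subseteq> {..<length a}" "qfree \<phi>" for \<phi>
    using that
  proof (induction \<phi>)
    case (Eq s t)
    then obtain x y where "s = Var x" "t = Var y" 
      using wf_tm_mlo[of J s] wf_tm_mlo[of J t] by auto
    with Eq * show ?case by auto
  next
    case (Rel r ts)
    obtain x y where "r \<in> J" "ts = [Var x, Var y]" using wf_Rel_mlo[OF Rel.prems(1)] by auto
    with Rel.prems(2) * show ?case by (auto simp: lt_def)
  qed auto
  with * show "same_qftp (mlo_lang J) A a b" unfolding same_qftp_def formula_def by blast
qed


text \<open>An abstract point in the required cuts is added to the finite set of all bounds. The
  result is a finite multi-order, hence embeds into \<open>F\<close>; homogeneity then corrects the
  embedding so that the bounds stay where they are.\<close>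

lemma fraisse_limit_rich:
  assumes n: "0 < n" and F: "mlo_fraisse_limit n F"
  shows "rich n F"
proof -
  let ?L = "mlo_lang {..<n}"
  have age: "models ?L B (T_mlo n) \<longleftrightarrow> (\<exists>h. embedding ?L B F h)"
    if "is_struct ?L B" "finite (univ B)" for B :: "(unit, nat, nat) struct"
    using F that unfolding mlo_fraisse_limit_def Let_def by blast
  have hom: "\<exists>g. automorphism ?L F g \<and> (\<forall>x\<in>S. g x = h x)"
    if "S \<subseteq> univ F" "finite S" "embedding ?L (F\<lparr>univ := S\<rparr>) F h" for S h
    using F that unfolding mlo_fraisse_limit_def Let_def by blast
  \<comment> \<open>Finite subsets of \<open>F\<close> lie in the age and are multi-orders. The
    axioms of linear orders concern at most three points, so \<open>F\<close> inherits them.\<close>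
  have sub: "multi_order n (F\<lparr>univ := S\<rparr>)" if "S \<subseteq> univ F" "finite S" "S \<noteq> {}" for S
  proof -
    have "embedding ?L (F\<lparr>univ := S\<rparr>) F id" using that(1) unfolding embedding_mlo by (auto simp: lt_def)
    then show ?thesis using age[of "F\<lparr>univ := S\<rparr>"] that models_T_mlo[of n] by (auto simp: is_struct_mlo)
  qed
  have lt_upd: "lt (F\<lparr>univ := S\<rparr>) = lt F" for S by (intro ext) (simp add: lt_def)
  have F_mo: "multi_order n F"
    unfolding multi_order_def
  proof (intro allI impI conjI ballI)
    fix i x assume "i < n" "x \<in> univ F"
    then show "\<not> lt F i x x" using lt_irrefl[OF sub[of "{x}"], of i x] by (simp add: lt_upd)
  next
    fix i x y z assume "i < n" "x \<in> univ F" "y \<in> univ F" "z \<in> univ F" "lt F i x y" "lt F i y z"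
    then show "lt F i x z" using lt_trans[OF sub[of "{x, y, z}"], of i x y z] by (simp add: lt_upd)
  next
    fix i x y assume "i < n" "x \<in> univ F" "y \<in> univ F" "x \<noteq> y"
    then show "lt F i x y \<or> lt F i y x" using lt_total[OF sub[of "{x, y}"], of i x y] by (simp add: lt_upd)
  qed
  have "\<exists>x\<in>univ F. \<forall>i<n. (\<forall>a\<in>Lo i. lt F i a x) \<and> (\<forall>b\<in>Up i. lt F i x b)"
    if LU: "\<forall>i<n. finite (Lo i) \<and> Lo i \<subseteq> univ F \<and> finite (Up i) \<and> Up i \<subseteq> univ F \<and>
        (\<forall>a\<in>Lo i. \<forall>b\<in>Up i. lt F i a b)" for Lo Up
  proof -
    define S where "S = (\<Union>i<n. Lo i \<union> Up i)"
    have S: "finite S" "S \<subseteq> univ F" "\<And>i. i < n \<Longrightarrow> Lo i \<subseteq> S \<and> Up i \<subseteq> S"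
      using LU unfolding S_def by auto
    obtain z where z: "z \<notin> S" using ex_new_if_finite[OF infinite_UNIV_nat S(1)] by auto
    \<comment> \<open>The new point goes directly above the initial segment generated by the lower
      bounds, at the very bottom if there are none. Compatibility of the bounds keeps the upper ones
      out of that segment.\<close>
    define below where "below i s \<longleftrightarrow> (\<exists>a\<in>Lo i. s = a \<or> lt F i s a)" for i s
    define B :: "(unit, nat, nat) struct" where "B = \<lparr>univ = insert z S, fun_int = fun_int F,
      rel_int = (\<lambda>i xs. let x = xs ! 0; y = xs ! 1 in
        if x = z then y \<noteq> z \<and> \<not> below i y else if y = z then below i x else lt F i x y)\<rparr>"
    have lt_B: "lt B i x y \<longleftrightarrow> (if x = z then y \<noteq> z \<and> \<not> below i y else if y = z then below i x else lt F i x y)"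
      for i x y unfolding lt_def[of B] by (simp add: B_def Let_def)
    have uB: "univ B = insert z S" by (simp add: B_def)
    have below_down: "below i s" if "i < n" "lt F i s t" "below i t" "s \<in> S" "t \<in> S" for i s t
      using that S lt_trans[OF F_mo, of i s t] unfolding below_def by blast
    have "multi_order n B"
      unfolding multi_order_def
    proof (intro allI impI conjI ballI)
      fix i x assume "i < n" "x \<in> univ B"
      then show "\<not> lt B i x x" using lt_irrefl[OF F_mo, of i x] S(2) by (auto simp: lt_B uB)
    next
      fix i x y w assume *: "i < n" "x \<in> univ B" "y \<in> univ B" "w \<in> univ B" "lt B i x y" "lt B i y w"
      have [simp]: "x \<noteq> z \<longleftrightarrow> x \<in> S" "y \<noteq> z \<longleftrightarrow> y \<in> S" "w \<noteq> z \<longleftrightarrow> w \<in> S"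
        using * z by (auto simp: uB)
      have "lt F i x w" if "x \<in> S" "w \<in> S" "below i x" "\<not> below i w"
        using that lt_total[OF F_mo *(1), of x w] below_down[OF *(1), of w x] S(2) by auto
      then show "lt B i x w"
        using *(5,6) below_down[OF *(1), of x y] below_down[OF *(1), of y w]
          lt_trans[OF F_mo *(1), of x y w] S(2) z
        unfolding lt_B by (cases "x = z"; cases "y = z"; cases "w = z") auto
    next
      fix i x y assume "i < n" "x \<in> univ B" "y \<in> univ B" "x \<noteq> y"
      then show "lt B i x y \<or> lt B i y x" using lt_total[OF F_mo, of i x y] S(2) by (auto simp: lt_B uB)
    qed
    then have "models ?L B (T_mlo n)" unfolding models_T_mlo by (simp add: uB)
    then obtain h where h: "embedding ?L B F h"
      using age[of B] S(1) by (auto simp: is_struct_mlo uB)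
    have "lt B i x y \<longleftrightarrow> lt F i x y" if "x \<in> S" "y \<in> S" for i x y
      using that z by (auto simp: lt_B)
    then have "embedding ?L (F\<lparr>univ := S\<rparr>) F h"
      using h unfolding embedding_mlo lt_upd by (simp add: uB)
    then obtain g where g: "automorphism ?L F g" "\<forall>x\<in>S. g x = h x" using hom[OF S(2,1)] by blast
    have "h z \<in> univ F" using h unfolding embedding_mlo uB by auto
    \<comment> \<open>The automorphism \<open>g\<close> agrees with \<open>h\<close> on the bounds,
      so the preimage of \<open>h z\<close> under \<open>g\<close> stands to the bounds as
      \<open>z\<close> does.\<close>
    then obtain x where x: "x \<in> univ F" "g x = h z" using g(1) unfolding automorphism_def by force
    have g_lt: "lt F i a b \<longleftrightarrow> lt F i (g a) (g b)" if "i < n" "a \<in> univ F" "b \<in> univ F" for i a b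
      using g(1) that unfolding automorphism_def embedding_mlo by blast
    have h_lt: "lt B i a b \<longleftrightarrow> lt F i (h a) (h b)" if "i < n" "a \<in> insert z S" "b \<in> insert z S" for i a b
      using h that unfolding embedding_mlo uB by blast
    have "lt F i a x" if "i < n" "a \<in> Lo i" for i a
    proof -
      have "lt B i a z" "a \<in> S" using that S(3) z by (auto simp: lt_B below_def)
      then show ?thesis using g_lt[of i a x] h_lt[of i a z] that(1) x g(2) S(2) by auto
    qed
    moreover have "lt F i x b" if "i < n" "b \<in> Up i" for i b
    proof -
      have b: "b \<in> S" using that S(3) by auto
      have "\<not> below i b"
        using LU that lt_irrefl[OF F_mo that(1)] lt_asym[OF F_mo that(1)] unfolding below_def by blast
      with b have "lt B i z b" using z by (auto simp: lt_B)
      then show ?thesis using g_lt[of i x b] h_lt[of i z b] that(1) x g(2) S(2) b by auto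
    qed
    ultimately show ?thesis using x(1) by blast
  qed
  with F_mo show ?thesis unfolding rich_def by blast
qed

section \<open>Richness as an axiomatization of the theory of the limit\<close>

lemma rich_univ_nonempty: "rich n A \<Longrightarrow> univ A \<noteq> {}"
  by (rule rich_point[of n A "\<lambda>_. {}" "\<lambda>_. {}"]) auto

lemma rich_models_T_mlo_star:
  fixes A :: "(unit, nat, 'a) struct" and F :: "(unit, nat, nat) struct"
  assumes n: "0 < n" and F: "mlo_fraisse_limit n F" and A: "rich n A"
  shows "models (mlo_lang {..<n}) A (T_mlo_star n)"
  unfolding models_def is_struct_mlo
proof (intro conjI ballI)
  show "univ A \<noteq> {}" by (rule rich_univ_nonempty[OF A])
  fix \<sigma> assume "\<sigma> \<in> T_mlo_star n"
  then have \<sigma>: "wf_fm (mlo_lang {..<n}) \<sigma>" "fv \<sigma> = {}" "holds F \<sigma> []"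
    using F unfolding T_mlo_star_def formula_def by auto
  have "partial_iso n F A (fv \<sigma>) (nth []) (nth [])" using \<sigma>(2) unfolding partial_iso_def by simp
  from rich_elementarily_equivalent[OF n fraisse_limit_rich[OF n F] A \<sigma>(1) this] \<sigma>(3)
  show "holds A \<sigma> []" by simp
qed

text \<open>The empty conjunction is a closed valid formula rather than an open equation, so that it
  adds no free variable.\<close>

fun conj_fm :: "('f, 'r) fm list \<Rightarrow> ('f, 'r) fm" where
  "conj_fm [] = All 0 (Eq (Var 0) (Var 0))"
| "conj_fm (\<phi> # \<phi>s) = Neg (Imp \<phi> (Neg (conj_fm \<phi>s)))"

fun all_fm :: "nat \<Rightarrow> ('f, 'r) fm \<Rightarrow> ('f, 'r) fm" where
  "all_fm 0 \<phi> = \<phi>"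
| "all_fm (Suc r) \<phi> = all_fm r (All r \<phi>)"

lemma sat_conj_fm: "sat M v (conj_fm \<phi>s) \<longleftrightarrow> (\<forall>\<phi>\<in>set \<phi>s. sat M v \<phi>)"
  by (induction \<phi>s) auto

lemma wf_conj_fm: "wf_fm L (conj_fm \<phi>s) \<longleftrightarrow> (\<forall>\<phi>\<in>set \<phi>s. wf_fm L \<phi>)"
  by (induction \<phi>s) auto

lemma fv_conj_fm: "fv (conj_fm \<phi>s) = (\<Union>\<phi>\<in>set \<phi>s. fv \<phi>)"
  by (induction \<phi>s) auto

lemma wf_all_fm: "wf_fm L (all_fm r \<phi>) \<longleftrightarrow> wf_fm L \<phi>"
  by (induction r arbitrary: \<phi>) auto

lemma fv_all_fm: "fv (all_fm r \<phi>) = fv \<phi> - {..<r}"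
  by (induction r arbitrary: \<phi>) (auto simp: lessThan_Suc)

lemma sat_all_fm: "sat M v (all_fm r \<phi>) \<longleftrightarrow>
    (\<forall>w. (\<forall>i\<ge>r. w i = v i) \<and> (\<forall>i<r. w i \<in> univ M) \<longrightarrow> sat M w \<phi>)"
proof (induction r arbitrary: \<phi>)
  case 0
  have "(\<forall>i. w i = v i) \<longleftrightarrow> w = v" for w by auto
  then show ?case by simp
next
  case (Suc r)
  have "(\<forall>w. (\<forall>i\<ge>r. w i = v i) \<and> (\<forall>i<r. w i \<in> univ M) \<longrightarrow> (\<forall>d\<in>univ M. sat M (w(r := d)) \<phi>)) \<longleftrightarrow>
    (\<forall>w. (\<forall>i\<ge>Suc r. w i = v i) \<and> (\<forall>i<Suc r. w i \<in> univ M) \<longrightarrow> sat M w \<phi>)" (is "?L \<longleftrightarrow> ?R")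
  proof
    assume ?L
    show ?R
    proof (intro allI impI)
      fix w assume w: "(\<forall>i\<ge>Suc r. w i = v i) \<and> (\<forall>i<Suc r. w i \<in> univ M)"
      have "\<forall>i\<ge>r. (w(r := v r)) i = v i" "\<forall>i<r. (w(r := v r)) i \<in> univ M" using w by auto
      then have "sat M ((w(r := v r))(r := w r)) \<phi>" using \<open>?L\<close> w by blast
      then show "sat M w \<phi>" by simp
    qed
  qed (auto simp: less_Suc_eq)
  then show ?case using Suc.IH[of "All r \<phi>"] by simp
qed

text \<open>Each instance of richness, for a fixed arrangement of the finitely many bounds, is a sentence.\<close>

lemma models_T_mlo_star_rich:
  fixes A :: "(unit, nat, 'a) struct"
  assumes n: "0 < n" and A: "models (mlo_lang {..<n}) A (T_mlo_star n)"
  shows "rich n A"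
proof -
  let ?L = "mlo_lang {..<n}"
  \<comment> \<open>Every Fraisse limit is rich, so a sentence true in all rich structures on
    \<open>nat\<close> belongs to \<open>T_mlo_star n\<close>.\<close>
  have A_sat: "holds A \<sigma> []"
    if "sentence ?L \<sigma>" "\<And>F :: (unit, nat, nat) struct. rich n F \<Longrightarrow> holds F \<sigma> []" for \<sigma>
    using A that fraisse_limit_rich[OF n] unfolding models_def T_mlo_star_def by auto
  have "\<sigma> \<in> T_mlo n \<Longrightarrow> sentence ?L \<sigma>" for \<sigma>
    unfolding T_mlo_def formula_def mlo_lang_def by auto
  moreover have "holds F \<sigma> []" if "\<sigma> \<in> T_mlo n" "rich n F" for \<sigma> and F :: "(unit, nat, nat) struct"
    using models_T_mlo[of n F] rich_univ_nonempty[OF that(2)] rich_multi_order[OF that(2)] that(1)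
    unfolding models_def by blast
  ultimately have "models ?L A (T_mlo n)" using A A_sat unfolding models_def by blast
  then have mo: "multi_order n A" unfolding models_T_mlo by blast
  have "\<exists>x\<in>univ A. \<forall>i<n. (\<forall>a\<in>Lo i. lt A i a x) \<and> (\<forall>b\<in>Up i. lt A i x b)"
    if LU: "\<forall>i<n. finite (Lo i) \<and> Lo i \<subseteq> univ A \<and> finite (Up i) \<and> Up i \<subseteq> univ A \<and>
        (\<forall>a\<in>Lo i. \<forall>b\<in>Up i. lt A i a b)" for Lo Up
  proof -
    have fin: "finite (\<Union>i<n. Lo i \<union> Up i)" using LU by auto
    obtain a where a: "set a = (\<Union>i<n. Lo i \<union> Up i)" using finite_list[OF fin] by (elim exE)
    define r where "r = length a"
    \<comment> \<open>The arrangement is recorded by positions in the list \<open>a\<close>: in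
      which order an entry is a bound, and on which side. Only this finite data enters the
      sentence.\<close>
    define lo where "lo = [(i, p). i \<leftarrow> [0..<n], p \<leftarrow> [0..<r], a ! p \<in> Lo i]"
    define up where "up = [(i, p). i \<leftarrow> [0..<n], p \<leftarrow> [0..<r], a ! p \<in> Up i]"
    have lo: "set lo = {(i, p). i < n \<and> p < r \<and> a ! p \<in> Lo i}"
      and up: "set up = {(i, p). i < n \<and> p < r \<and> a ! p \<in> Up i}"
      unfolding lo_def up_def by auto
    define hyp where "hyp = conj_fm [Lt i p q. (i, p) \<leftarrow> lo, (j, q) \<leftarrow> up, i = j]"
    define con where "con = conj_fm ([Lt i p r. (i, p) \<leftarrow> lo] @ [Lt i r p. (i, p) \<leftarrow> up])"
    define \<sigma> where "\<sigma> = all_fm r (Imp hyp (Neg (All r (Neg con))))"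
    have sat_hyp: "sat M v hyp \<longleftrightarrow> (\<forall>(i, p)\<in>set lo. \<forall>(j, q)\<in>set up. i = j \<longrightarrow> lt M i (v p) (v q))"
      for M :: "(unit, nat, 'c) struct" and v
      unfolding hyp_def sat_conj_fm by (fastforce simp: lt_def)
    have sat_con: "sat M v con \<longleftrightarrow> (\<forall>(i, p)\<in>set lo. lt M i (v p) (v r)) \<and> (\<forall>(i, p)\<in>set up. lt M i (v r) (v p))"
      for M :: "(unit, nat, 'c) struct" and v
      unfolding con_def sat_conj_fm set_append set_map ball_Un by (force simp: lt_def)
    have "sentence ?L \<sigma>"
      unfolding formula_def \<sigma>_def hyp_def con_def wf_all_fm fv_all_fm
      using lo up by (auto simp: wf_conj_fm fv_conj_fm mlo_lang_def)
    moreover have "holds F \<sigma> []" if F: "rich n F" for F :: "(unit, nat, nat) struct"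
      unfolding \<sigma>_def sat_all_fm
    proof (intro allI impI)
      fix w assume w: "(\<forall>i\<ge>r. w i = [] ! i) \<and> (\<forall>i<r. w i \<in> univ F)"
      have "\<exists>d\<in>univ F. sat F (w(r := d)) con" if hyp: "sat F w hyp"
      proof -
        obtain d where "d \<in> univ F" "\<And>i b. i < n \<Longrightarrow> b \<in> w ` {p. (i, p) \<in> set lo} \<Longrightarrow> lt F i b d"
          "\<And>i b. i < n \<Longrightarrow> b \<in> w ` {p. (i, p) \<in> set up} \<Longrightarrow> lt F i d b"
        proof (rule rich_point[OF F, of "\<lambda>i. w ` {p. (i, p) \<in> set lo}" "\<lambda>i. w ` {p. (i, p) \<in> set up}"])
          fix i assume "i < n"
          show "finite (w ` {p. (i, p) \<in> set lo}) \<and> w ` {p. (i, p) \<in> set lo} \<subseteq> univ F"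
            using w by (auto simp: lo)
          show "finite (w ` {p. (i, p) \<in> set up}) \<and> w ` {p. (i, p) \<in> set up} \<subseteq> univ F"
            using w by (auto simp: up)
        qed (use hyp in \<open>auto simp: sat_hyp\<close>)
        then show ?thesis unfolding sat_con using lo up by (intro bexI[of _ d]) auto
      qed
      then show "sat F w (Imp hyp (Neg (All r (Neg con))))" by auto
    qed
    ultimately have "holds A \<sigma> []" using A_sat by blast
    \<comment> \<open>\<open>sat_all_fm\<close> changes only the variables below \<open>r\<close>;
      beyond \<open>r\<close> the valuation must stay that of the empty tuple.\<close>
    define w where "w i = (if i < r then a ! i else [] ! i)" for i
    have w_a: "w ` {..<r} = set a" unfolding w_def r_def set_conv_nth by auto
    have "(\<forall>i\<ge>r. w i = [] ! i) \<and> (\<forall>i<r. w i \<in> univ A)"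
    proof -
      have "set a \<subseteq> univ A" using LU unfolding a by blast
      then show ?thesis unfolding w_def r_def by auto
    qed
    then have "sat A w (Imp hyp (Neg (All r (Neg con))))"
      using \<open>holds A \<sigma> []\<close> unfolding \<sigma>_def sat_all_fm by blast
    moreover have "sat A w hyp" unfolding sat_hyp lo up w_def using LU by auto
    ultimately obtain x where x: "x \<in> univ A" "sat A (w(r := x)) con" by auto
    have mem: "\<exists>p<r. a ! p = b" if "b \<in> Lo i \<union> Up i" "i < n" for b i
      using that a unfolding r_def in_set_conv_nth[symmetric] by auto
    have "lt A i b x" if "i < n" "b \<in> Lo i" for i b
      using mem[of b i] x(2) that unfolding sat_con lo w_def by fastforce
    moreover have "lt A i x b" if "i < n" "b \<in> Up i" for i b
      using mem[of b i] x(2) that unfolding sat_con up w_def by fastforce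
    ultimately show ?thesis using x(1) by blast
  qed
  with mo show ?thesis unfolding rich_def by blast
qed


section \<open>A countable model\<close>

text \<open>Finite lists of rational intervals are countable, and point \<open>m\<close> is put into
  the \<open>m\<close>-th box. Each of its coordinates avoids the finitely many values used before,
  which is possible in an infinite interval and gives injectivity in every coordinate. One sequence
  serves all dimensions.\<close>

lemma ex_dense_generic_sequence:
  obtains c :: "nat \<Rightarrow> nat \<Rightarrow> rat"
  where "\<And>i. inj (\<lambda>m. c m i)"
    and "\<And>n u v. (\<And>i. i < n \<Longrightarrow> u i < v i) \<Longrightarrow> \<exists>m. \<forall>i<n. u i < c m i \<and> c m i < v i"
proof -
  define box :: "nat \<Rightarrow> (rat \<times> rat) list" where "box = from_nat"
  define R where "R c m r \<longleftrightarrow> (\<forall>i. (\<forall>m'<m. r i \<noteq> c m' i) \<and>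
    (i < length (box m) \<and> fst (box m ! i) < snd (box m ! i) \<longrightarrow> fst (box m ! i) < r i \<and> r i < snd (box m ! i)))"
    for c :: "nat \<Rightarrow> nat \<Rightarrow> rat" and m r
  have "\<exists>c. \<forall>m. R c m (c m)"
  proof (rule dependent_wellorder_choice)
    show "\<And>r f g x. (\<And>y. y < x \<Longrightarrow> f y = g y) \<Longrightarrow> R f x r = R g x r"
      unfolding R_def by simp
    fix m and c :: "nat \<Rightarrow> nat \<Rightarrow> rat"
    have "\<exists>q. (\<forall>m'<m. q \<noteq> c m' i) \<and> (i < length (box m) \<and> fst (box m ! i) < snd (box m ! i) \<longrightarrow>
        fst (box m ! i) < q \<and> q < snd (box m ! i))" for i
    proof -
      \<comment> \<open>A coordinate on which the box imposes nothing, or an empty interval, is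
        chosen in the unit interval instead.\<close>
      define u v where "u = (if i < length (box m) \<and> fst (box m ! i) < snd (box m ! i) then fst (box m ! i) else 0)"
        and "v = (if i < length (box m) \<and> fst (box m ! i) < snd (box m ! i) then snd (box m ! i) else 1)"
      have "infinite {u<..<v}" unfolding u_def v_def by auto
      then have "infinite ({u<..<v} - (\<lambda>m'. c m' i) ` {..<m})" by (intro Diff_infinite_finite) auto
      then obtain q where "q \<in> {u<..<v} - (\<lambda>m'. c m' i) ` {..<m}"
        using infinite_imp_nonempty by blast
      then show ?thesis by (intro exI[of _ q]) (auto simp: u_def v_def)
    qed
    then show "\<exists>r. R c m r" unfolding R_def by (rule choice[OF allI])
  qed
  then obtain c where c: "\<And>m. R c m (c m)" by blast
  have "inj (\<lambda>m. c m i)" for i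
  proof (rule linorder_injI)
    fix m m' :: nat assume "m < m'"
    with c[of m'] show "c m i \<noteq> c m' i" unfolding R_def by metis
  qed
  moreover have "\<exists>m. \<forall>i<n. u i < c m i \<and> c m i < v i" if "\<And>i. i < n \<Longrightarrow> u i < v i" for n u v
  proof -
    define m where "m = to_nat (map (\<lambda>i. (u i, v i)) [0..<n])"
    have "box m = map (\<lambda>i. (u i, v i)) [0..<n]" unfolding box_def m_def by simp
    with c[of m] that show ?thesis unfolding R_def by (intro exI[of _ m]) auto
  qed
  ultimately show thesis using that by blast
qed

text \<open>The map \<open>g\<close> names the points in an arbitrary type: the Fraisse limit takes
  \<open>id\<close>, while the picture needs its domain inside the type \<open>'b\<close>.\<close>

definition coord_struct :: "(nat \<Rightarrow> 'a) \<Rightarrow> (nat \<Rightarrow> nat \<Rightarrow> rat) \<Rightarrow> (unit, nat, 'a) struct" where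
  "coord_struct g c = \<lparr>univ = range g, fun_int = (\<lambda>_ _. undefined),
     rel_int = (\<lambda>i xs. c (inv g (xs ! 0)) i < c (inv g (xs ! 1)) i)\<rparr>"

lemma lt_coord_struct: "inj g \<Longrightarrow> lt (coord_struct g c) i (g p) (g q) \<longleftrightarrow> c p i < c q i"
  by (simp add: lt_def coord_struct_def)

lemma univ_coord_struct [simp]: "univ (coord_struct g c) = range g"
  by (simp add: coord_struct_def)

lemma separate_finite_rats:
  fixes S T :: "rat set"
  assumes "finite S" "finite T" "\<And>s t. s \<in> S \<Longrightarrow> t \<in> T \<Longrightarrow> s < t"
  shows "\<exists>u v. u < v \<and> (\<forall>s\<in>S. s \<le> u) \<and> (\<forall>t\<in>T. v \<le> t)"
proof (cases "S = {}")
  case True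
  show ?thesis
  proof (cases "T = {}")
    case True
    have "\<exists>u v :: rat. u < v" using zero_less_one by blast
    with True \<open>S = {}\<close> show ?thesis by simp
  next
    case False
    show ?thesis by (rule exI[of _ "Min T - 1"], rule exI[of _ "Min T"], use \<open>S = {}\<close> assms(2) in simp)
  qed
next
  case False
  show ?thesis
  proof (cases "T = {}")
    case True
    show ?thesis by (rule exI[of _ "Max S"], rule exI[of _ "Max S + 1"], use True assms(1) in simp)
  next
    case False
    with \<open>S \<noteq> {}\<close> assms have "Max S < Min T" by (intro assms(3)) auto
    show ?thesis by (rule exI[of _ "Max S"], rule exI[of _ "Min T"], use \<open>Max S < Min T\<close> assms(1,2) in simp)
  qed
qed

lemma rich_coord_struct:
  fixes c :: "nat \<Rightarrow> nat \<Rightarrow> rat"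
  assumes g: "inj g" and inj: "\<And>i. inj (\<lambda>m. c m i)"
    and dense: "\<And>n u v. (\<And>i. i < n \<Longrightarrow> u i < v i) \<Longrightarrow> \<exists>m. \<forall>i<n. u i < c m i \<and> c m i < v i"
  shows "rich n (coord_struct g c)"
proof -
  let ?A = "coord_struct g c"
  have "c p i \<noteq> c q i" if "p \<noteq> q" for p q i using inj[of i] that unfolding inj_def by blast
  then have "multi_order n ?A"
    unfolding multi_order_def by (auto simp: lt_coord_struct[OF g] not_less_iff_gr_or_eq) (metis neqE)
  moreover have "\<exists>x\<in>univ ?A. \<forall>i<n. (\<forall>a\<in>Lo i. lt ?A i a x) \<and> (\<forall>b\<in>Up i. lt ?A i x b)"
    if LU: "\<forall>i<n. finite (Lo i) \<and> Lo i \<subseteq> univ ?A \<and> finite (Up i) \<and> Up i \<subseteq> univ ?A \<and>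
        (\<forall>a\<in>Lo i. \<forall>b\<in>Up i. lt ?A i a b)" for Lo Up
  proof -
    have "\<exists>u v. u < v \<and> (\<forall>a\<in>Lo i. c (inv g a) i \<le> u) \<and> (\<forall>b\<in>Up i. v \<le> c (inv g b) i)" if i: "i < n" for i
    proof -
      have "c (inv g a) i < c (inv g b) i" if "a \<in> Lo i" "b \<in> Up i" for a b
        using LU i that by (auto simp: lt_def coord_struct_def)
      then show ?thesis
        using separate_finite_rats[of "(\<lambda>a. c (inv g a) i) ` Lo i" "(\<lambda>b. c (inv g b) i) ` Up i"] LU i by auto
    qed
    then obtain u v where uv: "\<And>i. i < n \<Longrightarrow> u i < v i \<and> (\<forall>a\<in>Lo i. c (inv g a) i \<le> u i) \<and>
        (\<forall>b\<in>Up i. v i \<le> c (inv g b) i)"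
      by metis
    obtain m where m: "\<And>i. i < n \<Longrightarrow> u i < c m i \<and> c m i < v i" using dense[of n u v] uv by blast
    have "lt ?A i a (g m)" if "i < n" "a \<in> Lo i" for i a
      using uv[OF that(1)] m[OF that(1)] that(2) g by (fastforce simp: lt_def coord_struct_def)
    moreover have "lt ?A i (g m) b" if "i < n" "b \<in> Up i" for i b
      using uv[OF that(1)] m[OF that(1)] that(2) g by (fastforce simp: lt_def coord_struct_def)
    ultimately show ?thesis by (intro bexI[of _ "g m"]) auto
  qed
  ultimately show ?thesis unfolding rich_def by blast
qed

section \<open>Age and homogeneity of a countable rich structure\<close>

lemma rich_embeds_finite:
  assumes "0 < n" "rich n A" "multi_order n B" "finite (univ B)"
  shows "\<exists>h. embedding (mlo_lang {..<n}) B A h"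
proof -
  have "partial_iso n B A {} id w" for w unfolding partial_iso_def by simp
  from partial_iso_extend_set[OF assms(3,2,1,4) _ _ this] obtain h where "partial_iso n B A (univ B) id h"
    by auto
  then show ?thesis
    using embedding_mlo_partial_iso[OF assms(3) rich_multi_order[OF assms(2)] assms(1)] by blast
qed

text \<open>Back and forth over an enumeration of the universe: at stage \<open>m\<close> a finite
  relation receives \<open>m\<close> in its domain and in its range. The union is the graph of an
  automorphism because both projections determine each other.\<close>

lemma rich_countable_homogeneous:
  fixes F :: "(unit, nat, nat) struct"
  assumes n: "0 < n" and F: "rich n F" "univ F = UNIV"
    and S: "finite S" "partial_iso n F F S id h"
  shows "\<exists>g. automorphism (mlo_lang {..<n}) F g \<and> (\<forall>x\<in>S. g x = h x)"
proof -
  note mo = rich_multi_order[OF F(1)]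
  define PI where "PI R \<longleftrightarrow> finite R \<and> partial_iso n F F R fst snd" for R
  have to_domain: "\<exists>R'. PI R' \<and> R \<subseteq> R' \<and> x \<in> fst ` R'" if "PI R" for R x
  proof -
    have R: "finite R" "partial_iso n F F R fst snd" and x: "x \<in> univ F"
      using that F(2) unfolding PI_def by auto
    obtain e where "\<And>p i. p \<in> R \<Longrightarrow> i < n \<Longrightarrow> lt F i x (fst p) \<longleftrightarrow> lt F i e (snd p)"
        "\<And>p i. p \<in> R \<Longrightarrow> i < n \<Longrightarrow> lt F i (fst p) x \<longleftrightarrow> lt F i (snd p) e"
      by (rule partial_iso_extend_point[OF mo F(1) n R x]) blast
    then have "PI (insert (x, e) R)"
      using that lt_irrefl[OF mo] F(2) unfolding PI_def partial_iso_def by auto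
    then show ?thesis by (intro exI[of _ "insert (x, e) R"]) auto
  qed
  have to_range: "\<exists>R'. PI R' \<and> R \<subseteq> R' \<and> y \<in> snd ` R'" if "PI R" for R y
  proof -
    have R: "finite R" "partial_iso n F F R snd fst" and y: "y \<in> univ F"
      using that partial_iso_sym F(2) unfolding PI_def by auto
    obtain e where "\<And>p i. p \<in> R \<Longrightarrow> i < n \<Longrightarrow> lt F i y (snd p) \<longleftrightarrow> lt F i e (fst p)"
        "\<And>p i. p \<in> R \<Longrightarrow> i < n \<Longrightarrow> lt F i (snd p) y \<longleftrightarrow> lt F i (fst p) e"
      by (rule partial_iso_extend_point[OF mo F(1) n R y]) blast
    then have "PI (insert (e, y) R)"
      using that lt_irrefl[OF mo] F(2) unfolding PI_def partial_iso_def by auto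
    then show ?thesis by (intro exI[of _ "insert (e, y) R"]) auto
  qed
  define R0 where "R0 = (\<lambda>x. (x, h x)) ` S"
  have "PI R0" using S unfolding PI_def partial_iso_def R0_def by auto
  have "\<exists>f. \<forall>m. (PI (f m) \<and> R0 \<subseteq> f m) \<and> (f m \<subseteq> f (Suc m) \<and> m \<in> fst ` f (Suc m) \<and> m \<in> snd ` f (Suc m))"
  proof (rule dependent_nat_choice)
    show "\<exists>R. PI R \<and> R0 \<subseteq> R" using \<open>PI R0\<close> by blast
    fix R m assume R: "PI R \<and> R0 \<subseteq> R"
    obtain R1 where R1: "PI R1" "R \<subseteq> R1" "m \<in> fst ` R1" using to_domain[of R m] R by blast
    obtain R2 where "PI R2" "R1 \<subseteq> R2" "m \<in> snd ` R2" using to_range[of R1 m] R1(1) by blast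
    with R R1 show "\<exists>R'. (PI R' \<and> R0 \<subseteq> R') \<and> (R \<subseteq> R' \<and> m \<in> fst ` R' \<and> m \<in> snd ` R')"
      by (intro exI[of _ R2]) (auto intro: image_mono[THEN subsetD])
  qed
  then obtain f where f: "\<And>m. PI (f m)" "\<And>m. R0 \<subseteq> f m" "\<And>m. f m \<subseteq> f (Suc m)"
    "\<And>m. m \<in> fst ` f (Suc m)" "\<And>m. m \<in> snd ` f (Suc m)" by blast
  have mono: "f m \<subseteq> f m'" if "m \<le> m'" for m m' using lift_Suc_mono_le[of f, OF f(3) that] .
  define R where "R = (\<Union>m. f m)"
  have R: "lt F i (fst p) (fst q) \<longleftrightarrow> lt F i (snd p) (snd q)" if pq: "p \<in> R" "q \<in> R" "i < n" for p q i
  proof -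
    obtain m m' where "p \<in> f m" "q \<in> f m'" using pq(1,2) unfolding R_def by auto
    then have "p \<in> f (max m m')" "q \<in> f (max m m')" using mono by (meson max.cobounded1 max.cobounded2 subsetD)+
    then show ?thesis using f(1)[of "max m m'"] pq(3) unfolding PI_def partial_iso_def by blast
  qed
  have R_iso: "partial_iso n F F R fst snd" using R F(2) unfolding partial_iso_def by auto
  have R_eq: "fst p = fst q \<longleftrightarrow> snd p = snd q" if "p \<in> R" "q \<in> R" for p q
    using partial_iso_eq[OF mo mo n R_iso that] .
  have "\<exists>y. (x, y) \<in> R" for x using f(4)[of x] unfolding R_def by force
  then obtain g where g: "\<And>x. (x, g x) \<in> R" by metis
  have g_eq: "g x = y" if "(x, y) \<in> R" for x y using R_eq[OF g that, of x] by simp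
  have "range g = UNIV"
  proof (intro equalityI subset_UNIV subsetI)
    fix y
    obtain x where "(x, y) \<in> R" using f(5)[of y] unfolding R_def by force
    then show "y \<in> range g" using g_eq[of x y] by blast
  qed
  moreover have "partial_iso n F F (univ F) id g"
    unfolding partial_iso_def F(2) id_apply
  proof (intro conjI ballI allI impI)
    show "lt F i x y \<longleftrightarrow> lt F i (g x) (g y)" if "i < n" for x y i
      using R[OF g[of x] g[of y] that] by (simp only: fst_conv snd_conv)
  qed auto
  ultimately have "automorphism (mlo_lang {..<n}) F g"
    unfolding automorphism_def embedding_mlo_partial_iso[OF mo mo n] by (simp add: F(2) del: id_apply)
  moreover have "g x = h x" if "x \<in> S" for x
  proof (rule g_eq)
    have "(x, h x) \<in> R0" using that unfolding R0_def by simp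
    then show "(x, h x) \<in> R" using subsetD[OF f(2)[of 0]] unfolding R_def by simp blast
  qed
  ultimately show ?thesis by blast
qed

text \<open>\<open>T_mlo_star n\<close> is defined by truth in all limits. Without a limit it would
  contain every sentence and have no model, so existence is what gives statements about its models
  content.\<close>

lemma ex_fraisse_limit:
  assumes n: "0 < n"
  obtains F where "mlo_fraisse_limit n F"
proof -
  obtain c :: "nat \<Rightarrow> nat \<Rightarrow> rat" where c: "\<And>i. inj (\<lambda>m. c m i)"
    "\<And>n u v. (\<And>i. i < n \<Longrightarrow> u i < v i) \<Longrightarrow> \<exists>m. \<forall>i<n. u i < c m i \<and> c m i < v i"
    by (rule ex_dense_generic_sequence) blast
  define F where "F = coord_struct id c"
  have F: "rich n F" unfolding F_def by (rule rich_coord_struct[OF inj_on_id c])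
  have U: "univ F = UNIV" by (simp add: F_def)
  note mo = rich_multi_order[OF F]
  have "mlo_fraisse_limit n F"
    unfolding mlo_fraisse_limit_def Let_def
  proof (intro conjI allI impI)
    show "is_struct (mlo_lang {..<n}) F" unfolding is_struct_mlo U by simp
  next
    fix B :: "(unit, nat, nat) struct"
    assume B: "is_struct (mlo_lang {..<n}) B \<and> finite (univ B)"
    show "models (mlo_lang {..<n}) B (T_mlo n) \<longleftrightarrow> (\<exists>h. embedding (mlo_lang {..<n}) B F h)"
    proof
      assume "models (mlo_lang {..<n}) B (T_mlo n)"
      then show "\<exists>h. embedding (mlo_lang {..<n}) B F h"
        unfolding models_T_mlo using rich_embeds_finite[OF n F] B by blast
    next
      assume "\<exists>h. embedding (mlo_lang {..<n}) B F h"
      then obtain h where h: "inj_on h (univ B)" and "\<forall>x\<in>univ B. \<forall>y\<in>univ B. \<forall>i<n.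
          lt B i x y \<longleftrightarrow> lt F i (h x) (h y)"
        unfolding embedding_mlo by (elim exE conjE)
      then have h': "lt B i x y \<longleftrightarrow> lt F i (h x) (h y)" if "x \<in> univ B" "y \<in> univ B" "i < n" for x y i
        using that by simp
      have "multi_order n B"
        unfolding multi_order_def
      proof (intro allI impI conjI ballI)
        fix i x assume "i < n" "x \<in> univ B"
        then show "\<not> lt B i x x" using h' lt_irrefl[OF mo, of i "h x"] U by simp
      next
        fix i x y z assume "i < n" "x \<in> univ B" "y \<in> univ B" "z \<in> univ B" "lt B i x y" "lt B i y z"
        then show "lt B i x z" using h' lt_trans[OF mo, of i "h x" "h y" "h z"] U by simp
      next
        fix i x y assume "i < n" "x \<in> univ B" "y \<in> univ B" "x \<noteq> y"
        moreover from this h have "h x \<noteq> h y" by (meson inj_onD)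
        ultimately show "lt B i x y \<or> lt B i y x" using h' lt_total[OF mo, of i "h x" "h y"] U by simp
      qed
      with B show "models (mlo_lang {..<n}) B (T_mlo n)" by (simp add: models_T_mlo is_struct_mlo)
    qed
  next
    fix S h assume *: "S \<subseteq> univ F \<and> finite S \<and> embedding (mlo_lang {..<n}) (F\<lparr>univ := S\<rparr>) F h"
    have "partial_iso n F F S id h"
      using * unfolding embedding_mlo partial_iso_def by (auto simp: lt_def)
    then show "\<exists>g. automorphism (mlo_lang {..<n}) F g \<and> (\<forall>x\<in>S. g x = h x)"
      using rich_countable_homogeneous[OF n F U] * by blast
  qed
  with that show thesis .
qed

section \<open>From non-collapsing pictures to op-dimension\<close>

lemma nth_concat_uniform:
  assumes "\<And>x. x \<in> set xs \<Longrightarrow> length x = k" "t < length xs * k"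
  shows "concat xs ! t = xs ! (t div k) ! (t mod k)"
  using assms
proof (induction xs arbitrary: t)
  case (Cons x xs)
  have x: "length x = k" using Cons.prems(1) by simp
  show ?case
  proof (cases "t < k")
    case True
    then show ?thesis using x by (simp add: nth_append)
  next
    case False
    then obtain s where s: "t = k + s" by (metis le_add_diff_inverse not_less)
    have "0 < k" using Cons.prems(2) by (cases k) auto
    then have "concat xs ! s = xs ! (s div k) ! (s mod k)" "t div k = Suc (s div k)" "t mod k = s mod k"
      using Cons s by auto
    then show ?thesis using x s by (simp add: nth_append)
  qed
qed simp

lemma length_concat_uniform: "(\<And>x. x \<in> set xs \<Longrightarrow> length x = k) \<Longrightarrow> length (concat xs) = length xs * k"
  by (induction xs) auto

lemma same_tp_trans: "same_tp L M a b \<Longrightarrow> same_tp L M b c \<Longrightarrow> same_tp L M a c"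
  unfolding same_tp_def by simp

lemma not_same_tp_separated:
  assumes "\<not> same_tp L M a b" "length a = length b"
  obtains \<phi> where "formula L (length a) \<phi>" "\<not> holds M \<phi> a" "holds M \<phi> b"
proof -
  obtain \<phi> where \<phi>: "formula L (length a) \<phi>" "holds M \<phi> a \<noteq> holds M \<phi> b"
    using assms unfolding same_tp_def by blast
  then have "formula L (length a) (Neg \<phi>)" unfolding formula_def by simp
  with \<phi> that[of \<phi>] that[of "Neg \<phi>"] show thesis by auto
qed

text \<open>Moving the single element \<open>x\<close> of \<open>S\<close> upwards past its \<open><\<^sub>j\<close>-successor \<open>y\<close>, to \<open>w\<close>,
  changes nothing in the other orders; every permutation of the \<open><\<^sub>j\<close>-order is a product of such moves.\<close>

definition critical_move ::
  "nat \<Rightarrow> nat \<Rightarrow> (unit, nat, 'a) struct \<Rightarrow> 'a set \<Rightarrow> 'a \<Rightarrow> 'a \<Rightarrow> 'a \<Rightarrow> bool" where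
  "critical_move n j A S x y w \<longleftrightarrow> finite S \<and> S \<subseteq> univ A \<and> x \<in> S \<and> y \<in> S \<and> w \<in> univ A \<and>
     lt A j x y \<and> (\<forall>z\<in>S. lt A j z x \<or> z = x \<or> z = y \<or> lt A j y z) \<and>
     lt A j y w \<and> (\<forall>z\<in>S. lt A j y z \<longrightarrow> lt A j w z) \<and>
     (\<forall>i<n. i \<noteq> j \<longrightarrow> (\<forall>z\<in>S - {x}. (lt A i z w \<longleftrightarrow> lt A i z x) \<and> (lt A i w z \<longleftrightarrow> lt A i x z)))"

text \<open>Relative to \<open>S\<close>, the point \<open>w\<close> is chosen just above
  \<open>y\<close> in the order \<open>j\<close> and just above \<open>x\<close> in every other
  order. These are cuts in different orders, so richness fills them together.\<close>

lemma ex_critical_move: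
  assumes A: "rich n A" and j: "j < n" and S: "finite S" "S \<subseteq> univ A" and xy: "x \<in> S" "y \<in> S" "lt A j x y"
    and adj: "\<And>z. z \<in> S \<Longrightarrow> lt A j z x \<or> z = x \<or> z = y \<or> lt A j y z"
  shows "\<exists>w. critical_move n j A S x y w"
proof -
  note mo = rich_multi_order[OF A]
  define Lo where "Lo i = (if i = j then {y} else insert x {z \<in> S. lt A i z x})" for i
  define Up where "Up i = (if i = j then {z \<in> S. lt A j y z} else {z \<in> S. lt A i x z})" for i
  obtain w where w: "w \<in> univ A" "\<And>i a. i < n \<Longrightarrow> a \<in> Lo i \<Longrightarrow> lt A i a w"
      "\<And>i a. i < n \<Longrightarrow> a \<in> Up i \<Longrightarrow> lt A i w a"
  proof (rule rich_point[OF A, of Lo Up])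
    fix i a b assume *: "i < n" "a \<in> Lo i" "b \<in> Up i"
    then show "lt A i a b" using lt_trans[OF mo *(1), of a x b] S(2) xy
      unfolding Lo_def Up_def by (auto split: if_splits)
  qed (use S xy in \<open>auto simp: Lo_def Up_def\<close>)
  have "(lt A i z w \<longleftrightarrow> lt A i z x) \<and> (lt A i w z \<longleftrightarrow> lt A i x z)" if i: "i < n" "i \<noteq> j" and z: "z \<in> S - {x}" for i z
  proof -
    consider "lt A i z x" "z \<in> Lo i" | "lt A i x z" "z \<in> Up i"
      using lt_total[OF mo i(1), of z x] z xy(1) S(2) i(2) unfolding Lo_def Up_def by auto
    then show ?thesis
      using w lt_asym[OF mo i(1)] i z xy(1) S(2) by cases (metis Diff_iff subsetD)+
  qed
  then show ?thesis unfolding critical_move_def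
    using w(1) w(2)[OF j, of y] w(3)[OF j] S xy adj by (intro exI[of _ w]) (auto simp: Lo_def Up_def)
qed

text \<open>Bubble sort, by induction on the number of pairs that the order \<open>j\<close> ranks
  one way in \<open>a\<close> and differently in \<open>b\<close>. Without such an inversion the
  full quantifier-free types agree, contrary to \<open>tp\<close>. Otherwise an adjacent inversion
  is undone by a critical move: either this move already changes the type of the image, or the moved
  tuple still differs in type from \<open>b\<close> and has fewer inversions.\<close>

lemma non_collapse_critical_move:
  fixes I :: "'a \<Rightarrow> 'm list"
  assumes A: "rich n A" and j: "j < n" and ind: "indisc_picture L U k \<pi> {..<n} A I"
    and a: "set a \<subseteq> univ A" and b: "set b \<subseteq> univ A"
    and qf: "same_qftp (mlo_lang ({..<n} - {j})) A a b"
    and tp: "\<not> same_tp L U (concat (map I a)) (concat (map I b))"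
  shows "\<exists>a x y w. critical_move n j A (set a) x y w \<and>
    \<not> same_tp L U (concat (map I a)) (concat (map I (map (id(x := w)) a)))"
  using a qf tp
proof (induction "card {(p, q). p < length a \<and> q < length a \<and> lt A j (a ! p) (a ! q) \<and> \<not> lt A j (b ! p) (b ! q)}"
    arbitrary: a rule: less_induct)
  case less
  note mo = rich_multi_order[OF A]
  define inv where "inv a = {(p, q). p < length a \<and> q < length a \<and> lt A j (a ! p) (a ! q) \<and> \<not> lt A j (b ! p) (b ! q)}"
    for a
  have len: "length a = length b" using less.prems(2) unfolding same_qftp_def by blast
  have aU: "a ! p \<in> univ A" if "p < length a" for p using less.prems(1) that by auto
  have bU: "b ! p \<in> univ A" if "p < length a" for p using b that len by auto
  have qf': "a ! p = a ! q \<longleftrightarrow> b ! p = b ! q" "\<And>i. i < n \<Longrightarrow> i \<noteq> j \<Longrightarrow> lt A i (a ! p) (a ! q) \<longleftrightarrow> lt A i (b ! p) (b ! q)"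
    if "p < length a" "q < length a" for p q
    using less.prems(2) that unfolding same_qftp_mlo[OF less.prems(1) b] by auto
  show ?case
  proof (cases "inv a = {}")
    case True
    have 1: "lt A j (b ! p) (b ! q)" if "p < length a" "q < length a" "lt A j (a ! p) (a ! q)" for p q
      using True that unfolding inv_def by blast
    have 2: "lt A j (a ! p) (a ! q)" if "p < length a" "q < length a" "lt A j (b ! p) (b ! q)" for p q
      using lt_total[OF mo j aU[OF that(1)] aU[OF that(2)]] 1[OF that(2,1)] qf'(1)[OF that(1,2)]
        lt_asym[OF mo j bU[OF that(1)] bU[OF that(2)] that(3)] that(3) lt_irrefl[OF mo j bU[OF that(1)]] by metis
    have "lt A i (a ! p) (a ! q) \<longleftrightarrow> lt A i (b ! p) (b ! q)" if "p < length a" "q < length a" "i < n" for i p q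
      using qf'(2)[OF that(1,2,3)] 1[OF that(1,2)] 2[OF that(1,2)] by (cases "i = j") auto
    then have "same_qftp (mlo_lang {..<n}) A a b"
      unfolding same_qftp_mlo[OF less.prems(1) b] using len qf'(1) by auto
    moreover have "length a > 0" using less.prems(3) len unfolding same_tp_def by auto
    ultimately have "same_tp L U (concat (map I a)) (concat (map I b))"
      using ind less.prems(1) b len unfolding indisc_picture_def tuples_def by auto
    with less.prems(3) show ?thesis by simp
  next
    case False
    \<comment> \<open>An inversion with the fewest elements between its ends has none: an element in
      between would form an inversion with one of the ends, with fewer elements between
      them.\<close>
    define betw where "betw = (\<lambda>(p, q). card {z \<in> set a. lt A j (a ! p) z \<and> lt A j z (a ! q)})"
    obtain s where s: "s \<in> inv a" and min: "\<And>t. t \<in> inv a \<Longrightarrow> betw s \<le> betw t"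
      using False ex_has_least_nat[of "\<lambda>t. t \<in> inv a" _ betw] by blast
    obtain p q where pq: "s = (p, q)" by (cases s)
    have p: "p < length a" "q < length a" "lt A j (a ! p) (a ! q)" "\<not> lt A j (b ! p) (b ! q)"
      using s unfolding pq inv_def by auto
    have "a ! p \<noteq> a ! q" using p lt_irrefl[OF mo j aU[OF p(1)]] by auto
    then have b_qp: "lt A j (b ! q) (b ! p)"
      using lt_total[OF mo j bU[OF p(1)] bU[OF p(2)]] p qf'(1)[OF p(1,2)] by auto
    have no_betw: "\<not> (lt A j (a ! p) z \<and> lt A j z (a ! q))" if z: "z \<in> set a" for z
    proof
      assume *: "lt A j (a ! p) z \<and> lt A j z (a ! q)"
      obtain r where r: "r < length a" "a ! r = z" using z by (auto simp: in_set_conv_nth)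
      have sub: "betw (p, r) < betw (p, q)" "betw (r, q) < betw (p, q)"
      proof -
        have "{u \<in> set a. lt A j (a ! p) u \<and> lt A j u (a ! r)} \<subset> {u \<in> set a. lt A j (a ! p) u \<and> lt A j u (a ! q)}"
          using * r z lt_trans[OF mo j _ aU[OF r(1)] aU[OF p(2)]] lt_irrefl[OF mo j aU[OF r(1)]] less.prems(1)
          by (auto intro!: psubsetI)
        then show "betw (p, r) < betw (p, q)" unfolding betw_def by (auto intro: psubset_card_mono)
        have "{u \<in> set a. lt A j (a ! r) u \<and> lt A j u (a ! q)} \<subset> {u \<in> set a. lt A j (a ! p) u \<and> lt A j u (a ! q)}"
          using * r z lt_trans[OF mo j aU[OF p(1)] aU[OF r(1)]] lt_irrefl[OF mo j aU[OF r(1)]] less.prems(1)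
          by (auto intro!: psubsetI)
        then show "betw (r, q) < betw (p, q)" unfolding betw_def by (auto intro: psubset_card_mono)
      qed
      have "(p, r) \<notin> inv a" using min[of "(p, r)"] sub(1) unfolding pq by auto
      moreover have "(r, q) \<notin> inv a" using min[of "(r, q)"] sub(2) unfolding pq by auto
      ultimately have "lt A j (b ! p) (b ! r)" "lt A j (b ! r) (b ! q)"
        using * r p unfolding inv_def by auto
      then show False using lt_trans[OF mo j bU[OF p(1)] bU[OF r(1)] bU[OF p(2)]] p(4) by blast
    qed
    define x y where "x = a ! p" and "y = a ! q"
    have xy: "x \<in> set a" "y \<in> set a" "lt A j x y" using p unfolding x_def y_def by auto
    have aA: "z \<in> univ A" if "z \<in> set a" for z using that less.prems(1) by auto
    have adj: "lt A j z x \<or> z = x \<or> z = y \<or> lt A j y z" if "z \<in> set a" for z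
      using no_betw[OF that] lt_total[OF mo j aA[OF that] aA[OF xy(1)]] lt_total[OF mo j aA[OF that] aA[OF xy(2)]]
      unfolding x_def y_def by blast
    obtain w where w: "critical_move n j A (set a) x y w"
      using ex_critical_move[OF A j _ less.prems(1) xy adj] by auto
    then have wA: "w \<in> univ A" and yw: "lt A j y w"
      and wu: "\<And>z. z \<in> set a \<Longrightarrow> lt A j y z \<Longrightarrow> lt A j w z"
      and wi: "\<And>i z. i < n \<Longrightarrow> i \<noteq> j \<Longrightarrow> z \<in> set a \<Longrightarrow> z \<noteq> x \<Longrightarrow>
        (lt A i z w \<longleftrightarrow> lt A i z x) \<and> (lt A i w z \<longleftrightarrow> lt A i x z)"
      unfolding critical_move_def by auto
    define m where "m = id(x := w)"
    have xw: "lt A j x w" using lt_trans[OF mo j aA[OF xy(1)] aA[OF xy(2)] wA xy(3) yw] .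
    have w_new: "w \<notin> set a"
    proof
      assume "w \<in> set a"
      with adj[of w] wu[of w] yw lt_irrefl[OF mo j wA] xw lt_asym[OF mo j wA aA[OF xy(1)]]
      show False by blast
    qed
    show ?thesis
    proof (cases "same_tp L U (concat (map I a)) (concat (map I (map m a)))")
      case False
      with w show ?thesis unfolding m_def by blast
    next
      case True
      let ?a = "map m a"
      have a': "set ?a \<subseteq> univ A" using aA wA by (auto simp: m_def)
      have "(m z = m z' \<longleftrightarrow> z = z') \<and> (\<forall>i\<in>{..<n} - {j}. lt A i (m z) (m z') \<longleftrightarrow> lt A i z z')"
        if "z \<in> set a" "z' \<in> set a" for z z'
        using that w_new wi lt_irrefl[OF mo _ wA] lt_irrefl[OF mo _ aA[OF xy(1)]] unfolding m_def by auto
      then have "same_qftp (mlo_lang ({..<n} - {j})) A ?a b"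
        using less.prems(2) unfolding same_qftp_mlo[OF less.prems(1) b] same_qftp_mlo[OF a' b] by simp
      moreover have "\<not> same_tp L U (concat (map I ?a)) (concat (map I b))"
        using same_tp_trans[OF True] less.prems(3) by blast
      moreover have "inv ?a \<subset> inv a"
      proof
        \<comment> \<open>Among the points of the tuple the move reverses only the pair
          \<open>x\<close>, \<open>y\<close>, which was an inversion. Hence it creates no inversion
          and removes at least one.\<close>
        have m_lt: "lt A j z z' \<or> z = y \<and> z' = x" if "z \<in> set a" "z' \<in> set a" "lt A j (m z) (m z')" for z z'
        proof (cases "z = x")
          case True
          then show ?thesis using that adj[of z'] lt_irrefl[OF mo j wA] lt_asym[OF mo j wA aA]
              lt_trans[OF mo j aA[OF xy(1)] wA aA[of z']] xw unfolding m_def by (auto split: if_splits)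
        next
          case False
          then show ?thesis
            using that adj[of z] wu[of z] lt_asym[OF mo j wA aA[OF that(1)]] unfolding m_def by (auto split: if_splits)
        qed
        show "inv ?a \<subseteq> inv a"
        proof
          fix t assume "t \<in> inv ?a"
          then obtain r s where t: "t = (r, s)" "r < length a" "s < length a" "lt A j (m (a ! r)) (m (a ! s))"
              "\<not> lt A j (b ! r) (b ! s)" unfolding inv_def by auto
          have "\<not> (a ! r = y \<and> a ! s = x)"
          proof
            assume "a ! r = y \<and> a ! s = x"
            then have "b ! r = b ! q" "b ! s = b ! p" using qf'(1) t p unfolding x_def y_def by auto
            with b_qp t(5) show False by simp
          qed
          with m_lt[of "a ! r" "a ! s"] t show "t \<in> inv a" unfolding inv_def by auto
        qed
        have "m y = y" using xy lt_irrefl[OF mo j aA[OF xy(1)]] unfolding m_def by auto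
        then have "(p, q) \<notin> inv ?a"
          using p(1,2) lt_asym[OF mo j aA[OF xy(2)] wA yw] unfolding inv_def m_def x_def[symmetric] y_def[symmetric]
          by (auto simp: x_def[symmetric] y_def[symmetric])
        then show "inv ?a \<noteq> inv a" using s pq by blast
      qed
      then have "card (inv ?a) < card (inv a)"
        by (intro psubset_card_mono) (auto simp: inv_def intro: finite_subset[of _ "{..<length a} \<times> {..<length a}"])
      ultimately show ?thesis using less.hyps[of ?a] a' unfolding inv_def by blast
    qed
  qed
qed

text \<open>Around a box \<open>(u, v)\<close> one places a copy of the rest of the tuple of a critical move, and a
  \<open><\<^sub>j\<close>-increasing sequence of copies of \<open>y\<close> that crosses the box in the order \<open><\<^sub>j\<close> and lies outside
  of it in the other orders; then \<open>\<psi>\<close> compares a point of the box with this sequence.\<close>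

lemma critical_move_box_formula:
  fixes I :: "'a \<Rightarrow> 'm list"
  assumes n: "0 < n" and A: "rich n A" and j: "j < n" and ind: "indisc_picture L U k \<pi> {..<n} A I"
    and move: "critical_move n j A (set a) x y w"
    and tp: "\<not> same_tp L U (concat (map I a)) (concat (map I (map (id(x := w)) a)))"
    and u: "u \<in> univ A" and v: "v \<in> univ A" and uv: "\<And>i. i < n \<Longrightarrow> lt A i u v"
  shows "\<exists>m \<psi> b c. formula L (k + m) \<psi> \<and> (\<forall>l::nat. b l \<in> tuples U m \<and> c l \<in> univ A \<and>
      lt A j u (c l) \<and> lt A j (c l) v \<and> lt A j (c l) (c (Suc l))) \<and>
    (\<forall>l. \<forall>z\<in>univ A. (\<forall>i<n. lt A i u z \<and> lt A i z v) \<longrightarrow>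
      (lt A j (c l) z \<longrightarrow> holds U \<psi> (I z @ b l)) \<and> (lt A j z (c l) \<longrightarrow> \<not> holds U \<psi> (I z @ b l)))"
proof -
  note mo = rich_multi_order[OF A]
  let ?S = "set a"
  have S: "?S \<subseteq> univ A" and xy: "x \<in> ?S" "y \<in> ?S" and w: "w \<in> univ A" and lt_xy: "lt A j x y"
    and adj: "\<And>z. z \<in> ?S \<Longrightarrow> lt A j z x \<or> z = x \<or> z = y \<or> lt A j y z"
    and yw: "lt A j y w" and wu: "\<And>z. z \<in> ?S \<Longrightarrow> lt A j y z \<Longrightarrow> lt A j w z"
    and wi: "\<And>i z. i < n \<Longrightarrow> i \<noteq> j \<Longrightarrow> z \<in> ?S \<Longrightarrow> z \<noteq> x \<Longrightarrow>
        (lt A i z w \<longleftrightarrow> lt A i z x) \<and> (lt A i w z \<longleftrightarrow> lt A i x z)"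
    using move unfolding critical_move_def by auto
  have SA: "z \<in> univ A" if "z \<in> ?S" for z using that S by auto
  note xA = SA[OF xy(1)] and yA = SA[OF xy(2)]
  have x_ne_y: "x \<noteq> y" using lt_xy lt_irrefl[OF mo j xA] by auto
  \<comment> \<open>Among the points of the tuple, the interval from \<open>u'\<close> to
    \<open>v'\<close> isolates \<open>x\<close> in every order except \<open>j\<close>, where it
    contains just \<open>x\<close> and \<open>y\<close>.\<close>
  obtain u' where u': "u' \<in> univ A" "\<And>i z. i < n \<Longrightarrow> z \<in> {z \<in> ?S. lt A i z x} \<Longrightarrow> lt A i z u'"
      "\<And>i z. i < n \<Longrightarrow> z \<in> {x} \<Longrightarrow> lt A i u' z"
    by (rule rich_point[OF A, of "\<lambda>i. {z \<in> ?S. lt A i z x}" "\<lambda>i. {x}"]) (use S xA in auto)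
  define x' where "x' i = (if i = j then y else x)" for i
  have x': "x' i \<in> ?S" "x' i \<in> univ A" for i using xy xA yA unfolding x'_def by auto
  obtain v' where v': "v' \<in> univ A" "\<And>i z. i < n \<Longrightarrow> z \<in> {x' i} \<Longrightarrow> lt A i z v'"
      "\<And>i z. i < n \<Longrightarrow> z \<in> {z \<in> ?S. lt A i (x' i) z} \<Longrightarrow> lt A i v' z"
    by (rule rich_point[OF A, of "\<lambda>i. {x' i}" "\<lambda>i. {z \<in> ?S. lt A i (x' i) z}"]) (use S x' in auto)
  have x_v': "lt A i x v'" if "i < n" for i
    using v'(2)[OF that, of "x' i"] lt_trans[OF mo that xA yA v'(1)] lt_xy unfolding x'_def by (auto split: if_splits)
  have uv': "lt A i u' v'" if "i < n" for i
    using lt_trans[OF mo that u'(1) xA v'(1)] u'(3)[OF that] x_v'[OF that] by blast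
  have ne: "u' \<noteq> v'" using uv'[OF n] lt_irrefl[OF mo n u'(1)] by auto
  \<comment> \<open>Sending \<open>u'\<close> and \<open>v'\<close> to the ends of the box and
    extending to the tuple by richness gives a copy whose other points lie outside the box in each
    order.\<close>
  define h0 where "h0 z = (if z = u' then u else v)" for z
  have "partial_iso n A A {u', v'} id h0"
    unfolding partial_iso_def
    using u v u'(1) v'(1) uv uv' ne lt_irrefl[OF mo] lt_asym[OF mo _ u v] lt_asym[OF mo _ u'(1) v'(1)]
    by (auto simp: h0_def)
  then obtain h where h: "partial_iso n A A (insert u' (insert v' ?S)) id h"
      and h_h0: "\<And>z. z \<in> {u', v'} \<Longrightarrow> h z = h0 z"
    by (rule partial_iso_extend_set[OF mo A n, of "insert u' (insert v' ?S)" "{u', v'}" h0, rotated 3])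
      (use S u'(1) v'(1) in auto)
  then have h: "partial_iso n A A (insert u' (insert v' ?S)) id h" "h u' = u" "h v' = v"
    using ne by (simp_all add: h0_def)
  define T where "T = insert u' (insert v' (?S - {x}))"
  have T: "finite T" "T \<subseteq> univ A" "y \<in> T" using S u'(1) v'(1) xy x_ne_y unfolding T_def by auto
  \<comment> \<open>\<open>Y c\<close> says that \<open>c\<close> can stand for \<open>y\<close> in
    the copy. \<open>T\<close> omits \<open>x\<close>, because the place of \<open>x\<close> is
    reserved for a point of the box that may fall on either side of \<open>c\<close>. From one such
    \<open>c\<close> richness gives another, larger in the order \<open>j\<close> and in the same
    cuts over the rest of the copy.\<close>
  define Y where "Y c \<longleftrightarrow> partial_iso n A A T id (h(y := c))" for c
  have y_ne: "y \<noteq> u'" "y \<noteq> v'"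
    using lt_trans[OF mo j u'(1) xA yA] u'(3)[OF j, of x] lt_xy lt_irrefl[OF mo j yA]
      v'(2)[OF j, of y] unfolding x'_def by auto
  have Y_lt: "lt A i z z' \<longleftrightarrow> lt A i ((h(y := c)) z) ((h(y := c)) z')" if "Y c" "z \<in> T" "z' \<in> T" "i < n" for c z z' i
    using that unfolding Y_def partial_iso_def by simp
  have Y_univ: "(h(y := c)) z \<in> univ A" if "Y c" "z \<in> T" for c z
    using that unfolding Y_def partial_iso_def by blast
  have step: "\<exists>c'. Y c' \<and> lt A j c c'" if Yc: "Y c" for c
  proof -
    define Lo where "Lo i = (if i = j then {c} else {}) \<union> h ` {z \<in> T - {y}. lt A i z y}" for i
    define Up where "Up i = h ` {z \<in> T - {y}. lt A i y z}" for i
    have cA: "c \<in> univ A" using Y_univ[OF Yc T(3)] by simp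
    have hA: "h z \<in> univ A" if "z \<in> T - {y}" for z using Y_univ[OF Yc, of z] that by auto
    have c_lt: "lt A i z y \<longleftrightarrow> lt A i (h z) c" "lt A i y z \<longleftrightarrow> lt A i c (h z)" if "z \<in> T - {y}" "i < n" for i z
      using Y_lt[OF Yc, of z y i] Y_lt[OF Yc, of y z i] that T(3) by auto
    obtain c' where c': "c' \<in> univ A" "\<And>i z. i < n \<Longrightarrow> z \<in> Lo i \<Longrightarrow> lt A i z c'"
        "\<And>i z. i < n \<Longrightarrow> z \<in> Up i \<Longrightarrow> lt A i c' z"
    proof (rule rich_point[OF A, of Lo Up])
      fix i s t assume *: "i < n" "s \<in> Lo i" "t \<in> Up i"
      then have "lt A i c t" "t \<in> univ A" "s = c \<or> lt A i s c" "s \<in> univ A"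
        using c_lt hA cA unfolding Lo_def Up_def by (auto split: if_splits)
      then show "lt A i s t" using lt_trans[OF mo *(1) _ cA] by blast
    qed (use T(1) cA hA in \<open>auto simp: Lo_def Up_def\<close>)
    have c'_lt: "(lt A i y z \<longleftrightarrow> lt A i c' (h z)) \<and> (lt A i z y \<longleftrightarrow> lt A i (h z) c')" if z: "z \<in> T - {y}" "i < n" for i z
    proof -
      have zA: "z \<in> univ A" using z T by auto
      consider "lt A i z y" "h z \<in> Lo i" | "lt A i y z" "h z \<in> Up i"
        using lt_total[OF mo z(2) zA yA] z unfolding Lo_def Up_def by auto
      then show ?thesis
        using c'(2,3)[OF z(2), of "h z"] lt_asym[OF mo z(2) zA yA] lt_asym[OF mo z(2) yA zA]
          lt_asym[OF mo z(2) c'(1) hA[OF z(1)]] lt_asym[OF mo z(2) hA[OF z(1)] c'(1)] by cases auto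
    qed
    have "partial_iso n A A (T - {y}) id h"
      unfolding partial_iso_def
    proof (intro conjI ballI allI impI)
      show "lt A i (id z) (id z') \<longleftrightarrow> lt A i (h z) (h z')" if "z \<in> T - {y}" "z' \<in> T - {y}" "i < n" for z z' i
        using Y_lt[OF Yc, of z z' i] that by auto
    qed (use T(2) hA in auto)
    then have "partial_iso n A A T (id(y := y)) (h(y := c'))"
      using c'_lt by (intro partial_iso_update[OF mo mo _ yA c'(1)]) auto
    then have "Y c'" unfolding Y_def using fun_upd_triv[of id y] by simp
    moreover have "lt A j c c'" using c'(2)[OF j, of c] unfolding Lo_def by simp
    ultimately show ?thesis by blast
  qed
  have "Y (h y)"
    using h(1) unfolding Y_def fun_upd_triv partial_iso_def T_def by blast
  then have "\<exists>c. \<forall>l. Y (c l) \<and> lt A j (c l) (c (Suc l))"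
    using step by (intro dependent_nat_choice) auto
  then obtain c where c: "\<And>l. Y (c l)" "\<And>l. lt A j (c l) (c (Suc l))" by blast
  have cA: "c l \<in> univ A" for l using Y_univ[OF c(1) T(3)] by simp
  have uc: "lt A j u (c l)" for l
    using Y_lt[OF c(1), of u' y j l] T(3) j y_ne h(2) lt_trans[OF mo j u'(1) xA yA] u'(3)[OF j, of x] lt_xy
    unfolding T_def by auto
  have cv: "lt A j (c l) v" for l
    using Y_lt[OF c(1), of y v' j l] T(3) j y_ne h(3) v'(2)[OF j, of y]
    unfolding T_def x'_def by auto
  define g where "g l = h(y := c l)" for l
  have g_lt: "lt A i s t \<longleftrightarrow> lt A i (g l s) (g l t)" if "s \<in> T" "t \<in> T" "i < n" for s t i l
    using Y_lt[OF c(1)] that unfolding g_def by blast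
  have g_uv: "g l u' = u" "g l v' = v" "g l y = c l" for l using y_ne h unfolding g_def by auto
  have gA: "g l z \<in> univ A" if "z \<in> ?S" for l z
    using h(1) cA that unfolding g_def partial_iso_def by auto
  have ST: "z \<in> T" if "z \<in> ?S" "z \<noteq> x" for z using that unfolding T_def by auto
  have uvT: "u' \<in> T" "v' \<in> T" unfolding T_def by auto
  text \<open>A point \<open>z\<close> of the box lies relative to the copy like \<open>x\<close> or like \<open>w\<close>, depending only on its
    \<open><\<^sub>j\<close>-position relative to \<open>c l\<close>.\<close>
  have side: "(lt A i s (if lt A j z (c l) then x else w) \<longleftrightarrow> lt A i (g l s) z) \<and>
      (lt A i (if lt A j z (c l) then x else w) s \<longleftrightarrow> lt A i z (g l s))"
    if z: "z \<in> univ A" "\<And>i. i < n \<Longrightarrow> lt A i u z \<and> lt A i z v" "z \<noteq> c l" and s: "s \<in> ?S" "s \<noteq> x" and i: "i < n"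
    for z l s i
  proof (cases "s = y \<and> i = j")
    case True
    have "lt A j z (c l) \<or> lt A j (c l) z" using lt_total[OF mo j z(1) cA] z(3) by blast
    then show ?thesis using True g_uv lt_xy yw lt_asym[OF mo j xA yA] lt_asym[OF mo j yA w]
        lt_asym[OF mo j z(1) cA] lt_asym[OF mo j cA z(1)] by auto
  next
    case False
    define e where "e = (if lt A j z (c l) then x else w)"
    have eA: "e \<in> univ A" using xA w unfolding e_def by auto
    have "(lt A i s x \<and> lt A i s e) \<or> (lt A i (x' i) s \<and> lt A i e s)"
    proof (cases "i = j")
      case True
      then have "lt A j s x \<or> lt A j y s" using adj[OF s(1)] s False by auto
      then show ?thesis
      proof
        assume *: "lt A j s x"
        then have "lt A j s w" using lt_trans[OF mo j SA[OF s(1)] xA yA _ lt_xy] lt_trans[OF mo j SA[OF s(1)] yA w _ yw] by blast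
        with * True show ?thesis unfolding e_def by auto
      next
        assume *: "lt A j y s"
        then have "lt A j x s" using lt_trans[OF mo j xA yA SA[OF s(1)] lt_xy] by blast
        with * True wu[OF s(1)] show ?thesis unfolding e_def x'_def by auto
      qed
    next
      case False
      then show ?thesis using lt_total[OF mo i SA[OF s(1)] xA] s wi[OF i False s] unfolding e_def x'_def by auto
    qed
    then have "(lt A i s e \<and> lt A i (g l s) z) \<or> (lt A i e s \<and> lt A i z (g l s))"
    proof
      assume *: "lt A i s x \<and> lt A i s e"
      then have "lt A i s u'" using u'(2)[OF i, of s] s(1) by auto
      then have "lt A i (g l s) u" using g_lt[OF ST[OF s] uvT(1) i, of l] g_uv by simp
      with * show ?thesis using lt_trans[OF mo i gA[OF s(1)] u z(1)] z(2)[OF i] by blast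
    next
      assume *: "lt A i (x' i) s \<and> lt A i e s"
      then have "lt A i v' s" using v'(3)[OF i, of s] s(1) by auto
      then have "lt A i v (g l s)" using g_lt[OF uvT(2) ST[OF s] i, of l] g_uv by simp
      with * show ?thesis using lt_trans[OF mo i z(1) v gA[OF s(1)]] z(2)[OF i] by blast
    qed
    then show ?thesis unfolding e_def[symmetric]
      using lt_asym[OF mo i SA[OF s(1)] eA] lt_asym[OF mo i eA SA[OF s(1)]]
        lt_asym[OF mo i z(1) gA[OF s(1)]] lt_asym[OF mo i gA[OF s(1)] z(1)] by blast
  qed
  have I: "length (I z) = k" "set (I z) \<subseteq> univ U" if "z \<in> univ A" for z
    using ind that unfolding indisc_picture_def realizations_def tuples_def by auto
  have lenI: "length (concat (map I s)) = length s * k" if "set s \<subseteq> univ A" for s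
    using length_concat_uniform[of "map I s" k] I that by auto
  \<comment> \<open>With \<open>z\<close> in the place of \<open>x\<close>, the copy has the
    quantifier-free type of \<open>a\<close> or of the moved tuple, so indiscernibility determines
    the type of its image.\<close>
  have moved: "same_tp L U (concat (map I (map ((g l)(x := z)) a)))
      (concat (map I (map (id(x := if lt A j z (c l) then x else w)) a)))"
    if z: "z \<in> univ A" "\<And>i. i < n \<Longrightarrow> lt A i u z \<and> lt A i z v" "z \<noteq> c l" for z l
  proof -
    define e where "e = (if lt A j z (c l) then x else w)"
    have eA: "e \<in> univ A" using xA w unfolding e_def by auto
    have "partial_iso n A A (?S - {x}) id (g l)"
      unfolding partial_iso_def using g_lt ST gA S by auto
    then have iso: "partial_iso n A A ?S (id(x := e)) ((g l)(x := z))"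
      using side[OF z] by (intro partial_iso_update[OF mo mo _ eA z(1)]) (auto simp: e_def)
    have sub: "set (map (id(x := e)) a) \<subseteq> univ A" "set (map ((g l)(x := z)) a) \<subseteq> univ A"
      using iso unfolding partial_iso_def by auto
    have "same_qftp (mlo_lang {..<n}) A (map ((g l)(x := z)) a) (map (id(x := e)) a)"
      unfolding same_qftp_mlo[OF sub(2,1)]
    proof (intro conjI allI impI ballI)
      fix p q assume *: "p < length (map ((g l)(x := z)) a)" "q < length (map ((g l)(x := z)) a)"
      then have pq: "a ! p \<in> ?S" "a ! q \<in> ?S" by auto
      show "map ((g l)(x := z)) a ! p = map ((g l)(x := z)) a ! q \<longleftrightarrow> map (id(x := e)) a ! p = map (id(x := e)) a ! q"
        using partial_iso_eq[OF mo mo n iso pq] * by (simp del: fun_upd_apply)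
      fix i assume "i \<in> {..<n}"
      then show "lt A i (map ((g l)(x := z)) a ! p) (map ((g l)(x := z)) a ! q) \<longleftrightarrow>
          lt A i (map (id(x := e)) a ! p) (map (id(x := e)) a ! q)"
        using iso pq * unfolding partial_iso_def by (simp del: fun_upd_apply)
    qed simp
    moreover have "map (id(x := e)) a \<in> tuples A (length a)" "map ((g l)(x := z)) a \<in> tuples A (length a)"
      using sub unfolding tuples_def by simp_all
    moreover have "length a > 0" using xy by auto
    ultimately show ?thesis
      using ind unfolding indisc_picture_def e_def[symmetric] by meson
  qed
  have aw: "set (map (id(x := w)) a) \<subseteq> univ A" using S w by auto
  obtain \<phi> where \<phi>: "formula L (length a * k) \<phi>" "\<not> holds U \<phi> (concat (map I a))"
      "holds U \<phi> (concat (map I (map (id(x := w)) a)))"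
    using not_same_tp_separated[OF tp] lenI[OF S] lenI[OF aw] by (metis length_map)
  \<comment> \<open>\<open>x\<close> may occur several times in \<open>a\<close>. All its
    occurrences read the one tuple \<open>I z\<close>, and the other positions read
    \<open>b l\<close>; the entries of \<open>b l\<close> at positions of \<open>x\<close> are never
    read.\<close>
  define \<rho> where "\<rho> t = (if a ! (t div k) = x then t mod k else k + t)" for t
  obtain \<psi> where \<psi>: "wf_fm L \<psi>" "fv \<psi> \<subseteq> \<rho> ` fv \<phi>" "\<forall>v. sat U v \<psi> = sat U (v \<circ> \<rho>) \<phi>"
    using ex_rename[of L \<phi>] \<phi>(1) unfolding formula_def by metis
  define b where "b l = concat (map I (map (g l) a))" for l
  have ga: "set (map (g l) a) \<subseteq> univ A" for l using gA by auto
  have "\<rho> t < k + length a * k" if "t < length a * k" for t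
  proof -
    have "0 < k" using that by (cases k) auto
    then have "t mod k < k" by simp
    then show ?thesis using that unfolding \<rho>_def by (simp add: trans_less_add1)
  qed
  then have f\<psi>: "formula L (k + length a * k) \<psi>"
    using \<psi>(1,2) \<phi>(1) unfolding formula_def by fastforce
  have bU: "b l \<in> tuples U (length a * k)" for l
    using lenI[OF ga] I ga[of l] unfolding b_def tuples_def by fastforce
  have eq: "holds U \<psi> (I z @ b l) \<longleftrightarrow> holds U \<phi> (concat (map I (map ((g l)(x := z)) a)))" if z: "z \<in> univ A" for z l
  proof -
    have "(I z @ b l) ! \<rho> t = concat (map I (map ((g l)(x := z)) a)) ! t" if t: "t < length a * k" for t
    proof -
      have k: "0 < k" using t by (cases k) auto
      have p: "t div k < length a" using t by (simp add: less_mult_imp_div_less)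
      have "set (map ((g l)(x := z)) a) \<subseteq> univ A" using gA z by auto
      then have 1: "concat (map I (map ((g l)(x := z)) a)) ! t = I (((g l)(x := z)) (a ! (t div k))) ! (t mod k)"
        using nth_concat_uniform[of "map I (map ((g l)(x := z)) a)" k t] I t p by (auto simp del: fun_upd_apply)
      have "length s = k" if "s \<in> set (map I (map (g l) a))" for s using that I(1) gA by auto
      then have 2: "b l ! t = I (g l (a ! (t div k))) ! (t mod k)"
        unfolding b_def using nth_concat_uniform[of "map I (map (g l) a)" k t] t p by simp
      show ?thesis
        unfolding 1 \<rho>_def using I[OF z] k 2 by (simp add: nth_append)
    qed
    then have "sat U (nth (I z @ b l) \<circ> \<rho>) \<phi> \<longleftrightarrow> holds U \<phi> (concat (map I (map ((g l)(x := z)) a)))"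
      using \<phi>(1) unfolding formula_def by (intro sat_cong) auto
    with \<psi>(3) show ?thesis by simp
  qed
  have "(lt A j (c l) z \<longrightarrow> holds U \<psi> (I z @ b l)) \<and> (lt A j z (c l) \<longrightarrow> \<not> holds U \<psi> (I z @ b l))"
    if z: "z \<in> univ A" "\<forall>i<n. lt A i u z \<and> lt A i z v" for l z
  proof (cases "z = c l")
    case True
    then show ?thesis using lt_irrefl[OF mo j z(1)] by auto
  next
    case False
    have sub: "set (map ((g l)(x := z)) a) \<subseteq> univ A" using gA z by auto
    have tp': "holds U \<phi> (concat (map I (map ((g l)(x := z)) a))) \<longleftrightarrow>
        holds U \<phi> (concat (map I (map (id(x := if lt A j z (c l) then x else w)) a)))"
      using moved[of z l] z False \<phi>(1) lenI[OF sub] unfolding same_tp_def by (auto simp del: fun_upd_apply)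
    have "map (id(x := x)) a = a" by (intro map_idI) simp
    then show ?thesis unfolding eq[OF z(1)] tp'
      using \<phi>(2,3) lt_asym[OF mo j z(1) cA] lt_asym[OF mo j cA z(1)] by (auto simp del: fun_upd_apply)
  qed
  then show ?thesis using f\<psi> bU cA uc cv c(2)
    by (intro exI[of _ "length a * k"] exI[of _ \<psi>] exI[of _ b] exI[of _ c]) blast
qed

lemma realized_consistent: "a \<in> realizations M k \<pi> \<Longrightarrow> consistent M k \<pi>"
  unfolding consistent_def realizations_def by blast

text \<open>The formulas for all \<open>j\<close> are valid on one common box. Richness can
  therefore prescribe the position of a single \<open>z\<close> against every sequence
  \<open>c j\<close> at once, and \<open>I z\<close> realizes the pattern for the given
  function.\<close>

proposition non_collapse_opD_ge:
  fixes I :: "'a \<Rightarrow> 'm list"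
  assumes n: "0 < n" and A: "rich n A" and ind: "indisc_picture L U k \<pi> {..<n} A I"
    and nc: "\<And>j. j < n \<Longrightarrow> \<not> indisc_picture L U k \<pi> ({..<n} - {j}) A I"
  shows "opD_ge L U k \<pi> n"
proof -
  note mo = rich_multi_order[OF A]
  obtain u where u: "u \<in> univ A" using rich_univ_nonempty[OF A] by blast
  obtain v where v: "v \<in> univ A" "\<And>i z. i < n \<Longrightarrow> z \<in> {u} \<Longrightarrow> lt A i z v"
    by (rule rich_point[OF A, of "\<lambda>_. {u}" "\<lambda>_. {}"]) (use u in auto)
  have "\<exists>m \<psi> b c. formula L (k + m) \<psi> \<and> (\<forall>l::nat. b l \<in> tuples U m \<and> c l \<in> univ A \<and>
      lt A j u (c l) \<and> lt A j (c l) v \<and> lt A j (c l) (c (Suc l))) \<and>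
    (\<forall>l. \<forall>z\<in>univ A. (\<forall>i<n. lt A i u z \<and> lt A i z v) \<longrightarrow>
      (lt A j (c l) z \<longrightarrow> holds U \<psi> (I z @ b l)) \<and> (lt A j z (c l) \<longrightarrow> \<not> holds U \<psi> (I z @ b l)))"
    if j: "j < n" for j
  proof -
    have "inj_on I (univ A) \<and> I ` univ A \<subseteq> realizations U k \<pi>"
      using ind unfolding indisc_picture_def by (elim conjE) (rule conjI)
    then have "\<not> (\<forall>l>0. \<forall>a\<in>tuples A l. \<forall>b\<in>tuples A l. same_qftp (mlo_lang ({..<n} - {j})) A a b \<longrightarrow>
        same_tp L U (concat (map I a)) (concat (map I b)))"
      using nc[OF j] unfolding indisc_picture_def by (simp only: simp_thms)
    then obtain l a b where ab: "a \<in> tuples A l" "b \<in> tuples A l" "same_qftp (mlo_lang ({..<n} - {j})) A a b"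
        "\<not> same_tp L U (concat (map I a)) (concat (map I b))"
      by blast
    then obtain a x y w where "critical_move n j A (set a) x y w"
        "\<not> same_tp L U (concat (map I a)) (concat (map I (map (id(x := w)) a)))"
      using non_collapse_critical_move[OF A j ind, of a b] unfolding tuples_def by blast
    from critical_move_box_formula[OF n A j ind this u v(1)] v(2) show ?thesis by blast
  qed
  then have "\<forall>j. \<exists>m \<psi> b c. j < n \<longrightarrow> (formula L (k + m) \<psi> \<and> (\<forall>l::nat. b l \<in> tuples U m \<and> c l \<in> univ A \<and>
      lt A j u (c l) \<and> lt A j (c l) v \<and> lt A j (c l) (c (Suc l))) \<and>
    (\<forall>l. \<forall>z\<in>univ A. (\<forall>i<n. lt A i u z \<and> lt A i z v) \<longrightarrow>
      (lt A j (c l) z \<longrightarrow> holds U \<psi> (I z @ b l)) \<and> (lt A j z (c l) \<longrightarrow> \<not> holds U \<psi> (I z @ b l))))"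
    by blast
  then obtain m \<psi> b c where *: "\<And>j. j < n \<Longrightarrow> formula L (k + m j) (\<psi> j)"
      "\<And>j l. j < n \<Longrightarrow> b j l \<in> tuples U (m j) \<and> c j l \<in> univ A \<and> lt A j u (c j l) \<and> lt A j (c j l) v \<and>
        lt A j (c j l) (c j (Suc l))"
      "\<And>j l z. j < n \<Longrightarrow> z \<in> univ A \<Longrightarrow> (\<forall>i<n. lt A i u z \<and> lt A i z v) \<Longrightarrow>
      (lt A j (c j l) z \<longrightarrow> holds U (\<psi> j) (I z @ b j l)) \<and> (lt A j z (c j l) \<longrightarrow> \<not> holds U (\<psi> j) (I z @ b j l))"
    unfolding choice_iff by blast
  have c_mono: "lt A j (c j l) (c j l')" if "j < n" "l < l'" for j l l'
    using that(2)
  proof (induction l' rule: less_Suc_induct)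
    case (1 l)
    then show ?case using *(2)[OF that(1)] by blast
  next
    case (2 l l' l'')
    then show ?case using lt_trans[OF mo that(1)] *(2)[OF that(1)] by blast
  qed
  show ?thesis unfolding opD_ge_def
  proof (rule exI[of _ m], rule exI[of _ \<psi>], rule exI[of _ b], intro conjI allI impI)
    fix f :: "nat \<Rightarrow> nat"
    \<comment> \<open>In the order \<open>i\<close> the point goes between the first
      \<open>f i\<close> members of the sequence and the next one; monotonicity takes care of all
      later members.\<close>
    obtain z where z: "z \<in> univ A" "\<And>i s. i < n \<Longrightarrow> s \<in> insert u (c i ` {..<f i}) \<Longrightarrow> lt A i s z"
        "\<And>i s. i < n \<Longrightarrow> s \<in> {v, c i (f i)} \<Longrightarrow> lt A i z s"
      by (rule rich_point[OF A, of "\<lambda>i. insert u (c i ` {..<f i})" "\<lambda>i. {v, c i (f i)}"])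
        (use u v *(2) c_mono in auto)
    have box: "\<forall>i<n. lt A i u z \<and> lt A i z v" using z(2,3) by blast
    have pos: "holds U (\<psi> i) (I z @ b i l)" if "i < n" "l < f i" for i l
      using *(3)[OF that(1) z(1) box, of l] z(2)[OF that(1), of "c i l"] that(2) by auto
    have neg: "\<not> holds U (\<psi> i) (I z @ b i l)" if "i < n" "l \<ge> f i" for i l
    proof -
      have cA: "c i l' \<in> univ A" for l' using *(2)[OF that(1)] by blast
      have 1: "lt A i z (c i (f i))" using z(3)[OF that(1), of "c i (f i)"] by simp
      have "lt A i z (c i l)"
      proof (cases "f i = l")
        case False
        with that(2) have "lt A i (c i (f i)) (c i l)" by (intro c_mono[OF that(1)]) simp
        then show ?thesis by (rule lt_trans[OF mo that(1) z(1) cA cA 1])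
      qed (use 1 in simp)
      with *(3)[OF that(1) z(1) box, of l] show ?thesis by blast
    qed
    have "I ` univ A \<subseteq> realizations U k \<pi>" using ind unfolding indisc_picture_def by (elim conjE)
    then have Iz: "I z \<in> realizations U k \<pi>" using z(1) by blast
    have "I z \<in> realizations U k (\<pi> \<union> {(\<psi> i, b i j) | i j. i < n \<and> j < f i}
        \<union> {(Neg (\<psi> i), b i j) | i j. i < n \<and> j \<ge> f i})"
      unfolding realizations_def mem_Collect_eq
    proof (intro conjI ballI)
      show "I z \<in> tuples U k" using Iz unfolding realizations_def by blast
      fix q assume "q \<in> \<pi> \<union> {(\<psi> i, b i j) | i j. i < n \<and> j < f i}
        \<union> {(Neg (\<psi> i), b i j) | i j. i < n \<and> j \<ge> f i}"
      then consider "q \<in> \<pi>" | i j where "q = (\<psi> i, b i j)" "i < n" "j < f i"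
        | i j where "q = (Neg (\<psi> i), b i j)" "i < n" "j \<ge> f i"
        by blast
      then show "case q of (\<phi>, c) \<Rightarrow> holds U \<phi> (I z @ c)"
      proof cases
        case 1
        then show ?thesis using Iz unfolding realizations_def by blast
      qed (use pos neg in auto)
    qed
    then show "consistent U k (\<pi> \<union> {(\<psi> i, b i j) | i j. i < n \<and> j < f i}
        \<union> {(Neg (\<psi> i), b i j) | i j. i < n \<and> j \<ge> f i})"
      by (rule realized_consistent)
  next
    fix i assume i: "i < n"
    show "formula L (k + m i) (\<psi> i)" by (rule *(1)[OF i])
    fix l show "b i l \<in> tuples U (m i)" using *(2)[OF i, of l] by (elim conjE)
  qed
qed

section \<open>Homogeneous placements of finitely many points\<close>

definition homogeneous :: "nat set \<Rightarrow> nat \<times> (nat set \<Rightarrow> bool) \<Rightarrow> bool" where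
  "homogeneous H q \<longleftrightarrow> (\<forall>X Y. X \<subseteq> H \<and> finite X \<and> card X = fst q \<and> Y \<subseteq> H \<and> finite Y \<and> card Y = fst q \<longrightarrow>
     (snd q X \<longleftrightarrow> snd q Y))"

text \<open>The colourings are treated one after another; passing to an infinite subset preserves
  the homogeneity obtained before.\<close>

lemma ramsey_finitely_many:
  assumes "finite \<Q>" "infinite Z"
  shows "\<exists>H\<subseteq>Z. infinite H \<and> (\<forall>q\<in>\<Q>. homogeneous H q)"
  using assms(1)
proof (induction \<Q> rule: finite_induct)
  case empty
  then show ?case using assms(2) by auto
next
  case (insert q \<Q>)
  obtain H where H: "H \<subseteq> Z" "infinite H" "\<forall>q\<in>\<Q>. homogeneous H q" using insert.IH by blast
  have "\<forall>X. X \<subseteq> H \<and> finite X \<and> card X = fst q \<longrightarrow> of_bool (snd q X) < (2::nat)" by (simp add: of_bool_def)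
  from Ramsey[OF H(2) this] obtain H' t where H': "H' \<subseteq> H" "infinite H'"
      "\<forall>X. X \<subseteq> H' \<and> finite X \<and> card X = fst q \<longrightarrow> of_bool (snd q X) = (t::nat)"
    by blast
  have "snd q X \<longleftrightarrow> snd q Y"
    if "X \<subseteq> H'" "finite X" "card X = fst q" "Y \<subseteq> H'" "finite Y" "card Y = fst q" for X Y
  proof -
    have "of_bool (snd q X) = (of_bool (snd q Y) :: nat)" using H'(3) that by simp
    then show ?thesis by (simp only: of_bool_eq_iff)
  qed
  then have "homogeneous H' q" unfolding homogeneous_def by blast
  moreover have "homogeneous H' q'" if "q' \<in> \<Q>" for q'
  proof -
    have "homogeneous H q'" using H(3) that by blast
    then show ?thesis unfolding homogeneous_def using H'(1) by (meson subset_trans)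
  qed
  ultimately have "\<forall>q'\<in>insert q \<Q>. homogeneous H' q'" by blast
  with H'(1,2) H(1) show ?case by blast
qed

text \<open>Ramsey's theorem colours sets, whereas formulas speak of tuples. Together with a list of
  ranks, \<open>nth_elem\<close> reads a tuple back from a bare set.\<close>

definition nth_elem :: "nat set \<Rightarrow> nat \<Rightarrow> nat" where
  "nth_elem X m = (THE x. x \<in> X \<and> card {y \<in> X. y < x} = m)"

lemma nth_elem_rank:
  assumes "finite X" "x \<in> X"
  shows "nth_elem X (card {y \<in> X. y < x}) = x"
  unfolding nth_elem_def
proof (rule the_equality)
  fix x' assume x': "x' \<in> X \<and> card {y \<in> X. y < x'} = card {y \<in> X. y < x}"
  have less: "card {y \<in> X. y < a} < card {y \<in> X. y < b}" if "a < b" "a \<in> X" for a b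
    using assms(1) that by (intro psubset_card_mono) auto
  have "\<not> x < x'" using less[of x x'] x' assms(2) by linarith
  moreover have "\<not> x' < x" using less[of x' x] x' by linarith
  ultimately show "x' = x" by linarith
qed (use assms in auto)

text \<open>The maps need not be injective, since tuples may repeat points: by totality, agreeing on
  strict inequalities forces agreeing on ties.\<close>

lemma card_image_same_order:
  fixes f f' :: "'a \<Rightarrow> nat"
  assumes "\<And>x y. x \<in> K \<Longrightarrow> y \<in> K \<Longrightarrow> f x < f y \<longleftrightarrow> f' x < f' y"
  shows "card (f ` K) = card (f' ` K)"
proof -
  have eq: "f x = f y \<longleftrightarrow> f' x = f' y" if "x \<in> K" "y \<in> K" for x y
    using assms[OF that] assms[OF that(2,1)] by (metis less_irrefl linorder_neqE_nat)
  define g where "g = f' \<circ> inv_into K f"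
  have g: "g (f x) = f' x" if "x \<in> K" for x
    using eq[of "inv_into K f (f x)" x] that inv_into_into[of "f x" f K] f_inv_into_f[of "f x" f K]
    unfolding g_def by auto
  have "g ` f ` K = f' ` K" using g by (force simp: image_image)
  moreover have "inj_on g (f ` K)" using g eq by (auto intro!: inj_onI)
  ultimately show ?thesis by (metis card_image)
qed

lemma rank_same_order:
  fixes f f' :: "'a \<Rightarrow> nat"
  assumes "\<And>x y. x \<in> K \<Longrightarrow> y \<in> K \<Longrightarrow> f x < f y \<longleftrightarrow> f' x < f' y" "x \<in> K"
  shows "card {w \<in> f ` K. w < f x} = card {w \<in> f' ` K. w < f' x}"
proof -
  have "{w \<in> f ` K. w < f x} = f ` {y \<in> K. f y < f x}" by auto
  moreover have "{w \<in> f' ` K. w < f' x} = f' ` {y \<in> K. f y < f x}" using assms by auto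
  moreover have "card (f ` {y \<in> K. f y < f x}) = card (f' ` {y \<in> K. f y < f x})"
    using assms(1) by (intro card_image_same_order) auto
  ultimately show ?thesis by simp
qed

definition same_pattern :: "nat \<Rightarrow> (nat \<Rightarrow> nat \<Rightarrow> rat) \<Rightarrow> nat list \<Rightarrow> nat list \<Rightarrow> bool" where
  "same_pattern n c ss ts \<longleftrightarrow> length ss = length ts \<and>
     (\<forall>p<length ss. \<forall>q<length ss. \<forall>i<n. c (ss ! p) i < c (ss ! q) i \<longleftrightarrow> c (ts ! p) i < c (ts ! q) i)"

text \<open>The Ramsey property of multi-orders: all coordinates are embedded into one \<open>\<omega>\<close>, the values of
  coordinate \<open>i\<close> forming the \<open>i\<close>-th block, so that tuples with the same pattern become finite sets of the
  same size and the usual Ramsey theorem applies.\<close>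

proposition ramsey_multi_order:
  fixes c :: "nat \<Rightarrow> nat \<Rightarrow> rat" and P :: "'d \<Rightarrow> 'a list \<Rightarrow> bool" and \<alpha> :: "(nat \<Rightarrow> nat) \<Rightarrow> 'a"
  assumes inj: "\<And>i. inj (\<lambda>s. c s i)" and fin: "finite \<D>"
    and pat: "\<And>d ss ts. (d, ss, ts) \<in> \<D> \<Longrightarrow> same_pattern n c ss ts \<and> set ss \<subseteq> {..<N} \<and> set ts \<subseteq> {..<N}"
  shows "\<exists>e :: nat \<Rightarrow> nat \<Rightarrow> nat.
    (\<forall>i<n. \<forall>s<N. \<forall>t<N. c s i < c t i \<longrightarrow> e s i < e t i) \<and> (\<forall>s. \<forall>i<n. 0 < e s i) \<and>
    (\<forall>(d, ss, ts)\<in>\<D>. P d (map (\<lambda>s. \<alpha> (e s)) ss) \<longleftrightarrow> P d (map (\<lambda>s. \<alpha> (e s)) ts))"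
proof -
  \<comment> \<open>The rank of the point \<open>s\<close> in coordinate \<open>i\<close>, moved
    into the \<open>i\<close>-th interval of length \<open>N\<close>. Different coordinates are thus
    compared by their index alone.\<close>
  define pos where "pos i s = i * N + card {t. t < N \<and> c t i < c s i}" for i s
  have card_less: "card {t. t < N \<and> c t i < c s i} < card {t. t < N \<and> c t i < c s' i}"
    if "s < N" "c s i < c s' i" for s s' i
    using that by (intro psubset_card_mono) auto
  have card_N: "card {t. t < N \<and> c t i < c s i} < N" if "s < N" for s i
  proof -
    have "{t. t < N \<and> c t i < c s i} \<subset> {..<N}" using that by auto
    then show ?thesis using psubset_card_mono[of "{..<N}"] by simp
  qed
  have pos_less: "pos i s < pos i' s'" if "s < N" "s' < N" "i < i' \<or> i = i' \<and> c s i < c s' i" for i s i' s'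
  proof (cases "i < i'")
    case True
    have "pos i s < Suc i * N" unfolding pos_def using card_N[OF that(1), of i] by simp
    also have "\<dots> \<le> i' * N" using True by (intro mult_le_mono1) simp
    finally show ?thesis unfolding pos_def by simp
  next
    case False
    then show ?thesis using that card_less[OF that(1)] unfolding pos_def by auto
  qed
  have c_eq: "c s i = c s' i \<longleftrightarrow> s = s'" for s s' i using inj[of i] unfolding inj_def by blast
  have pos_iff: "pos i s < pos i' s' \<longleftrightarrow> i < i' \<or> i = i' \<and> c s i < c s' i" if "s < N" "s' < N" for i s i' s'
  proof -
    consider "i < i' \<or> i = i' \<and> c s i < c s' i" | "i' < i \<or> i' = i \<and> c s' i' < c s i'" | "i = i'" "s = s'"
      using c_eq[of s i s'] by (metis linorder_neqE nat_neq_iff)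
    then show ?thesis
    proof cases
      case 2
      then show ?thesis using pos_less[OF that(2,1), of i' i] by auto
    qed (use pos_less[OF that] in auto)
  qed
  define W where "W ss = (\<lambda>(i, p). pos i (ss ! p)) ` ({..<n} \<times> {..<length ss})" for ss
  have W_mem: "pos i (ss ! p) \<in> W ss" if "i < n" "p < length ss" for i p ss using that unfolding W_def by auto
  define rank where "rank ss i p = card {w \<in> W ss. w < pos i (ss ! p)}" for ss i p
  \<comment> \<open>\<open>Suc\<close> keeps all values positive, which leaves 0 free as a position
    below every point. The fixed value outside the n orders makes the index function depend on the
    relevant coordinates only.\<close>
  define pt where "pt e = \<alpha> (\<lambda>i. if i < n then Suc (e i) else 0)" for e
  \<comment> \<open>A set \<open>X\<close> is turned into a tuple by the ranks of \<open>ss\<close>.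
    Tuples of the same pattern have the same ranks and equally large sets \<open>W\<close>, so one
    colouring evaluates both.\<close>
  define Q where "Q = (\<lambda>(d, ss, ts :: nat list) X. P d (map (\<lambda>p. pt (\<lambda>i. nth_elem X (rank ss i p))) [0..<length ss]))"
  obtain H where H: "infinite H" "\<forall>q\<in>(\<lambda>(d, ss, ts). (card (W ss), Q (d, ss, ts))) ` \<D>. homogeneous H q"
    using ramsey_finitely_many[OF finite_imageI[OF fin] infinite_UNIV_nat] by blast
  define h where "h = enumerate H"
  have h: "strict_mono h" "range h = H"
    unfolding h_def using H(1) by (simp_all add: strict_mono_enumerate range_enumerate)
  have h_less: "h x < h y \<longleftrightarrow> x < y" for x y using h(1) by (rule strict_mono_less)
  have inj_h: "inj_on h V" for V by (rule strict_mono_imp_inj_on[OF h(1)])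
  define e where "e s i = (if i < n then Suc (h (pos i s)) else 0)" for s i
  have nth_h: "nth_elem (h ` W ss) (rank ss i p) = h (pos i (ss ! p))" if "i < n" "p < length ss" for ss i p
  proof -
    have "{y \<in> h ` W ss. y < h (pos i (ss ! p))} = h ` {w \<in> W ss. w < pos i (ss ! p)}"
      using h_less by auto
    then have "card {y \<in> h ` W ss. y < h (pos i (ss ! p))} = rank ss i p"
      unfolding rank_def using card_image[OF inj_h] by simp
    moreover have "finite (W ss)" unfolding W_def by auto
    ultimately show ?thesis using nth_elem_rank[of "h ` W ss" "h (pos i (ss ! p))"] W_mem[OF that] by auto
  qed
  have pt_e: "pt (\<lambda>i. nth_elem (h ` W ss) (rank ss i p)) = \<alpha> (e (ss ! p))" if "p < length ss" for ss p
  proof -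
    have "(\<lambda>i. if i < n then Suc (nth_elem (h ` W ss) (rank ss i p)) else 0) = e (ss ! p)"
      using nth_h[OF _ that] by (auto simp: e_def)
    then show ?thesis unfolding pt_def by simp
  qed
  have "P d (map (\<lambda>s. \<alpha> (e s)) ss) \<longleftrightarrow> P d (map (\<lambda>s. \<alpha> (e s)) ts)" if D: "(d, ss, ts) \<in> \<D>" for d ss ts
  proof -
    note pt_D = pat[OF D]
    have len: "length ss = length ts" using pt_D unfolding same_pattern_def by blast
    have N: "ss ! p < N" "ts ! p < N" if "p < length ss" for p
    proof -
      have "ss ! p \<in> set ss" "ts ! p \<in> set ts" using that len by auto
      then show "ss ! p < N" "ts ! p < N" using pt_D by auto
    qed
    let ?f = "\<lambda>(i, p). pos i (ss ! p)" and ?f' = "\<lambda>(i, p). pos i (ts ! p)"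
      and ?K = "{..<n} \<times> {..<length ss}"
    have ord: "?f x < ?f y \<longleftrightarrow> ?f' x < ?f' y" if "x \<in> ?K" "y \<in> ?K" for x y
      using that pos_iff N pt_D unfolding same_pattern_def by auto
    have Ws: "W ss = ?f ` ?K" "W ts = ?f' ` ?K" unfolding W_def using len by auto
    have rank_eq: "rank ts i p = rank ss i p" if "i < n" "p < length ss" for i p
      using rank_same_order[of ?K ?f ?f' "(i, p)", OF ord] that unfolding rank_def Ws by auto
    have pt_eq: "pt (\<lambda>i. nth_elem X (rank ss i p)) = pt (\<lambda>i. nth_elem X (rank ts i p))" if "p < length ss" for X p
    proof -
      have "(\<lambda>i. if i < n then Suc (nth_elem X (rank ss i p)) else 0) =
          (\<lambda>i. if i < n then Suc (nth_elem X (rank ts i p)) else 0)"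
        using rank_eq[OF _ that] by auto
      then show ?thesis unfolding pt_def by simp
    qed
    have "map (\<lambda>s. \<alpha> (e s)) ss = map (\<lambda>p. pt (\<lambda>i. nth_elem (h ` W ss) (rank ss i p))) [0..<length ss]"
      by (intro nth_equalityI) (auto simp: pt_e)
    then have 1: "P d (map (\<lambda>s. \<alpha> (e s)) ss) \<longleftrightarrow> Q (d, ss, ts) (h ` W ss)" unfolding Q_def by simp
    have "map (\<lambda>s. \<alpha> (e s)) ts = map (\<lambda>p. pt (\<lambda>i. nth_elem (h ` W ts) (rank ss i p))) [0..<length ss]"
      using len by (intro nth_equalityI) (auto simp: pt_e pt_eq)
    then have 2: "P d (map (\<lambda>s. \<alpha> (e s)) ts) \<longleftrightarrow> Q (d, ss, ts) (h ` W ts)" unfolding Q_def by simp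
    have "card (W ts) = card (W ss)" unfolding Ws by (rule card_image_same_order[OF ord, symmetric])
    then have "card (h ` W ss) = card (W ss)" "card (h ` W ts) = card (W ss)"
      by (simp_all add: card_image[OF inj_h])
    moreover have "h ` W ss \<subseteq> H" "h ` W ts \<subseteq> H" using h(2) by auto
    moreover have "finite (h ` W ss)" "finite (h ` W ts)" unfolding W_def by auto
    moreover have "homogeneous H (card (W ss), Q (d, ss, ts))"
      using bspec[OF H(2) imageI[OF D]] by simp
    ultimately have "Q (d, ss, ts) (h ` W ss) \<longleftrightarrow> Q (d, ss, ts) (h ` W ts)"
      unfolding homogeneous_def fst_conv snd_conv by blast
    with 1 2 show ?thesis by simp
  qed
  moreover have "e s i < e t i" if "i < n" "s < N" "t < N" "c s i < c t i" for i s t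
    using pos_less[of s t i i] h_less that unfolding e_def by simp
  moreover have "0 < e s i" if "i < n" for s i using that unfolding e_def by simp
  ultimately show ?thesis by (intro exI[of _ e]) auto
qed


section \<open>From op-dimension to non-collapsing pictures\<close>

text \<open>One valuation of countably many variables codes a sequence of k-tuples, the form in
  which \<open>omega_saturation\<close> delivers the points of a picture.\<close>

definition block :: "nat \<Rightarrow> (nat \<Rightarrow> 'm) \<Rightarrow> nat \<Rightarrow> 'm list" where
  "block k v s = map v [s * k..<s * k + k]"

lemma length_block [simp]: "length (block k v s) = k"
  by (simp add: block_def)

lemma block_tuples: "range v \<subseteq> univ M \<Longrightarrow> block k v s \<in> tuples M k"
  by (auto simp: block_def tuples_def)

lemma concat_blocks: "concat (map (block k v) ss) = map v (concat (map (\<lambda>s. [s * k..<s * k + k]) ss))"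
  by (induction ss) (auto simp: block_def)

lemma length_concat_blocks: "length (concat (map (\<lambda>s. [s * k..<s * k + k]) ss)) = length ss * k"
  by (induction ss) auto

lemma block_concat:
  assumes "\<And>x. x \<in> set xs \<Longrightarrow> length x = k" "p < length xs"
  shows "block k (nth (concat xs)) p = xs ! p"
  using assms
proof (induction xs arbitrary: p)
  case (Cons x xs)
  then have x: "length x = k" by simp
  show ?case
  proof (cases p)
    case 0
    then show ?thesis using x by (auto simp: block_def nth_append intro!: nth_equalityI)
  next
    case (Suc q)
    have "block k (nth (concat (x # xs))) p = block k (nth (concat xs)) q"
      using x Suc by (auto simp: block_def nth_append intro!: nth_equalityI)
    also have "\<dots> = xs ! q" using Cons Suc by simp
    finally show ?thesis using Suc by simp
  qed
qed simp

text \<open>Quantifying over \<open>d\<close> makes separability a condition without parameters. It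
  can therefore enter the type to be realized and be transferred between tuples of the same type
  over the empty set.\<close>

lemma vdef_separated:
  assumes \<psi>: "formula L (k + m) \<psi>" and X: "finite X" and Y: "finite Y"
  shows "vdef L M B (\<lambda>v. \<exists>d\<in>tuples M m. (\<forall>s\<in>X. \<not> holds M \<psi> (block k v s @ d)) \<and>
    (\<forall>s\<in>Y. holds M \<psi> (block k v s @ d)))"
proof -
  obtain N where N: "\<And>s. s \<in> X \<union> Y \<Longrightarrow> s < N"
    using finite_nat_bounded[of "X \<union> Y"] X Y by auto
  have below: "s * k + k \<le> N * k" if "s \<in> X \<union> Y" for s
    using mult_le_mono1[of "Suc s" N k] N[OF that] by simp
  show ?thesis
  proof (rule vdef_ex_tuples[of _ _ _ _ "N * k"])
    have "vdef L M B (\<lambda>v. holds M \<psi> (block k v s @ map v [N * k..<N * k + m]))" for s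
      using vdef_holds[of L "[s * k..<s * k + k] @ [N * k..<N * k + m]" "[]" \<psi> B M] \<psi>
      by (simp add: block_def)
    then show "vdef L M B (\<lambda>v. (\<forall>s\<in>X. \<not> holds M \<psi> (block k v s @ map v [N * k..<N * k + m])) \<and>
        (\<forall>s\<in>Y. holds M \<psi> (block k v s @ map v [N * k..<N * k + m])))"
      using X Y by (intro vdef_conj vdef_Ball vdef_neg)
  next
    fix d and v w :: "nat \<Rightarrow> 'c" assume vw: "\<forall>i<N * k. v i = w i"
    have "block k v s = block k w s" if "s \<in> X \<union> Y" for s
      using vw below[OF that] unfolding block_def by auto
    then show "((\<forall>s\<in>X. \<not> holds M \<psi> (block k v s @ d)) \<and> (\<forall>s\<in>Y. holds M \<psi> (block k v s @ d))) =
        ((\<forall>s\<in>X. \<not> holds M \<psi> (block k w s @ d)) \<and> (\<forall>s\<in>Y. holds M \<psi> (block k w s @ d)))"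
      by auto
  qed
qed

text \<open>The formula behind \<open>G\<close> may mention variables beyond the tuple although
  \<open>G\<close> does not depend on them. They are all sent to variable 0, which must then be an
  entry of the tuple.\<close>

lemma same_tp_vdef:
  assumes tp: "same_tp L M a b" and G: "vdef L M {} G" and len: "0 < length a"
    and dep: "\<And>v w. \<forall>i<length a. v i = w i \<Longrightarrow> G v = G w"
  shows "G (nth a) \<longleftrightarrow> G (nth b)"
proof -
  obtain \<phi> where \<phi>: "wf_fm L \<phi>" "\<And>v. G v = sat M (prefix_val [] v) \<phi>"
    using G unfolding vdef_def by auto
  define g where "g i = (if i < length a then i else 0)" for i
  obtain \<phi>' where \<phi>': "wf_fm L \<phi>'" "fv \<phi>' \<subseteq> g ` fv \<phi>" "\<forall>v. sat M v \<phi>' = sat M (v \<circ> g) \<phi>"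
    using ex_rename[OF \<phi>(1)] by metis
  have "prefix_val [] v = v" for v :: "nat \<Rightarrow> 'c" by (auto simp: prefix_val_def)
  then have "G v = sat M v \<phi>'" for v using \<phi>(2) \<phi>'(3) dep[of v "v \<circ> g"] by (simp add: g_def)
  moreover have "formula L (length a) \<phi>'" using \<phi>'(1,2) len unfolding formula_def g_def by auto
  ultimately show ?thesis using tp unfolding same_tp_def by simp
qed

section \<open>Realizing the pattern in the monster model\<close>

lemma monster_uncountable:
  assumes "monster L T \<kappa> U"
  shows "|UNIV :: nat set| <o \<kappa>"
proof -
  have "inj_on (\<lambda>i. Eq (Var i) (Var i) :: ('a, 'b) fm) UNIV" by (rule inj_onI) simp
  moreover have "range (\<lambda>i. Eq (Var i) (Var i)) \<subseteq> {\<phi> :: ('a, 'b) fm. wf_fm L \<phi>}" by auto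
  ultimately have "|UNIV :: nat set| \<le>o |{\<phi>. wf_fm L \<phi>}|"
    unfolding card_of_ordLeq[symmetric] by blast
  with assms show ?thesis unfolding monster_def by (blast intro: ordLeq_ordLess_trans)
qed

text \<open>\<open>consistent\<close> means finite satisfiability. The parameters of \<pi> and the
  countably many \<open>b i j\<close> form a small set, so saturation realizes the type belonging to
  each \<open>f\<close>.\<close>

lemma opD_ge_realized:
  fixes U :: "('f, 'r, 'm) struct"
  assumes U: "monster L T \<kappa> U" and \<pi>: "partial_type L \<kappa> U k \<pi>" and opD: "opD_ge L U k \<pi> n"
  shows "\<exists>m \<psi> b (\<alpha> :: (nat \<Rightarrow> nat) \<Rightarrow> 'm list).
    (\<forall>i<n. formula L (k + m i) (\<psi> i) \<and> (\<forall>j. b i j \<in> tuples U (m i))) \<and>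
    (\<forall>f. \<alpha> f \<in> realizations U k \<pi> \<and> (\<forall>i<n. \<forall>j. holds U (\<psi> i) (\<alpha> f @ b i j) \<longleftrightarrow> j < f i))"
proof -
  obtain m \<psi> b where *: "\<And>i. i < n \<Longrightarrow> formula L (k + m i) (\<psi> i) \<and> (\<forall>j. b i j \<in> tuples U (m i))"
    and cons: "\<And>f :: nat \<Rightarrow> nat. consistent U k (\<pi> \<union> {(\<psi> i, b i j) | i j. i < n \<and> j < f i}
              \<union> {(Neg (\<psi> i), b i j) | i j. i < n \<and> j \<ge> f i})"
    using opD unfolding opD_ge_def by blast
  obtain B where B: "B \<subseteq> univ U" "|B| <o \<kappa>" "type_over L k B \<pi>"
    using \<pi> unfolding partial_type_def by blast
  define C where "C = (\<Union>i<n. \<Union>j. set (b i j))"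
  have C: "C \<subseteq> univ U" using * unfolding C_def tuples_def by auto
  have "countable C" unfolding C_def by (intro countable_UN countable_finite[OF finite_set]) auto
  have small: "|B \<union> C| <o \<kappa>"
    using small_Un_countable[OF _ monster_uncountable[OF U] B(2) \<open>countable C\<close>] U unfolding monster_def by blast
  have "\<exists>a. a \<in> realizations U k \<pi> \<and> (\<forall>i<n. \<forall>j. holds U (\<psi> i) (a @ b i j) \<longleftrightarrow> j < f i)" for f
  proof -
    let ?p = "\<pi> \<union> {(\<psi> i, b i j) | i j. i < n \<and> j < f i} \<union> {(Neg (\<psi> i), b i j) | i j. i < n \<and> j \<ge> f i}"
    have "formula L (k + length (b i j)) (\<psi> i) \<and> set (b i j) \<subseteq> B \<union> C" if "i < n" for i j
      using *[OF that] that unfolding C_def tuples_def by auto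
    moreover have "formula L k' (Neg \<phi>) = formula L k' \<phi>" for k' \<phi> by (simp add: formula_def)
    ultimately have "type_over L k (B \<union> C) ?p"
      using B(3) unfolding type_over_def by auto
    then have "realizations U k ?p \<noteq> {}"
      using U cons[of f] small B(1) C unfolding monster_def saturated_def by blast
    then obtain a where a: "a \<in> realizations U k ?p" by blast
    have mem: "holds U \<phi> (a @ q)" if "(\<phi>, q) \<in> ?p" for \<phi> q
      using a that unfolding realizations_def by blast
    have "a \<in> realizations U k \<pi>" using a unfolding realizations_def by blast
    moreover have "holds U (\<psi> i) (a @ b i j) \<longleftrightarrow> j < f i" if "i < n" for i j
    proof (cases "j < f i")
      case True
      then have "(\<psi> i, b i j) \<in> ?p" using that by blast
      from mem[OF this] True show ?thesis by simp
    next
      case False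
      then have "(Neg (\<psi> i), b i j) \<in> ?p" using that by (auto simp: not_less)
      from mem[OF this] False show ?thesis by simp
    qed
    ultimately show ?thesis by blast
  qed
  then have "\<exists>\<alpha>. \<forall>f. \<alpha> f \<in> realizations U k \<pi> \<and> (\<forall>i<n. \<forall>j. holds U (\<psi> i) (\<alpha> f @ b i j) \<longleftrightarrow> j < f i)"
    by (rule choice[OF allI])
  moreover have "\<forall>i<n. formula L (k + m i) (\<psi> i) \<and> (\<forall>j. b i j \<in> tuples U (m i))" using * by simp
  ultimately show ?thesis by blast
qed

text \<open>Any finitely many of these conditions hold for the family \<open>\<alpha>\<close> of realizations of the pattern, read
  along a placement of the points given by Ramsey's theorem.\<close>

proposition opD_ge_indiscernible_blocks:
  fixes c :: "nat \<Rightarrow> nat \<Rightarrow> rat" and U :: "('f, 'r, 'm) struct"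
  assumes U: "monster L T \<kappa> U" and \<pi>: "partial_type L \<kappa> U k \<pi>" and opD: "opD_ge L U k \<pi> n"
    and inj: "\<And>i. inj (\<lambda>s. c s i)"
  shows "\<exists>m \<psi> v. (\<forall>i<n. formula L (k + m i) (\<psi> i)) \<and> range v \<subseteq> univ U \<and>
    (\<forall>s. block k v s \<in> realizations U k \<pi>) \<and>
    (\<forall>i<n. \<forall>X Y. finite X \<and> finite Y \<and> (\<forall>s\<in>X. \<forall>t\<in>Y. c s i < c t i) \<longrightarrow>
      (\<exists>d\<in>tuples U (m i). (\<forall>s\<in>X. \<not> holds U (\<psi> i) (block k v s @ d)) \<and>
        (\<forall>s\<in>Y. holds U (\<psi> i) (block k v s @ d)))) \<and>
    (\<forall>ss ts. same_pattern n c ss ts \<longrightarrow>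
      same_tp L U (concat (map (block k v) ss)) (concat (map (block k v) ts)))"
proof -
  obtain m \<psi> b and \<alpha> :: "(nat \<Rightarrow> nat) \<Rightarrow> 'm list"
    where 1: "\<forall>i<n. formula L (k + m i) (\<psi> i) \<and> (\<forall>j. b i j \<in> tuples U (m i))"
    and 2: "\<forall>f. \<alpha> f \<in> realizations U k \<pi> \<and> (\<forall>i<n. \<forall>j. holds U (\<psi> i) (\<alpha> f @ b i j) \<longleftrightarrow> j < f i)"
    using opD_ge_realized[OF U \<pi> opD] by (elim exE conjE) (rule that)
  have \<psi>: "formula L (k + m i) (\<psi> i)" and b: "b i j \<in> tuples U (m i)" if "i < n" for i j
    using 1 that by simp_all
  have \<alpha>: "\<alpha> f \<in> realizations U k \<pi>" "i < n \<Longrightarrow> holds U (\<psi> i) (\<alpha> f @ b i j) \<longleftrightarrow> j < f i" for f i j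
    using 2 by simp_all
  obtain B where B: "B \<subseteq> univ U" "|B| <o \<kappa>" "type_over L k B \<pi>"
    using \<pi> unfolding partial_type_def by blast
  define real_c where "real_c N = {(\<lambda>v. holds U \<phi> (block k v s @ q)) | \<phi> q s. (\<phi>, q) \<in> \<pi> \<and> s < N}" for N
  define sep_c where "sep_c N = {(\<lambda>v. \<exists>d\<in>tuples U (m i). (\<forall>s\<in>X. \<not> holds U (\<psi> i) (block k v s @ d)) \<and>
        (\<forall>s\<in>Y. holds U (\<psi> i) (block k v s @ d))) | i X Y. i < n \<and> X \<subseteq> {..<N} \<and> Y \<subseteq> {..<N} \<and>
        (\<forall>s\<in>X. \<forall>t\<in>Y. c s i < c t i)}" for N
  define ind_c where "ind_c \<D> = {(\<lambda>v. holds U \<phi> (concat (map (block k v) ss)) \<longleftrightarrow>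
        holds U \<phi> (concat (map (block k v) ts))) | \<phi> ss ts. (\<phi>, ss, ts) \<in> \<D>}" for \<D>
  define data where "data N = {(\<phi>, ss, ts). formula L (length ss * k) \<phi> \<and> same_pattern n c ss ts \<and>
        set ss \<subseteq> {..<N} \<and> set ts \<subseteq> {..<N}}" for N
  define \<Gamma> where "\<Gamma> = (\<Union>N. real_c N \<union> sep_c N \<union> ind_c (data N))"
  have data_mono: "data N \<subseteq> data N'" if "N \<le> N'" for N N'
    unfolding data_def using that by force
  have real_mono: "real_c N \<subseteq> real_c N'" if "N \<le> N'" for N N'
    unfolding real_c_def using that by fastforce
  have sep_mono: "sep_c N \<subseteq> sep_c N'" if "N \<le> N'" for N N'
  proof -
    have "{..<N} \<subseteq> {..<N'}" using that by auto
    then show ?thesis unfolding sep_c_def by (smt (verit) Collect_mono subset_trans)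
  qed
  have ind_mono: "ind_c D \<subseteq> ind_c D'" if "D \<subseteq> D'" for D D'
    unfolding ind_c_def using that by blast
  \<comment> \<open>Ramsey's theorem needs finitely many formulas, so only the conditions on types
    are cut down to a finite set \<open>D\<close>. The other two families will be satisfied as a
    whole once the number of points is bounded.\<close>
  have cover: "\<exists>N D. finite D \<and> D \<subseteq> data N \<and> \<Gamma>' \<subseteq> real_c N \<union> sep_c N \<union> ind_c D"
    if "finite \<Gamma>'" "\<Gamma>' \<subseteq> \<Gamma>" for \<Gamma>'
    using that
  proof (induction \<Gamma>' rule: finite_induct)
    case (insert G \<Gamma>')
    then obtain N D where ND: "finite D" "D \<subseteq> data N" "\<Gamma>' \<subseteq> real_c N \<union> sep_c N \<union> ind_c D" by auto
    obtain N' where "G \<in> real_c N' \<union> sep_c N' \<union> ind_c (data N')" using insert.prems unfolding \<Gamma>_def by auto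
    then obtain D' where D': "finite D'" "D' \<subseteq> data N'" "G \<in> real_c N' \<union> sep_c N' \<union> ind_c D'"
    proof (elim UnE)
      assume "G \<in> ind_c (data N')"
      then obtain \<phi> ss ts where "(\<phi>, ss, ts) \<in> data N'" "G \<in> ind_c {(\<phi>, ss, ts)}" unfolding ind_c_def by blast
      then show thesis using that[of "{(\<phi>, ss, ts)}"] by auto
    qed (use that[of "{}"] in auto)
    have "finite (D \<union> D')" "D \<union> D' \<subseteq> data (max N N')"
      using ND(1,2) D'(1,2) data_mono[of N "max N N'"] data_mono[of N' "max N N'"] by auto
    moreover have "insert G \<Gamma>' \<subseteq> real_c (max N N') \<union> sep_c (max N N') \<union> ind_c (D \<union> D')"
      using ND(3) D'(3) real_mono[of N "max N N'"] real_mono[of N' "max N N'"] sep_mono[of N "max N N'"]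
        sep_mono[of N' "max N N'"] ind_mono[of D "D \<union> D'"] ind_mono[of D' "D \<union> D'"] by auto
    ultimately show ?case by blast
  qed auto
  have def: "vdef L U B G" if G_mem: "G \<in> \<Gamma>" for G
  proof -
    obtain N where "G \<in> real_c N \<union> sep_c N \<union> ind_c (data N)" using G_mem unfolding \<Gamma>_def by auto
    then show ?thesis
    proof (elim UnE)
      assume "G \<in> real_c N"
      then obtain \<phi> q s where G: "G = (\<lambda>v. holds U \<phi> (block k v s @ q))" "(\<phi>, q) \<in> \<pi>" unfolding real_c_def by blast
      have "formula L (length [s * k..<s * k + k] + length q) \<phi>" "set q \<subseteq> B"
        using B(3) G(2) unfolding type_over_def by auto
      from vdef_holds[OF this] show ?thesis unfolding G(1) block_def .
    next
      assume "G \<in> sep_c N"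
      then obtain i X Y where G: "G = (\<lambda>v. \<exists>d\<in>tuples U (m i). (\<forall>s\<in>X. \<not> holds U (\<psi> i) (block k v s @ d)) \<and>
        (\<forall>s\<in>Y. holds U (\<psi> i) (block k v s @ d)))" and i: "i < n" and XY: "X \<subseteq> {..<N}" "Y \<subseteq> {..<N}"
        unfolding sep_c_def by blast
      from XY have "finite X" "finite Y" by (auto intro: finite_subset)
      from vdef_separated[OF \<psi>[OF i] this] show ?thesis unfolding G .
    next
      assume "G \<in> ind_c (data N)"
      then obtain \<phi> ss ts where G: "G = (\<lambda>v. holds U \<phi> (concat (map (block k v) ss)) \<longleftrightarrow>
          holds U \<phi> (concat (map (block k v) ts)))" "formula L (length ss * k) \<phi>" "same_pattern n c ss ts"
        unfolding ind_c_def data_def by blast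
      have "vdef L U B (\<lambda>v. holds U \<phi> (concat (map (block k v) rs)))" if "length rs = length ss" for rs
        using vdef_holds[of L "concat (map (\<lambda>s. [s * k..<s * k + k]) rs)" "[]" \<phi> B U] G(2) that
        unfolding concat_blocks length_concat_blocks by simp
      then show ?thesis unfolding G(1) using G(3) by (intro vdef_iff) (auto simp: same_pattern_def)
    qed
  qed
  have fin: "\<exists>v. range v \<subseteq> univ U \<and> (\<forall>G\<in>\<Gamma>'. G v)" if \<Gamma>': "\<Gamma>' \<subseteq> \<Gamma>" "finite \<Gamma>'" for \<Gamma>'
  proof -
    obtain N D where D: "finite D" "D \<subseteq> data N" "\<Gamma>' \<subseteq> real_c N \<union> sep_c N \<union> ind_c D"
      using cover[OF \<Gamma>'(2,1)] by blast
    have D_pat: "same_pattern n c ss ts \<and> set ss \<subseteq> {..<N} \<and> set ts \<subseteq> {..<N}" if "(\<phi>, ss, ts) \<in> D" for \<phi> ss ts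
      using that D(2) unfolding data_def by blast
    have "\<exists>e :: nat \<Rightarrow> nat \<Rightarrow> nat.
      (\<forall>i<n. \<forall>s<N. \<forall>t<N. c s i < c t i \<longrightarrow> e s i < e t i) \<and> (\<forall>s. \<forall>i<n. 0 < e s i) \<and>
      (\<forall>(\<phi>, ss, ts)\<in>D. holds U \<phi> (concat (map (\<lambda>s. \<alpha> (e s)) ss)) \<longleftrightarrow>
        holds U \<phi> (concat (map (\<lambda>s. \<alpha> (e s)) ts)))"
      by (rule ramsey_multi_order[where P = "\<lambda>\<phi> xs. holds U \<phi> (concat xs)", OF inj D(1)]) (rule D_pat)
    then obtain e :: "nat \<Rightarrow> nat \<Rightarrow> nat"
      where e1: "\<forall>i<n. \<forall>s<N. \<forall>t<N. c s i < c t i \<longrightarrow> e s i < e t i" and e2: "\<forall>s. \<forall>i<n. 0 < e s i"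
        and e3: "\<forall>(\<phi>, ss, ts)\<in>D. holds U \<phi> (concat (map (\<lambda>s. \<alpha> (e s)) ss)) \<longleftrightarrow>
          holds U \<phi> (concat (map (\<lambda>s. \<alpha> (e s)) ts))"
      by (elim exE conjE) (rule that)
    have e: "i < n \<Longrightarrow> s < N \<Longrightarrow> t < N \<Longrightarrow> c s i < c t i \<Longrightarrow> e s i < e t i" "i < n \<Longrightarrow> 0 < e s i"
      "(\<phi>, ss, ts) \<in> D \<Longrightarrow> holds U \<phi> (concat (map (\<lambda>s. \<alpha> (e s)) ss)) \<longleftrightarrow>
          holds U \<phi> (concat (map (\<lambda>s. \<alpha> (e s)) ts))" for i s t \<phi> ss ts
      using e1 e2 e3 by auto
    have \<alpha>k: "length (\<alpha> f) = k" "set (\<alpha> f) \<subseteq> univ U" for f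
      using \<alpha>(1) unfolding realizations_def tuples_def by auto
    obtain u where u: "u \<in> univ U" using U unfolding monster_def models_def is_struct_def by blast
    \<comment> \<open>For \<open>k = 0\<close> the blocks are empty and any value will do.\<close>
    define v where "v t = (if k = 0 then u else \<alpha> (e (t div k)) ! (t mod k))" for t
    have "v t \<in> univ U" for t
      using u \<alpha>k(2)[of "e (t div k)"] nth_mem[of "t mod k" "\<alpha> (e (t div k))"] \<alpha>k(1)
      unfolding v_def by (cases "k = 0") auto
    then have vU: "range v \<subseteq> univ U" by blast
    have block_v: "block k v s = \<alpha> (e s)" for s
      using \<alpha>k(1) unfolding block_def v_def by (intro nth_equalityI) auto
    have "G v" if "G \<in> \<Gamma>'" for G
    proof -
      from that D(3) have "G \<in> real_c N \<union> sep_c N \<union> ind_c D" by blast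
      then show ?thesis
      proof (elim UnE)
        assume "G \<in> real_c N"
        then obtain \<phi> q s where G: "G = (\<lambda>v. holds U \<phi> (block k v s @ q))" "(\<phi>, q) \<in> \<pi>" unfolding real_c_def by blast
        then show ?thesis using \<alpha>(1)[of "e s"] unfolding G(1) block_v realizations_def by blast
      next
        assume "G \<in> sep_c N"
        then obtain i X Y where G: "G = (\<lambda>v. \<exists>d\<in>tuples U (m i). (\<forall>s\<in>X. \<not> holds U (\<psi> i) (block k v s @ d)) \<and>
          (\<forall>s\<in>Y. holds U (\<psi> i) (block k v s @ d)))" and i: "i < n" and XY: "X \<subseteq> {..<N}" "Y \<subseteq> {..<N}"
          "\<forall>s\<in>X. \<forall>t\<in>Y. c s i < c t i"
          unfolding sep_c_def by blast
        have finX: "finite X" using XY(1) by (rule finite_subset) simp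
        \<comment> \<open>\<open>\<psi> i\<close> with \<open>b i l\<close> is true at a point
          exactly when \<open>l\<close> is below its \<open>i\<close>-th value. For empty
          \<open>X\<close> this gives \<open>l = 0\<close>, which works because all values are
          positive.\<close>
        define l where "l = Max (insert 0 ((\<lambda>s. e s i) ` X))"
        have "e s i \<le> l" if "s \<in> X" for s using finX that unfolding l_def by simp
        moreover have "l < e t i" if t: "t \<in> Y" for t
        proof -
          have "e s i < e t i" if "s \<in> X" for s using e(1)[OF i, of s t] that t XY by blast
          then show ?thesis unfolding l_def using finX e(2)[OF i] by simp
        qed
        ultimately show ?thesis unfolding G block_v using b[OF i, of l] \<alpha>(2)[OF i]
          by (intro bexI[of _ "b i l"]) (auto simp: not_less)
      next
        assume "G \<in> ind_c D"
        moreover have "block k v = (\<lambda>s. \<alpha> (e s))" using block_v by (rule ext)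
        ultimately show ?thesis unfolding ind_c_def using e(3) by auto
      qed
    qed
    with vU show ?thesis by blast
  qed
  have "\<exists>v. range v \<subseteq> univ U \<and> (\<forall>G\<in>\<Gamma>. G v)"
    using omega_saturation[OF _ _ monster_uncountable[OF U] B(1,2) def fin] U unfolding monster_def by blast
  then obtain v where v: "range v \<subseteq> univ U" "\<And>G. G \<in> \<Gamma> \<Longrightarrow> G v" by blast
  have "block k v s \<in> realizations U k \<pi>" for s
  proof -
    have "holds U \<phi> (block k v s @ q)" if "(\<phi>, q) \<in> \<pi>" for \<phi> q
    proof -
      have "(\<lambda>v. holds U \<phi> (block k v s @ q)) \<in> real_c (Suc s)" using that unfolding real_c_def by blast
      then have "(\<lambda>v. holds U \<phi> (block k v s @ q)) \<in> \<Gamma>" unfolding \<Gamma>_def by blast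
      from v(2)[OF this] show ?thesis .
    qed
    then show ?thesis using block_tuples[OF v(1)] unfolding realizations_def by auto
  qed
  moreover have "\<exists>d\<in>tuples U (m i). (\<forall>s\<in>X. \<not> holds U (\<psi> i) (block k v s @ d)) \<and>
        (\<forall>s\<in>Y. holds U (\<psi> i) (block k v s @ d))"
    if i: "i < n" and fin: "finite X" "finite Y" and less: "\<And>s t. s \<in> X \<Longrightarrow> t \<in> Y \<Longrightarrow> c s i < c t i" for i X Y
  proof -
    obtain N where "X \<union> Y \<subseteq> {..<N}" using finite_nat_bounded[of "X \<union> Y"] fin by auto
    then have "(\<lambda>v. \<exists>d\<in>tuples U (m i). (\<forall>s\<in>X. \<not> holds U (\<psi> i) (block k v s @ d)) \<and>
        (\<forall>s\<in>Y. holds U (\<psi> i) (block k v s @ d))) \<in> sep_c N"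
      unfolding sep_c_def using i less by blast
    then have "(\<lambda>v. \<exists>d\<in>tuples U (m i). (\<forall>s\<in>X. \<not> holds U (\<psi> i) (block k v s @ d)) \<and>
        (\<forall>s\<in>Y. holds U (\<psi> i) (block k v s @ d))) \<in> \<Gamma>"
      unfolding \<Gamma>_def by blast
    from v(2)[OF this] show ?thesis .
  qed
  moreover have "same_tp L U (concat (map (block k v) ss)) (concat (map (block k v) ts))"
    if st: "same_pattern n c ss ts" for ss ts
  proof -
    have len: "length (concat (map (block k v) rs)) = length rs * k" for rs
      unfolding concat_blocks by (simp add: length_concat_blocks)
    have "holds U \<phi> (concat (map (block k v) ss)) \<longleftrightarrow> holds U \<phi> (concat (map (block k v) ts))"
      if \<phi>: "formula L (length ss * k) \<phi>" for \<phi>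
    proof -
      obtain N where "set ss \<union> set ts \<subseteq> {..<N}" using finite_nat_bounded[of "set ss \<union> set ts"] by auto
      then have "(\<phi>, ss, ts) \<in> data N" using \<phi> st unfolding data_def by simp
      then have "(\<lambda>v. holds U \<phi> (concat (map (block k v) ss)) \<longleftrightarrow> holds U \<phi> (concat (map (block k v) ts)))
          \<in> ind_c (data N)" unfolding ind_c_def by blast
      then have "(\<lambda>v. holds U \<phi> (concat (map (block k v) ss)) \<longleftrightarrow> holds U \<phi> (concat (map (block k v) ts))) \<in> \<Gamma>"
        unfolding \<Gamma>_def by blast
      from v(2)[OF this] show ?thesis .
    qed
    then show ?thesis using st unfolding same_tp_def len same_pattern_def by auto
  qed
  moreover have "\<forall>i<n. formula L (k + m i) (\<psi> i)" using \<psi> by simp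
  ultimately show ?thesis using v(1)
    by (intro exI[of _ m] exI[of _ \<psi>] exI[of _ v] conjI) simp_all
qed

text \<open>After forgetting \<open><\<^sub>j\<close>, any subset of a finite set of points can be moved above the other points
  in the order \<open><\<^sub>j\<close>, so instances of \<open>\<psi>\<close> cut out all subsets.\<close>

proposition collapse_has_IP:
  fixes c :: "nat \<Rightarrow> nat \<Rightarrow> rat" and g :: "nat \<Rightarrow> 'b" and U :: "('f, 'r, 'm) struct"
  assumes U: "monster L T \<kappa> U" and g: "inj g" and j: "j < n" and k: "0 < k"
    and inj: "\<And>i. inj (\<lambda>m. c m i)"
    and dense: "\<And>n u v. (\<And>i. i < n \<Longrightarrow> u i < v i) \<Longrightarrow> \<exists>m. \<forall>i<n. u i < c m i \<and> c m i < v i"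
    and \<psi>: "formula L (k + m) \<psi>" and v: "range v \<subseteq> univ U"
    and sep: "\<And>X Y. finite X \<Longrightarrow> finite Y \<Longrightarrow> (\<And>s t. s \<in> X \<Longrightarrow> t \<in> Y \<Longrightarrow> c s j < c t j) \<Longrightarrow>
      \<exists>d\<in>tuples U m. (\<forall>s\<in>X. \<not> holds U \<psi> (block k v s @ d)) \<and> (\<forall>s\<in>Y. holds U \<psi> (block k v s @ d))"
    and ind: "indisc_picture L U k \<pi> ({..<n} - {j}) (coord_struct g c) (\<lambda>y. block k v (inv g y))"
  shows "has_IP U k m \<psi>"
proof -
  have shatter: "\<exists>d\<in>tuples U m. \<forall>s\<in>F. holds U \<psi> (block k v s @ d) \<longleftrightarrow> s \<in> S" if F: "finite F" for F S
  proof (cases "F = {}")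
    case True
    then show ?thesis using sep[of "{}" "{}"] by auto
  next
    case False
    \<comment> \<open>The copy of \<open>s\<close> stays just above \<open>s\<close> in the other
      orders. In the order \<open>j\<close> it moves above or below the reference point 0 according
      to membership in \<open>S\<close>, into a unit interval numbered by \<open>s\<close>; these
      intervals are disjoint, so copies of different points are different.\<close>
    have "\<exists>t. (\<forall>i<n. i \<noteq> j \<longrightarrow> c s i < c t i \<and> (\<forall>s'\<in>F. c s i < c s' i \<longrightarrow> c t i < c s' i)) \<and>
      (if s \<in> S then c 0 j + of_nat s < c t j \<and> c t j < c 0 j + of_nat s + 1
       else c 0 j - of_nat s - 1 < c t j \<and> c t j < c 0 j - of_nat s)" for s
    proof -
      have "\<exists>u v. u < v \<and> c s i \<le> u \<and> (\<forall>s'\<in>F. c s i < c s' i \<longrightarrow> v \<le> c s' i)" for i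
      proof -
        have "\<exists>u v. u < v \<and> (\<forall>a\<in>{c s i}. a \<le> u) \<and> (\<forall>b\<in>(\<lambda>s'. c s' i) ` {s' \<in> F. c s i < c s' i}. v \<le> b)"
          using F by (intro separate_finite_rats) auto
        then show ?thesis by (simp only: ball_simps mem_Collect_eq) blast
      qed
      then obtain u w where uw: "\<And>i. u i < w i \<and> c s i \<le> u i \<and> (\<forall>s'\<in>F. c s i < c s' i \<longrightarrow> w i \<le> c s' i)"
        by metis
      define lo where "lo i = (if i = j then if s \<in> S then c 0 j + of_nat s else c 0 j - of_nat s - 1 else u i)" for i
      define hi where "hi i = (if i = j then if s \<in> S then c 0 j + of_nat s + 1 else c 0 j - of_nat s else w i)" for i
      have "lo i < hi i" for i using uw[of i] unfolding lo_def hi_def by simp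
      then obtain t where t: "\<forall>i<n. lo i < c t i \<and> c t i < hi i"
        using dense[of n lo hi] by blast
      have "c s i < c t i \<and> (\<forall>s'\<in>F. c s i < c s' i \<longrightarrow> c t i < c s' i)" if "i < n" "i \<noteq> j" for i
        using t[rule_format, OF that(1)] uw[of i] that(2) unfolding lo_def hi_def by (auto intro: le_less_trans less_le_trans)
      moreover have "lo j < c t j" "c t j < hi j" using t j by auto
      ultimately show ?thesis unfolding lo_def hi_def by (intro exI[of _ t]) auto
    qed
    then obtain t where t: "\<And>s i. i < n \<Longrightarrow> i \<noteq> j \<Longrightarrow> c s i < c (t s) i"
      "\<And>s i s'. i < n \<Longrightarrow> i \<noteq> j \<Longrightarrow> s' \<in> F \<Longrightarrow> c s i < c s' i \<Longrightarrow> c (t s) i < c s' i"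
      "\<And>s. s \<in> S \<Longrightarrow> c 0 j + of_nat s < c (t s) j \<and> c (t s) j < c 0 j + of_nat s + 1"
      "\<And>s. s \<notin> S \<Longrightarrow> c 0 j - of_nat s - 1 < c (t s) j \<and> c (t s) j < c 0 j - of_nat s"
      by metis
    have t_S: "c 0 j < c (t s) j" if "s \<in> S" for s using t(3)[OF that] of_nat_0_le_iff[of s] by linarith
    have t_nS: "c (t s) j < c 0 j" if "s \<notin> S" for s using t(4)[OF that] of_nat_0_le_iff[of s] by linarith
    have t_ne: "t s \<noteq> t s'" if "s < s'" for s s'
    proof -
      have le: "of_nat s + 1 \<le> (of_nat s' :: rat)" using that by (metis Suc_leI of_nat_Suc of_nat_le_iff add.commute)
      show ?thesis
      proof (cases "s \<in> S \<longleftrightarrow> s' \<in> S")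
        case True
        then show ?thesis using t(3)[of s] t(3)[of s'] t(4)[of s] t(4)[of s'] le by (cases "s \<in> S") force+
      next
        case False
        then show ?thesis using t_S[of s] t_S[of s'] t_nS[of s] t_nS[of s'] by (metis less_asym)
      qed
    qed
    then have t_inj: "t s = t s' \<longleftrightarrow> s = s'" for s s' by (metis linorder_neqE_nat)
    have c_eq: "c s i = c s' i \<longleftrightarrow> s = s'" for s s' i using inj[of i] unfolding inj_def by blast
    have t_lt: "c (t s) i < c (t s') i" if "i < n" "i \<noteq> j" "s \<in> F" "s' \<in> F" "c s i < c s' i" for s s' i
      using t(2)[OF that(1,2,4,5)] t(1)[OF that(1,2), of s'] by (rule less_trans)
    have t_iff: "c s i < c s' i \<longleftrightarrow> c (t s) i < c (t s') i" if "i < n" "i \<noteq> j" "s \<in> F" "s' \<in> F" for s s' i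
      using t_lt[OF that] t_lt[OF that(1,2,4,3)] c_eq[of s i s'] by (metis less_asym linorder_neqE less_irrefl)
    obtain ss where ss: "set ss = F" using finite_list[OF F] by blast
    let ?A = "coord_struct g c" and ?I = "\<lambda>y. block k v (inv g y)"
    have tup: "map g rs \<in> tuples ?A (length rs)" for rs unfolding tuples_def by auto
    have mem: "ss ! p \<in> F" if "p < length ss" for p using that ss by auto
    have "same_qftp (mlo_lang ({..<n} - {j})) ?A (map g ss) (map g (map t ss))"
      by (subst same_qftp_mlo) (auto simp: lt_coord_struct[OF g] inj_eq[OF g] t_inj t_iff mem)
    moreover have "0 < length ss" using ss False by auto
    ultimately have tp: "same_tp L U (concat (map ?I (map g ss))) (concat (map ?I (map g (map t ss))))"
      using ind tup[of ss] tup[of "map t ss"] unfolding indisc_picture_def by (metis length_map)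
    define X where "X = {p. p < length ss \<and> ss ! p \<notin> S}"
    define Y where "Y = {p. p < length ss \<and> ss ! p \<in> S}"
    have XY: "finite X" "finite Y" unfolding X_def Y_def by auto
    \<comment> \<open>The condition speaks of positions in \<open>ss\<close> rather than of points,
      so it applies to the tuple and to its copy. Separation in the order \<open>j\<close> gives it
      for the copy, and equality of types brings it back.\<close>
    define G where "G v \<longleftrightarrow> (\<exists>d\<in>tuples U m. (\<forall>s\<in>X. \<not> holds U \<psi> (block k v s @ d)) \<and>
      (\<forall>s\<in>Y. holds U \<psi> (block k v s @ d)))" for v
    have blk: "block k (nth (concat (map ?I (map g rs)))) p = block k v (rs ! p)" if "p < length rs" for rs p
      by (subst block_concat[where k = k]) (use that in \<open>auto simp: inv_f_f[OF g]\<close>)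
    have len: "length (concat (map ?I (map g ss))) = length ss * k"
      using length_concat_blocks by (simp add: comp_def inv_f_f[OF g] concat_blocks)
    have "G (nth (concat (map ?I (map g ss)))) \<longleftrightarrow> G (nth (concat (map ?I (map g (map t ss)))))"
    proof (rule same_tp_vdef[OF tp])
      show "vdef L U {} G" unfolding G_def[abs_def] by (rule vdef_separated[OF \<psi> XY])
      show "0 < length (concat (map ?I (map g ss)))" unfolding len using k \<open>0 < length ss\<close> by simp
      fix v w :: "nat \<Rightarrow> 'm" assume vw: "\<forall>i<length (concat (map ?I (map g ss))). v i = w i"
      have "block k v p = block k w p" if "p \<in> X \<union> Y" for p
      proof -
        have "p * k + k \<le> length ss * k"
          using mult_le_mono1[of "Suc p" "length ss" k] that unfolding X_def Y_def by auto
        then show ?thesis using vw unfolding len by (auto simp: block_def)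
      qed
      then show "G v = G w" unfolding G_def by auto
    qed
    moreover have "G (nth (concat (map ?I (map g (map t ss)))))"
    proof -
      obtain d where "d \<in> tuples U m" "\<forall>s\<in>t ` (F - S). \<not> holds U \<psi> (block k v s @ d)"
          "\<forall>s\<in>t ` (F \<inter> S). holds U \<psi> (block k v s @ d)"
      proof -
        have "\<exists>d\<in>tuples U m. (\<forall>s\<in>t ` (F - S). \<not> holds U \<psi> (block k v s @ d)) \<and>
          (\<forall>s\<in>t ` (F \<inter> S). holds U \<psi> (block k v s @ d))"
          using F t_S t_nS by (intro sep) (auto intro: less_trans)
        then show thesis using that by blast
      qed
      then show ?thesis unfolding G_def
        using blk[of _ "map t ss"] mem
        by (intro bexI[of _ d]) (auto simp: X_def Y_def simp del: map_map)
    qed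
    ultimately have "G (nth (concat (map ?I (map g ss))))" by blast
    then obtain d where d: "d \<in> tuples U m" "\<And>p. p \<in> X \<Longrightarrow> \<not> holds U \<psi> (block k v (ss ! p) @ d)"
        "\<And>p. p \<in> Y \<Longrightarrow> holds U \<psi> (block k v (ss ! p) @ d)"
      unfolding G_def using blk[of _ ss] by (auto simp: X_def Y_def simp del: map_map)
    have "holds U \<psi> (block k v s @ d) \<longleftrightarrow> s \<in> S" if s: "s \<in> F" for s
    proof -
      obtain p where "p < length ss" "s = ss ! p" using s unfolding ss[symmetric] in_set_conv_nth by blast
      then show ?thesis using d(2,3)[of p] unfolding X_def Y_def by blast
    qed
    with d(1) show ?thesis by blast
  qed
  \<comment> \<open>In \<open>realizations\<close> the unknown tuple precedes the parameters. Here
    \<open>d\<close> is sought and the blocks are parameters, so the two groups of variables of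
    \<psi> are exchanged.\<close>
  define swap where "swap i = (if i < k then m + i else i - k)" for i
  obtain \<psi>' where \<psi>': "wf_fm L \<psi>'" "fv \<psi>' \<subseteq> swap ` fv \<psi>" "\<forall>v. sat U v \<psi>' = sat U (v \<circ> swap) \<psi>"
    using ex_rename[of L \<psi>] \<psi> unfolding formula_def by metis
  have f\<psi>': "formula L (m + k) \<psi>'" using \<psi>'(1,2) \<psi> unfolding formula_def swap_def by force
  have holds': "holds U \<psi>' (d @ a) \<longleftrightarrow> holds U \<psi> (a @ d)" if "length a = k" "length d = m" for a d
  proof -
    have "sat U (nth (d @ a) \<circ> swap) \<psi> = sat U (nth (a @ d)) \<psi>"
      using \<psi> that unfolding formula_def swap_def by (intro sat_cong) (auto simp: nth_append)
    with \<psi>'(3) show ?thesis by simp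
  qed
  have "\<exists>d\<in>tuples U m. \<forall>s. holds U \<psi> (block k v s @ d) \<longleftrightarrow> s \<in> S" for S
  proof -
    \<comment> \<open>Compactness passes from finite sets of blocks to the whole sequence, as
      \<open>has_IP\<close> asks for every subset of the natural numbers.\<close>
    define q where "q s = (if s \<in> S then \<psi>' else Neg \<psi>', block k v s)" for s
    have q: "(case q s of (\<phi>, a) \<Rightarrow> holds U \<phi> (d @ a)) \<longleftrightarrow> (holds U \<psi> (block k v s @ d) \<longleftrightarrow> s \<in> S)"
      if "d \<in> tuples U m" for s d
      using holds'[of "block k v s" d] that unfolding q_def tuples_def by simp
    have "type_over L m (range v) (range q)"
      using f\<psi>' unfolding type_over_def q_def block_def by (auto simp: formula_def)
    moreover have "consistent U m (range q)"
      unfolding consistent_def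
    proof (intro allI impI)
      fix \<pi>0 assume "\<pi>0 \<subseteq> range q \<and> finite \<pi>0"
      then obtain F where F: "finite F" "\<pi>0 = q ` F" by (meson finite_subset_image)
      obtain d where d: "d \<in> tuples U m" "\<forall>s\<in>F. holds U \<psi> (block k v s @ d) \<longleftrightarrow> s \<in> S"
        using shatter[OF F(1)] by blast
      then have "d \<in> realizations U m \<pi>0" unfolding realizations_def F(2) using q[OF d(1)] by simp
      then show "realizations U m \<pi>0 \<noteq> {}" by blast
    qed
    moreover have "|range v| <o \<kappa>"
      using ordLeq_ordLess_trans[OF card_of_image monster_uncountable[OF U]] .
    ultimately have "realizations U m (range q) \<noteq> {}"
      using U v unfolding monster_def saturated_def by blast
    then obtain d where "d \<in> realizations U m (range q)" by (meson ex_in_conv)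
    then have d: "d \<in> tuples U m" "\<forall>x\<in>range q. case x of (\<phi>, a) \<Rightarrow> holds U \<phi> (d @ a)"
      unfolding realizations_def by simp_all
    have "holds U \<psi> (block k v s @ d) \<longleftrightarrow> s \<in> S" for s
      using bspec[OF d(2) rangeI[of q s]] q[OF d(1)] by (rule iffD1[rotated])
    with d(1) show ?thesis by blast
  qed
  then have "\<forall>S. \<exists>d. d \<in> tuples U m \<and> (\<forall>s. holds U \<psi> (block k v s @ d) \<longleftrightarrow> s \<in> S)"
    unfolding Bex_def ..
  from choice[OF this] obtain d
    where d: "\<forall>S. d S \<in> tuples U m \<and> (\<forall>s. holds U \<psi> (block k v s @ d S) \<longleftrightarrow> s \<in> S)" ..
  show ?thesis unfolding has_IP_def
    using block_tuples[OF v] d by (intro exI[of _ "block k v"] exI[of _ d]) simp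
qed

text \<open>The points of the domain are the values of \<open>e\<close> at the blocks themselves. A
  type with room for the k-tuples of \<open>U\<close> therefore has room for this countable
  model.\<close>

proposition opD_ge_non_collapse:
  fixes U :: "('f, 'r, 'm) struct" and e :: "'m list \<Rightarrow> 'b"
  assumes U: "monster L T \<kappa> U" and nip: "NIP L U" and \<pi>: "partial_type L \<kappa> U k \<pi>" and n: "0 < n"
    and e: "inj_on e (tuples U k)" and opD: "opD_ge L U k \<pi> n"
  shows "\<exists>(A :: (unit, nat, 'b) struct) I. models (mlo_lang {..<n}) A (T_mlo_star n) \<and>
    indisc_picture L U k \<pi> {..<n} A I \<and> (\<forall>j<n. \<not> indisc_picture L U k \<pi> ({..<n} - {j}) A I)"
proof -
  obtain c :: "nat \<Rightarrow> nat \<Rightarrow> rat" where c: "\<And>i. inj (\<lambda>m. c m i)"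
    "\<And>n u v. (\<And>i. i < n \<Longrightarrow> u i < v i) \<Longrightarrow> \<exists>m. \<forall>i<n. u i < c m i \<and> c m i < v i"
    by (rule ex_dense_generic_sequence) blast
  obtain m \<psi> v where 1: "\<forall>i<n. formula L (k + m i) (\<psi> i)" and v: "range v \<subseteq> univ U"
    and 2: "\<forall>s. block k v s \<in> realizations U k \<pi>"
    and 3: "\<forall>i<n. \<forall>X Y. finite X \<and> finite Y \<and> (\<forall>s\<in>X. \<forall>t\<in>Y. c s i < c t i) \<longrightarrow>
      (\<exists>d\<in>tuples U (m i). (\<forall>s\<in>X. \<not> holds U (\<psi> i) (block k v s @ d)) \<and>
        (\<forall>s\<in>Y. holds U (\<psi> i) (block k v s @ d)))"
    and 4: "\<forall>ss ts. same_pattern n c ss ts \<longrightarrow>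
      same_tp L U (concat (map (block k v) ss)) (concat (map (block k v) ts))"
    using opD_ge_indiscernible_blocks[OF U \<pi> opD, of c, OF c(1)] by (elim exE conjE) (rule that)
  have \<psi>: "formula L (k + m i) (\<psi> i)" if "i < n" for i using 1 that by simp
  have real: "block k v s \<in> realizations U k \<pi>" for s using 2 by simp
  have sep: "\<exists>d\<in>tuples U (m i). (\<forall>s\<in>X. \<not> holds U (\<psi> i) (block k v s @ d)) \<and>
      (\<forall>s\<in>Y. holds U (\<psi> i) (block k v s @ d))"
    if "i < n" "finite X" "finite Y" "\<And>s t. s \<in> X \<Longrightarrow> t \<in> Y \<Longrightarrow> c s i < c t i" for i X Y
    using 3 that by simp
  have tp: "same_tp L U (concat (map (block k v) ss)) (concat (map (block k v) ts))"
    if "same_pattern n c ss ts" for ss ts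
    using 4 that by simp
  have c_eq: "c s i = c t i \<longleftrightarrow> s = t" for s t i using c(1)[of i] unfolding inj_def by blast
  \<comment> \<open>\<open>\<psi> 0\<close> separates any two points in the order 0. This makes the
    picture injective and excludes \<open>k = 0\<close>, where all blocks coincide.\<close>
  have "block k v s \<noteq> block k v t" if "c s 0 < c t 0" for s t
  proof -
    have "\<exists>d\<in>tuples U (m 0). (\<forall>s\<in>{s}. \<not> holds U (\<psi> 0) (block k v s @ d)) \<and>
        (\<forall>s\<in>{t}. holds U (\<psi> 0) (block k v s @ d))"
      using that by (intro sep n) auto
    then show ?thesis by auto
  qed
  then have block_inj: "block k v s = block k v t \<longleftrightarrow> s = t" for s t
    using c_eq[of s 0 t] by (metis linorder_neqE)
  have k: "0 < k" using block_inj[of 0 1] by (cases k) (auto simp: block_def)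
  define g where "g s = e (block k v s)" for s
  have g: "inj g"
    using inj_onD[OF e] block_tuples[OF v] block_inj unfolding g_def inj_def by blast
  let ?A = "coord_struct g c" and ?I = "\<lambda>y. block k v (inv g y)"
  obtain F where "mlo_fraisse_limit n F" by (rule ex_fraisse_limit[OF n])
  from rich_models_T_mlo_star[OF n this rich_coord_struct[OF g c]]
  have "models (mlo_lang {..<n}) ?A (T_mlo_star n)" .
  moreover have "indisc_picture L U k \<pi> {..<n} ?A ?I"
    unfolding indisc_picture_def
  proof (intro conjI allI impI ballI)
    show "inj_on ?I (univ ?A)" by (rule inj_onI) (auto simp: block_inj inv_f_f[OF g])
    show "?I ` univ ?A \<subseteq> realizations U k \<pi>" using real by auto
    fix l :: nat and a b :: "'b list" assume ab: "a \<in> tuples ?A l" "b \<in> tuples ?A l"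
      and qf: "same_qftp (mlo_lang {..<n}) ?A a b"
    have sub: "set a \<subseteq> univ ?A" "set b \<subseteq> univ ?A" using ab unfolding tuples_def by auto
    then obtain ss ts where st: "a = map g ss" "b = map g ts" by (metis ex_map_conv subsetD rangeE univ_coord_struct)
    have "same_pattern n c ss ts"
      using qf unfolding same_qftp_mlo[OF sub] unfolding st same_pattern_def by (auto simp: lt_coord_struct[OF g])
    from tp[OF this] show "same_tp L U (concat (map ?I a)) (concat (map ?I b))"
      unfolding st by (simp add: comp_def inv_f_f[OF g])
  qed
  moreover have "\<not> indisc_picture L U k \<pi> ({..<n} - {j}) ?A ?I" if j: "j < n" for j
    using collapse_has_IP[OF U g j k c \<psi>[OF j] v sep[OF j]] nip \<psi>[OF j] unfolding NIP_def by blast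
  ultimately show ?thesis by blast
qed

theorem theorem3p4:
  fixes L :: "('f, 'r) lang" and T :: "('f, 'r) fm set"
    and \<kappa> :: "'k rel" and U :: "('f, 'r, 'm) struct"
    and k n :: nat and \<pi> :: "('f, 'r, 'm) ptype"
  assumes "complete_theory L T"
    and "monster L T \<kappa> U"
    and "NIP L U"
    and "partial_type L \<kappa> U k \<pi>"
    and "0 < n"
    (* the type 'b has room for a copy of every structure that injects into \<pi>(U) *)
    and "\<exists>e :: 'm list \<Rightarrow> 'b. inj_on e (tuples U k)"
  shows "\<not> opD_ge L U k \<pi> n \<longleftrightarrow>
    (\<forall>(A :: (unit, nat, 'b) struct) I.
       models (mlo_lang {..<n}) A (T_mlo_star n) \<and> indisc_picture L U k \<pi> {..<n} A I \<longrightarrow>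
       (\<exists>j<n. indisc_picture L U k \<pi> ({..<n} - {j}) A I))"
proof -
  have U: "monster L T \<kappa> U" and nip: "NIP L U" and \<pi>: "partial_type L \<kappa> U k \<pi>" and n: "0 < n"
    by fact+
  obtain e :: "'m list \<Rightarrow> 'b" where e: "inj_on e (tuples U k)" using assms(6) by blast
  show ?thesis
  proof
    assume no: "\<not> opD_ge L U k \<pi> n"
    show "\<forall>(A :: (unit, nat, 'b) struct) I.
       models (mlo_lang {..<n}) A (T_mlo_star n) \<and> indisc_picture L U k \<pi> {..<n} A I \<longrightarrow>
       (\<exists>j<n. indisc_picture L U k \<pi> ({..<n} - {j}) A I)"
    proof (intro allI impI)
      fix A :: "(unit, nat, 'b) struct" and I
      assume *: "models (mlo_lang {..<n}) A (T_mlo_star n) \<and> indisc_picture L U k \<pi> {..<n} A I"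
      have "rich n A" by (rule models_T_mlo_star_rich[OF n conjunct1[OF *]])
      from non_collapse_opD_ge[OF n this] * no
      show "\<exists>j<n. indisc_picture L U k \<pi> ({..<n} - {j}) A I" by blast
    qed
  next
    assume collapse: "\<forall>(A :: (unit, nat, 'b) struct) I.
       models (mlo_lang {..<n}) A (T_mlo_star n) \<and> indisc_picture L U k \<pi> {..<n} A I \<longrightarrow>
       (\<exists>j<n. indisc_picture L U k \<pi> ({..<n} - {j}) A I)"
    show "\<not> opD_ge L U k \<pi> n"
    proof
      assume "opD_ge L U k \<pi> n"
      from opD_ge_non_collapse[OF U nip \<pi> n e this] collapse show False by meson
    qed
  qed
qed

end
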